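(* The category $\mathcal{UF}^{\mathrm{op}}$ is equivalent to the full subcategory of $\mathsf{FC}(\mathbf{Set},\mathbf{Set})$ on the small-projective objects.
   Context: An object $X$ of a category $\mathcal E$ is small-projective if the hom-functor $\mathcal E(X,-)\colon\mathcal E\to\mathbf{Set}$ preserves all small colimits. $\mathsf{FC}(\mathbf{Set},\mathbf{Set})$ is the category of finite-coproduct-preserving endofunctors of $\mathbf{Set}$ and natural transformations. An ultrafilter on a set $X$ is a collection $\mathcal U$ of subsets of $X$ with $X\in\mathcal U$; $U\cap V\in\mathcal U$ iff ($U\in\mathcal U$ and $V\in\mathcal U$); and $U\in\mathcal U$ iff $X\setminus U\notin\mathcal U$. The category $\mathcal{UF}$ has as objects pairs $(X,\mathcal U)$ with $X$ a set and $\mathcal U$ an ultrafilter on $X$. A partial function $f\colon X\rightharpoonup Y$ defined on a set in $\mathcal U$ is continuous $(X,\mathcal U)\rightharpoonup(Y,\mathcal V)$ if for all $V\subseteq Y$: $V\in\mathcal V$ iff $f^{-1}(V)\in\mathcal U$. Two such partial functions are $=_{\mathcal U}$-equivalent if $\{x : f(x)\text{ and }g(x)\text{ are both defined and equal}\}\in\mathcal U$. Morphisms $(X,\mathcal U)\to(Y,\mathcal V)$ in $\mathcal{UF}$ are $=_{\mathcal U}$-equivalence classes of partial continuous functions defined on a set in $\mathcal U$. *)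

theory Defs
  imports "HOL-Library.FuncSet" "HOL-Library.Equipollence"
begin

section \<open>Smallness relative to a universe\<close>

text \<open>
  HOL has no type of all sets, so the size of the sets called small is measured by a type
  \<^typ>\<open>'u\<close>: a set (of elements of any type) is small when it has fewer elements than \<^typ>\<open>'u\<close>.
  If the cardinal of \<^typ>\<open>'u\<close> is strongly inaccessible, the small sets are, up to bijection,
  the members of a Grothendieck universe, and every small set has a copy inside \<^typ>\<open>'u\<close>.
  HOL cannot prove any of its types to be of this size, so inaccessibility is a hypothesis
  on \<^typ>\<open>'u\<close> wherever it is used.
\<close>

definition small :: "'u itself \<Rightarrow> 'x set \<Rightarrow> bool" where
  "small u A \<longleftrightarrow> A \<prec> (UNIV :: 'u set)"

definition inaccessible :: "'u itself \<Rightarrow> bool" where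
  "inaccessible u \<longleftrightarrow>
     small u (UNIV :: nat set) \<and>
     (\<forall>A :: 'u set. small u A \<longrightarrow> small u (Pow A)) \<and>
     (\<forall>\<A> :: 'u set set. small u \<A> \<and> (\<forall>A\<in>\<A>. small u A) \<longrightarrow> small u (\<Union>\<A>))"


section \<open>Categories, functors, natural transformations\<close>

text \<open>
  The hom-sets of different pairs of objects may overlap; hence composition and the
  action of functors on arrows carry the objects as arguments:
  \<open>Comp C x y z g f\<close> is the composite of \<open>f \<in> Hom C x y\<close> and \<open>g \<in> Hom C y z\<close>.
\<close>

record ('o, 'a) cat =
  Ob :: "'o set"
  Hom :: "'o \<Rightarrow> 'o \<Rightarrow> 'a set"
  Id :: "'o \<Rightarrow> 'a"
  Comp :: "'o \<Rightarrow> 'o \<Rightarrow> 'o \<Rightarrow> 'a \<Rightarrow> 'a \<Rightarrow> 'a"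

definition category :: "('o, 'a) cat \<Rightarrow> bool" where
  "category C \<longleftrightarrow>
     (\<forall>x\<in>Ob C. Id C x \<in> Hom C x x) \<and>
     (\<forall>x\<in>Ob C. \<forall>y\<in>Ob C. \<forall>z\<in>Ob C. \<forall>f\<in>Hom C x y. \<forall>g\<in>Hom C y z.
        Comp C x y z g f \<in> Hom C x z) \<and>
     (\<forall>x\<in>Ob C. \<forall>y\<in>Ob C. \<forall>f\<in>Hom C x y.
        Comp C x x y f (Id C x) = f \<and> Comp C x y y (Id C y) f = f) \<and>
     (\<forall>w\<in>Ob C. \<forall>x\<in>Ob C. \<forall>y\<in>Ob C. \<forall>z\<in>Ob C.
        \<forall>f\<in>Hom C w x. \<forall>g\<in>Hom C x y. \<forall>h\<in>Hom C y z.
        Comp C w x z (Comp C x y z h g) f = Comp C w y z h (Comp C w x y g f))"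

definition op_cat :: "('o, 'a) cat \<Rightarrow> ('o, 'a) cat" where
  "op_cat C = \<lparr>Ob = Ob C, Hom = (\<lambda>x y. Hom C y x), Id = Id C,
               Comp = (\<lambda>x y z g f. Comp C z y x f g)\<rparr>"

definition full_subcat :: "('o, 'a) cat \<Rightarrow> ('o \<Rightarrow> bool) \<Rightarrow> ('o, 'a) cat" where
  "full_subcat C P = C\<lparr>Ob := {x \<in> Ob C. P x}\<rparr>"

definition is_iso :: "('o, 'a) cat \<Rightarrow> 'o \<Rightarrow> 'o \<Rightarrow> 'a \<Rightarrow> bool" where
  "is_iso C x y f \<longleftrightarrow> f \<in> Hom C x y \<and>
     (\<exists>g\<in>Hom C y x. Comp C x y x g f = Id C x \<and> Comp C y x y f g = Id C y)"

record ('o, 'a, 'p, 'b) ftor =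
  on_ob :: "'o \<Rightarrow> 'p"
  on_hom :: "'o \<Rightarrow> 'o \<Rightarrow> 'a \<Rightarrow> 'b"

definition is_functor ::
    "('o, 'a) cat \<Rightarrow> ('p, 'b) cat \<Rightarrow> ('o, 'a, 'p, 'b) ftor \<Rightarrow> bool" where
  "is_functor C D F \<longleftrightarrow>
     (\<forall>x\<in>Ob C. on_ob F x \<in> Ob D) \<and>
     (\<forall>x\<in>Ob C. \<forall>y\<in>Ob C. \<forall>f\<in>Hom C x y. on_hom F x y f \<in> Hom D (on_ob F x) (on_ob F y)) \<and>
     (\<forall>x\<in>Ob C. on_hom F x x (Id C x) = Id D (on_ob F x)) \<and>
     (\<forall>x\<in>Ob C. \<forall>y\<in>Ob C. \<forall>z\<in>Ob C. \<forall>f\<in>Hom C x y. \<forall>g\<in>Hom C y z.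
        on_hom F x z (Comp C x y z g f) =
        Comp D (on_ob F x) (on_ob F y) (on_ob F z) (on_hom F y z g) (on_hom F x y f))"

text \<open>
  \<open>is_functor\<close> ignores the values outside \<open>C\<close>.  Where functors are themselves objects of a
  category, these values are fixed, so that record equality is equality of functors.
\<close>

definition functor_ext :: "('o, 'a) cat \<Rightarrow> ('o, 'a, 'p, 'b) ftor \<Rightarrow> bool" where
  "functor_ext C F \<longleftrightarrow>
     on_ob F \<in> extensional (Ob C) \<and>
     (\<forall>x y f. \<not> (x \<in> Ob C \<and> y \<in> Ob C \<and> f \<in> Hom C x y) \<longrightarrow> on_hom F x y f = undefined)"

definition id_ftor :: "('o, 'a, 'o, 'a) ftor" where
  "id_ftor = \<lparr>on_ob = (\<lambda>x. x), on_hom = (\<lambda>x y f. f)\<rparr>"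

definition comp_ftor ::
    "('p, 'b, 'q, 'c) ftor \<Rightarrow> ('o, 'a, 'p, 'b) ftor \<Rightarrow> ('o, 'a, 'q, 'c) ftor" where
  "comp_ftor G F =
     \<lparr>on_ob = (\<lambda>x. on_ob G (on_ob F x)),
      on_hom = (\<lambda>x y f. on_hom G (on_ob F x) (on_ob F y) (on_hom F x y f))\<rparr>"

definition nat_trans ::
    "('o, 'a) cat \<Rightarrow> ('p, 'b) cat \<Rightarrow> ('o, 'a, 'p, 'b) ftor \<Rightarrow> ('o, 'a, 'p, 'b) ftor \<Rightarrow>
     ('o \<Rightarrow> 'b) set" where
  "nat_trans C D F G =
     {\<alpha> \<in> (\<Pi>\<^sub>E x\<in>Ob C. Hom D (on_ob F x) (on_ob G x)).
        \<forall>x\<in>Ob C. \<forall>y\<in>Ob C. \<forall>f\<in>Hom C x y.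
          Comp D (on_ob F x) (on_ob F y) (on_ob G y) (\<alpha> y) (on_hom F x y f) =
          Comp D (on_ob F x) (on_ob G x) (on_ob G y) (on_hom G x y f) (\<alpha> x)}"

definition functor_cat ::
    "('o, 'a) cat \<Rightarrow> ('p, 'b) cat \<Rightarrow> (('o, 'a, 'p, 'b) ftor, 'o \<Rightarrow> 'b) cat" where
  "functor_cat C D =
     \<lparr>Ob = {F. is_functor C D F \<and> functor_ext C F},
      Hom = nat_trans C D,
      Id = (\<lambda>F. \<lambda>x\<in>Ob C. Id D (on_ob F x)),
      Comp = (\<lambda>F G H \<beta> \<alpha>. \<lambda>x\<in>Ob C.
        Comp D (on_ob F x) (on_ob G x) (on_ob H x) (\<beta> x) (\<alpha> x))\<rparr>"

definition nat_isomorphic ::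
    "('o, 'a) cat \<Rightarrow> ('p, 'b) cat \<Rightarrow> ('o, 'a, 'p, 'b) ftor \<Rightarrow> ('o, 'a, 'p, 'b) ftor \<Rightarrow> bool" where
  "nat_isomorphic C D F G \<longleftrightarrow>
     (\<exists>\<alpha>\<in>nat_trans C D F G. \<forall>x\<in>Ob C. is_iso D (on_ob F x) (on_ob G x) (\<alpha> x))"

definition equivalent_categories :: "('o, 'a) cat \<Rightarrow> ('p, 'b) cat \<Rightarrow> bool" where
  "equivalent_categories C D \<longleftrightarrow> category C \<and> category D \<and>
     (\<exists>F G. is_functor C D F \<and> is_functor D C G \<and>
        nat_isomorphic C C (comp_ftor G F) id_ftor \<and>
        nat_isomorphic D D (comp_ftor F G) id_ftor)"


section \<open>Coproducts and colimits\<close>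

definition is_coproduct ::
    "('o, 'a) cat \<Rightarrow> 'i set \<Rightarrow> ('i \<Rightarrow> 'o) \<Rightarrow> 'o \<Rightarrow> ('i \<Rightarrow> 'a) \<Rightarrow> bool" where
  "is_coproduct C I A c \<iota> \<longleftrightarrow>
     c \<in> Ob C \<and> (\<forall>i\<in>I. A i \<in> Ob C \<and> \<iota> i \<in> Hom C (A i) c) \<and>
     (\<forall>d\<in>Ob C. \<forall>\<kappa>. (\<forall>i\<in>I. \<kappa> i \<in> Hom C (A i) d) \<longrightarrow>
        (\<exists>!h. h \<in> Hom C c d \<and> (\<forall>i\<in>I. Comp C (A i) c d h (\<iota> i) = \<kappa> i)))"

definition preserves_finite_coproducts ::
    "('o, 'a) cat \<Rightarrow> ('p, 'b) cat \<Rightarrow> ('o, 'a, 'p, 'b) ftor \<Rightarrow> bool" where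
  "preserves_finite_coproducts C D F \<longleftrightarrow>
     (\<forall>(I :: nat set) A c \<iota>. finite I \<and> is_coproduct C I A c \<iota> \<longrightarrow>
        is_coproduct D I (\<lambda>i. on_ob F (A i)) (on_ob F c) (\<lambda>i. on_hom F (A i) c (\<iota> i)))"

definition is_cocone ::
    "('j, 'k) cat \<Rightarrow> ('o, 'a) cat \<Rightarrow> ('j, 'k, 'o, 'a) ftor \<Rightarrow> 'o \<Rightarrow> ('j \<Rightarrow> 'a) \<Rightarrow> bool" where
  "is_cocone J C D c \<iota> \<longleftrightarrow>
     c \<in> Ob C \<and> (\<forall>j\<in>Ob J. \<iota> j \<in> Hom C (on_ob D j) c) \<and>
     (\<forall>i\<in>Ob J. \<forall>j\<in>Ob J. \<forall>f\<in>Hom J i j.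
        Comp C (on_ob D i) (on_ob D j) c (\<iota> j) (on_hom D i j f) = \<iota> i)"

definition is_colimit ::
    "('j, 'k) cat \<Rightarrow> ('o, 'a) cat \<Rightarrow> ('j, 'k, 'o, 'a) ftor \<Rightarrow> 'o \<Rightarrow> ('j \<Rightarrow> 'a) \<Rightarrow> bool" where
  "is_colimit J C D c \<iota> \<longleftrightarrow> is_cocone J C D c \<iota> \<and>
     (\<forall>d \<kappa>. is_cocone J C D d \<kappa> \<longrightarrow>
        (\<exists>!h. h \<in> Hom C c d \<and> (\<forall>j\<in>Ob J. Comp C (on_ob D j) c d h (\<iota> j) = \<kappa> j)))"

definition small_category :: "'u itself \<Rightarrow> ('o, 'a) cat \<Rightarrow> bool" where
  "small_category u J \<longleftrightarrow> category J \<and> small u (Ob J) \<and>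
     (\<forall>i\<in>Ob J. \<forall>j\<in>Ob J. small u (Hom J i j))"

text \<open>
  Every small category is isomorphic to one whose objects and arrows are elements of
  \<^typ>\<open>'u\<close>, so these suffice as shapes of small diagrams.
\<close>

definition preserves_small_colimits ::
    "'u itself \<Rightarrow> ('o, 'a) cat \<Rightarrow> ('p, 'b) cat \<Rightarrow> ('o, 'a, 'p, 'b) ftor \<Rightarrow> bool" where
  "preserves_small_colimits u C D F \<longleftrightarrow>
     (\<forall>(J :: ('u, 'u) cat) T c \<iota>.
        small_category u J \<and> is_functor J C T \<and> is_colimit J C T c \<iota> \<longrightarrow>
        is_colimit J D (comp_ftor F T) (on_ob F c) (\<lambda>j. on_hom F (on_ob T j) c (\<iota> j)))"


section \<open>The category of sets and small-projective objects\<close>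

text \<open>
  Small sets with elements in \<^typ>\<open>'x\<close>.  If \<^typ>\<open>'x\<close> has at least as many elements as
  \<^typ>\<open>'u\<close>, every small set is isomorphic to one of these, and different choices of
  \<^typ>\<open>'x\<close> give equivalent categories.
\<close>

definition set_cat :: "'u itself \<Rightarrow> ('x set, 'x \<Rightarrow> 'x) cat" where
  "set_cat u = \<lparr>Ob = {A. small u A}, Hom = (\<lambda>A B. A \<rightarrow>\<^sub>E B), Id = (\<lambda>A. \<lambda>x\<in>A. x),
                Comp = (\<lambda>A B C g f. compose A g f)\<rparr>"

definition hom_ftor :: "('o, 'a) cat \<Rightarrow> 'o \<Rightarrow> ('o, 'a, 'a set, 'a \<Rightarrow> 'a) ftor" where
  "hom_ftor E X =
     \<lparr>on_ob = (\<lambda>Y. Hom E X Y),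
      on_hom = (\<lambda>Y Z g. \<lambda>f\<in>Hom E X Y. Comp E X Y Z g f)\<rparr>"

text \<open>
  That the hom-functor is a functor into \<open>set_cat u\<close> says that all hom-sets out of \<open>X\<close>
  are small, which is not automatic in a category of endofunctors of the category of sets.
  The sets involved have elements of the type \<^typ>\<open>'a\<close> of arrows of \<open>E\<close>; the definition
  is meant for \<^typ>\<open>'a\<close> with at least as many elements as \<^typ>\<open>'u\<close>, which holds for the
  arrows \<^typ>\<open>'u set \<Rightarrow> 'u \<Rightarrow> 'u\<close> of the category \<open>FC\<close> below.
\<close>

definition small_projective :: "'u itself \<Rightarrow> ('o, 'a) cat \<Rightarrow> 'o \<Rightarrow> bool" where
  "small_projective u E X \<longleftrightarrow>
     is_functor E (set_cat u) (hom_ftor E X) \<and>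
     preserves_small_colimits u E (set_cat u) (hom_ftor E X)"

definition FC ::
    "'u itself \<Rightarrow> (('u set, 'u \<Rightarrow> 'u, 'u set, 'u \<Rightarrow> 'u) ftor, 'u set \<Rightarrow> 'u \<Rightarrow> 'u) cat" where
  "FC u = full_subcat (functor_cat (set_cat u) (set_cat u))
            (preserves_finite_coproducts (set_cat u) (set_cat u))"


section \<open>The category of ultrafilters\<close>

definition ultrafilter_on :: "'x set \<Rightarrow> 'x set set \<Rightarrow> bool" where
  "ultrafilter_on X \<U> \<longleftrightarrow> \<U> \<subseteq> Pow X \<and> X \<in> \<U> \<and>
     (\<forall>A\<in>Pow X. \<forall>B\<in>Pow X. A \<inter> B \<in> \<U> \<longleftrightarrow> A \<in> \<U> \<and> B \<in> \<U>) \<and>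
     (\<forall>A\<in>Pow X. A \<in> \<U> \<longleftrightarrow> X - A \<notin> \<U>)"

type_synonym 'x uf = "'x set \<times> 'x set set"

text \<open>Partial functions are maps \<^typ>\<open>'x \<rightharpoonup> 'x\<close>; the domain lies in \<open>\<U> \<subseteq> Pow X\<close>.\<close>

definition partial_continuous :: "'x uf \<Rightarrow> 'x uf \<Rightarrow> ('x \<rightharpoonup> 'x) set" where
  "partial_continuous = (\<lambda>(X, \<U>) (Y, \<V>).
     {f. dom f \<in> \<U> \<and> ran f \<subseteq> Y \<and>
         (\<forall>V\<in>Pow Y. V \<in> \<V> \<longleftrightarrow> {x. \<exists>y\<in>V. f x = Some y} \<in> \<U>)})"

definition uf_eq :: "'x uf \<Rightarrow> 'x uf \<Rightarrow> (('x \<rightharpoonup> 'x) \<times> ('x \<rightharpoonup> 'x)) set" where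
  "uf_eq P Q = {(f, g). f \<in> partial_continuous P Q \<and> g \<in> partial_continuous P Q \<and>
                        {x. \<exists>y. f x = Some y \<and> g x = Some y} \<in> snd P}"

text \<open>
  Classes are composed by composing representatives; the result does not depend on them,
  so the union below is a single class.
\<close>

definition UF :: "'u itself \<Rightarrow> ('u uf, ('u \<rightharpoonup> 'u) set) cat" where
  "UF u =
     \<lparr>Ob = {(X, \<U>). small u X \<and> ultrafilter_on X \<U>},
      Hom = (\<lambda>P Q. partial_continuous P Q // uf_eq P Q),
      Id = (\<lambda>P. uf_eq P P `` {(\<lambda>x. if x \<in> fst P then Some x else None)}),
      Comp = (\<lambda>P Q R \<g> \<f>. \<Union>g\<in>\<g>. \<Union>f\<in>\<f>. uf_eq P R `` {g \<circ>\<^sub>m f})\<rparr>"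

end

theory Submission
  imports Defs
begin

text \<open>
  An element \<open>x \<in> F X\<close> of a finite-coproduct-preserving endofunctor \<open>F\<close> of sets has a type: the
  subsets \<open>A \<subseteq> X\<close> such that \<open>x\<close> comes from \<open>F A\<close> form an ultrafilter on \<open>X\<close>, and natural
  transformations preserve it.  By a Yoneda argument, maps from the ultrapower functor of
  \<open>(X, \<U>)\<close> to \<open>F\<close> are the elements of \<open>F X\<close> of type \<open>\<U>\<close>.  Hence ultrapowers embed the
  opposite of the category of ultrafilters fully faithfully.  They are small-projective because
  evaluation at \<open>X\<close> has a right adjoint on the category of these functors, so it preserves
  colimits.

  Conversely, let \<open>F\<close> be small-projective.  There is a functor classifying subfunctors, and the set
  of maps from \<open>F\<close> to it is small; so \<open>F\<close> has only a small number of subfunctors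
  generated by \<open>F L\<close> for a small set \<open>L\<close>, and one of them is all of \<open>F\<close>.  Then \<open>F\<close> is the colimit
  of the ultrapowers of the types of the elements of \<open>F L\<close>, and its identity lifts to one of them.
  Thus \<open>F\<close> is a retract of an ultrapower.  The retraction is an isomorphism, since a map that
  preserves an ultrafilter is the identity on a set of the ultrafilter: a map without cycles has
  a 2-colouring in which every point that moves changes its colour.
\<close>

section \<open>Small sets\<close>

text \<open>Two size problems shape the development. Functor values must be subsets of
  \<open>'u\<close>, while germs, ultrafilters and functions on them have other types; such data are
  coded by \<open>enc\<close>, which is injective on small sets. And hom-sets of \<open>FC u\<close>
  are not automatically small. Smallness of the hom-sets out of a small-projective \<open>F\<close>
  belongs to its definition, and it is what bounds \<open>F\<close>: a map from \<open>F\<close>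
  into the classifying functor remembers a subfunctor, so too many subfunctors would give too many
  maps.

  For the projectivity of ultrapowers no colimit in \<open>FC u\<close> is constructed. A colimit is
  known only by its universal property; testing it against cofree functors turns this into a
  universal property for functions on the values at \<open>Z\<close>. Maps from
  \<open>upow u X \<U>\<close> to \<open>F\<close> pick out the elements of type \<open>\<U>\<close>
  in the value at \<open>X\<close>, and every arrow preserves types, so this part of the value
  inherits the universal property.\<close>

lemma small_lepoll: "small u A \<Longrightarrow> B \<lesssim> A \<Longrightarrow> small u B"
  unfolding small_def by (rule lesspoll_trans1)

lemma small_subset: "small u A \<Longrightarrow> B \<subseteq> A \<Longrightarrow> small u B"
  by (blast intro: small_lepoll subset_imp_lepoll)

lemma small_image: "small u A \<Longrightarrow> small u (f ` A)"
  by (blast intro: small_lepoll image_lepoll)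

lemma small_inj_on: "small u A \<Longrightarrow> inj_on f B \<Longrightarrow> f ` B \<subseteq> A \<Longrightarrow> small u B"
  using small_lepoll[of u A B] unfolding lepoll_def by blast

text \<open>A copy of a small set inside \<open>'u\<close>. The injection depends on the whole set,
  so a code can be read only together with the set it belongs to; for a set with no injection into
  \<open>'u\<close> the choice is arbitrary.\<close>

definition enc :: "'x set \<Rightarrow> 'x \<Rightarrow> 'u" where
  "enc A = (SOME e. inj_on e A)"

lemma inj_enc:
  assumes "small (u::'u itself) A"
  shows "inj_on (enc A :: _ \<Rightarrow> 'u) A"
proof -
  have "\<exists>e :: 'a \<Rightarrow> 'u. inj_on e A"
    using assms unfolding small_def lesspoll_def lepoll_def by blast
  then show ?thesis unfolding enc_def by (rule someI_ex)
qed

lemma enc_eq_iff: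
  "small (u::'u itself) A \<Longrightarrow> a \<in> A \<Longrightarrow> b \<in> A \<Longrightarrow> (enc A a :: 'u) = enc A b \<longleftrightarrow> a = b"
  by (meson inj_enc inj_on_eq_iff)

context
  fixes u :: "'u itself"
  assumes inacc: "inaccessible u"
begin

lemma infinite_univ: "infinite (UNIV :: 'u set)"
  using inacc unfolding inaccessible_def small_def
  by (simp add: infinite_le_lepoll lesspoll_imp_lepoll)

lemma univ_two_elements: "\<exists>z w :: 'u. z \<noteq> w"
  using infinite_univ by (metis finite.emptyI finite_insert ex_new_if_finite insertI1)

lemma small_finite: "finite A \<Longrightarrow> small u A"
  unfolding small_def using infinite_univ by (rule finite_lesspoll_infinite)

text \<open>Inaccessibility speaks only of subsets of \<open>'u\<close>; the power set is
  transported along \<open>enc\<close>.\<close>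

lemma small_Pow:
  assumes "small u A" shows "small u (Pow A)"
proof -
  let ?e = "enc A :: _ \<Rightarrow> 'u"
  have "small u (Pow (?e ` A))"
    using inacc small_image[OF assms] unfolding inaccessible_def by blast
  moreover have "inj_on ((`) ?e) (Pow A)"
    using inj_enc[OF assms] by (rule inj_on_image_Pow)
  ultimately show ?thesis by (rule small_inj_on) auto
qed

lemma small_Union: "small u \<A> \<Longrightarrow> (\<And>A. A \<in> \<A> \<Longrightarrow> small u A) \<Longrightarrow> small u (\<Union>\<A> :: 'u set)"
  using inacc unfolding inaccessible_def by blast

text \<open>The union axiom applies only to sets of subsets of \<open>'u\<close>, so the disjoint
  union has to be realised inside \<open>'u\<close>: a pairing
  \<open>'u \<times> 'u \<Rightarrow> 'u\<close> tags the code of \<open>a\<close> with the code of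
  its index.\<close>

lemma small_Sigma:
  assumes "small u I" "\<And>i. i \<in> I \<Longrightarrow> small u (A i)"
  shows "small u (Sigma I A)"
proof -
  have "(card_of (UNIV :: ('u \<times> 'u) set), card_of (UNIV :: 'u set)) \<in> ordLeq"
    using card_of_Times_same_infinite[OF infinite_univ] by (simp add: ordIso_iff_ordLeq)
  then have "\<exists>p :: 'u \<times> 'u \<Rightarrow> 'u. inj_on p UNIV \<and> p ` UNIV \<subseteq> UNIV"
    by (rule card_of_ordLeq[THEN iffD2])
  then obtain p :: "'u \<times> 'u \<Rightarrow> 'u" where p: "inj p" by blast
  define q where "q = (\<lambda>(i, a). p (enc I i, enc (A i) a))"
  have "inj_on q (Sigma I A)"
    unfolding q_def using enc_eq_iff[OF assms(1)] enc_eq_iff[OF assms(2)]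
    by (auto simp: inj_on_def dest!: injD[OF p])
  moreover have "small u (\<Union>i\<in>I. (\<lambda>a. p (enc I i, enc (A i) a)) ` A i)"
    by (intro small_Union small_image assms) (auto intro: small_image assms)
  ultimately show ?thesis by (elim small_inj_on[rotated]) (auto simp: q_def)
qed

lemma small_Times: "small u A \<Longrightarrow> small u B \<Longrightarrow> small u (A \<times> B)"
  by (rule small_Sigma)

text \<open>A function in \<open>A \<rightarrow>\<^sub>E B\<close> is recovered from its graph,
  because its values outside \<open>A\<close> are fixed.\<close>

lemma small_PiE:
  assumes "small u A" "small u B" shows "small u (A \<rightarrow>\<^sub>E B)"
proof (rule small_inj_on)
  show "small u (Pow (A \<times> B))" using assms by (intro small_Pow small_Times)
  show "inj_on (\<lambda>f. (\<lambda>a. (a, f a)) ` A) (A \<rightarrow>\<^sub>E B)"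
  proof (rule inj_onI)
    fix f g assume fg: "f \<in> A \<rightarrow>\<^sub>E B" "g \<in> A \<rightarrow>\<^sub>E B" "(\<lambda>a. (a, f a)) ` A = (\<lambda>a. (a, g a)) ` A"
    then have "f a = g a" if "a \<in> A" for a using that by blast
    with fg show "f = g" by (meson PiE_ext)
  qed
qed auto

end

section \<open>Ultrafilters\<close>

lemma ultrafilter_onI:
  assumes "\<U> \<subseteq> Pow X" "X \<in> \<U>"
    and "\<And>A B. A \<in> \<U> \<Longrightarrow> B \<in> \<U> \<Longrightarrow> A \<inter> B \<in> \<U>"
    and "\<And>A B. A \<in> \<U> \<Longrightarrow> A \<subseteq> B \<Longrightarrow> B \<subseteq> X \<Longrightarrow> B \<in> \<U>"
    and "\<And>A. A \<subseteq> X \<Longrightarrow> A \<in> \<U> \<longleftrightarrow> X - A \<notin> \<U>"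
  shows "ultrafilter_on X \<U>"
  unfolding ultrafilter_on_def
proof (intro conjI ballI)
  fix A B assume AB: "A \<in> Pow X" "B \<in> Pow X"
  show "(A \<inter> B \<in> \<U>) = (A \<in> \<U> \<and> B \<in> \<U>)"
  proof
    assume "A \<inter> B \<in> \<U>"
    then show "A \<in> \<U> \<and> B \<in> \<U>" using AB assms(4) by (metis Int_lower1 Int_lower2 PowD)
  qed (use assms(3) in simp)
next
  fix A assume "A \<in> Pow X"
  then show "A \<in> \<U> \<longleftrightarrow> X - A \<notin> \<U>" by (intro assms(5) PowD)
qed (fact assms)+

context
  fixes X :: "'x set" and \<U>
  assumes uf: "ultrafilter_on X \<U>"
begin

lemma uf_subset: "A \<in> \<U> \<Longrightarrow> A \<subseteq> X"
  using uf unfolding ultrafilter_on_def by blast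

lemma uf_top: "X \<in> \<U>"
  using uf unfolding ultrafilter_on_def by blast

lemma uf_Int: "A \<in> \<U> \<Longrightarrow> B \<in> \<U> \<Longrightarrow> A \<inter> B \<in> \<U>"
  using uf uf_subset unfolding ultrafilter_on_def by blast

lemma uf_mono: "A \<in> \<U> \<Longrightarrow> A \<subseteq> B \<Longrightarrow> B \<subseteq> X \<Longrightarrow> B \<in> \<U>"
proof -
  assume "A \<in> \<U>" "A \<subseteq> B" "B \<subseteq> X"
  moreover have "A \<inter> B = A" using \<open>A \<subseteq> B\<close> by blast
  ultimately show ?thesis using uf uf_subset[of A] unfolding ultrafilter_on_def by (metis PowI)
qed

lemma uf_compl: "A \<subseteq> X \<Longrightarrow> X - A \<in> \<U> \<longleftrightarrow> A \<notin> \<U>"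
  using uf unfolding ultrafilter_on_def by blast

lemma uf_empty: "{} \<notin> \<U>"
  using uf_compl[of X] uf_top by simp

lemma uf_nonempty: "A \<in> \<U> \<Longrightarrow> \<exists>a\<in>X. a \<in> A"
  using uf_empty uf_subset by (cases "A = {}") auto

lemma uf_Collect_conj:
  "{x\<in>X. P x} \<in> \<U> \<Longrightarrow> {x\<in>X. Q x} \<in> \<U> \<Longrightarrow> (\<And>x. x \<in> X \<Longrightarrow> P x \<Longrightarrow> Q x \<Longrightarrow> R x) \<Longrightarrow> {x\<in>X. R x} \<in> \<U>"
  by (rule uf_mono[OF uf_Int[of "{x\<in>X. P x}" "{x\<in>X. Q x}"]]) auto

lemma uf_Collect_mono:
  "{x\<in>X. P x} \<in> \<U> \<Longrightarrow> (\<And>x. x \<in> X \<Longrightarrow> P x \<Longrightarrow> R x) \<Longrightarrow> {x\<in>X. R x} \<in> \<U>"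
  by (rule uf_mono) auto

lemma uf_Collect_True: "(\<And>x. x \<in> X \<Longrightarrow> P x) \<Longrightarrow> {x\<in>X. P x} \<in> \<U>"
  by (rule uf_mono[OF uf_top]) auto

text \<open>Primeness: if \<open>A i\<close> is not in \<open>\<U>\<close>, intersecting the union
  with its complement leaves a set inside the union over the remaining indices. This selects the
  summand from which an element of a coproduct comes.\<close>

lemma uf_finite_UN:
  assumes "finite I" "(\<Union>i\<in>I. A i) \<in> \<U>" shows "\<exists>i\<in>I. A i \<in> \<U>"
  using assms
proof (induction I rule: finite_induct)
  case empty then show ?case using uf_empty by simp
next
  case (insert i I)
  show ?case
  proof (cases "A i \<in> \<U>")
    case False
    moreover have sub: "A i \<subseteq> X" using uf_subset[OF insert.prems] by auto
    ultimately have "X - A i \<in> \<U>" using uf_compl by simp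
    then have "(X - A i) \<inter> (\<Union>j\<in>insert i I. A j) \<in> \<U>"
      using insert.prems by (rule uf_Int)
    then have "(\<Union>j\<in>I. A j) \<in> \<U>"
      by (rule uf_mono) (use uf_subset[OF insert.prems] in auto)
    then show ?thesis using insert.IH by blast
  qed auto
qed

end

text \<open>Maximality: a set of \<open>\<V>\<close> outside \<open>\<U>\<close> would have its
  complement in \<open>\<U>\<close>, hence in \<open>\<V>\<close>. Equalities of types are thus
  reduced to one inclusion.\<close>

lemma ultrafilter_subset_eq:
  assumes "ultrafilter_on X \<U>" "ultrafilter_on X \<V>" "\<U> \<subseteq> \<V>" shows "\<U> = \<V>"
proof (rule equalityI[OF assms(3) subsetI])
  fix A assume A: "A \<in> \<V>"
  then have "A \<subseteq> X" by (rule uf_subset[OF assms(2)])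
  then show "A \<in> \<U>"
    using A assms(3) uf_compl[OF assms(1), of A] uf_compl[OF assms(2), of A] by blast
qed

text \<open>The image ultrafilter. For a total map \<open>f\<close>, the equation
  \<open>push X Y f \<U> = \<V>\<close> is the continuity condition of \<open>UF\<close>.\<close>

definition push :: "'x set \<Rightarrow> 'y set \<Rightarrow> ('x \<Rightarrow> 'y) \<Rightarrow> 'x set set \<Rightarrow> 'y set set" where
  "push X Y f \<U> = {B. B \<subseteq> Y \<and> {x\<in>X. f x \<in> B} \<in> \<U>}"

lemma ultrafilter_push:
  assumes uf: "ultrafilter_on X \<U>" and f: "f \<in> X \<rightarrow> Y"
  shows "ultrafilter_on Y (push X Y f \<U>)"
proof (rule ultrafilter_onI)
  show "Y \<in> push X Y f \<U>"
    using f by (auto simp: push_def Pi_iff intro!: uf_Collect_True[OF uf])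
  show "A \<inter> B \<in> push X Y f \<U>" if "A \<in> push X Y f \<U>" "B \<in> push X Y f \<U>" for A B
    using that uf_Collect_conj[OF uf, of "\<lambda>x. f x \<in> A" "\<lambda>x. f x \<in> B" "\<lambda>x. f x \<in> A \<inter> B"]
    unfolding push_def by auto
  show "B \<in> push X Y f \<U>" if "A \<in> push X Y f \<U>" "A \<subseteq> B" "B \<subseteq> Y" for A B
    using that uf_Collect_mono[OF uf, of "\<lambda>x. f x \<in> A" "\<lambda>x. f x \<in> B"]
    unfolding push_def by auto
  show "A \<in> push X Y f \<U> \<longleftrightarrow> Y - A \<notin> push X Y f \<U>" if "A \<subseteq> Y" for A
  proof -
    have "{x\<in>X. f x \<in> Y - A} = X - {x\<in>X. f x \<in> A}" using f by auto
    moreover have "X - {x\<in>X. f x \<in> A} \<in> \<U> \<longleftrightarrow> {x\<in>X. f x \<in> A} \<notin> \<U>"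
      by (rule uf_compl[OF uf]) blast
    ultimately show ?thesis using that by (simp add: push_def)
  qed
qed (auto simp: push_def)

lemma push_push:
  "f \<in> X \<rightarrow> Y \<Longrightarrow> push Y Z g (push X Y f \<U>) = push X Z (\<lambda>x. g (f x)) \<U>"
proof -
  assume f: "f \<in> X \<rightarrow> Y"
  have "{x\<in>X. f x \<in> {y\<in>Y. g y \<in> B}} = {x\<in>X. g (f x) \<in> B}" for B using f by auto
  then show ?thesis unfolding push_def by auto
qed

lemma push_cong:
  "(\<And>x. x \<in> X \<Longrightarrow> f x = g x) \<Longrightarrow> push X Y f \<U> = push X Y g \<U>"
  unfolding push_def by (auto cong: conj_cong)

lemma push_cong_uf:
  assumes "ultrafilter_on X \<U>" "{x\<in>X. f x = g x} \<in> \<U>"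
  shows "push X Y f \<U> = push X Y g \<U>"
proof -
  have "{x\<in>X. f x \<in> B} \<in> \<U> \<longleftrightarrow> {x\<in>X. g x \<in> B} \<in> \<U>" for B
    using uf_Collect_conj[OF assms, of "\<lambda>x. f x \<in> B" "\<lambda>x. g x \<in> B"]
      uf_Collect_conj[OF assms, of "\<lambda>x. g x \<in> B" "\<lambda>x. f x \<in> B"] by auto
  then show ?thesis by (simp add: push_def)
qed

lemma push_id: "ultrafilter_on X \<U> \<Longrightarrow> push X X (\<lambda>x. x) \<U> = \<U>"
proof -
  assume uf: "ultrafilter_on X \<U>"
  show ?thesis
  proof (rule set_eqI)
    fix B
    have "{x\<in>X. x \<in> B} = B" if "B \<subseteq> X" using that by blast
    then show "B \<in> push X X (\<lambda>x. x) \<U> \<longleftrightarrow> B \<in> \<U>"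
      using uf_subset[OF uf, of B] by (auto simp: push_def)
  qed
qed

section \<open>Functor categories and finite coproducts of sets\<close>

lemma set_cat_simps [simp]:
  "Ob (set_cat u) = {A. small u A}" "Hom (set_cat u) A B = A \<rightarrow>\<^sub>E B"
  "Id (set_cat u) A = (\<lambda>x\<in>A. x)" "Comp (set_cat u) A B C g f = compose A g f"
  by (simp_all add: set_cat_def)

lemma category_set_cat: "category (set_cat u)"
  unfolding category_def set_cat_simps
proof (intro conjI ballI)
  fix w x y z and f g h :: "'a \<Rightarrow> 'a"
  assume "f \<in> w \<rightarrow>\<^sub>E x" "g \<in> x \<rightarrow>\<^sub>E y" "h \<in> y \<rightarrow>\<^sub>E z"
  then show "compose w (compose x h g) f = compose w h (compose w g f)"
    by (auto simp: compose_def fun_eq_iff)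
next
  fix x y and f :: "'a \<Rightarrow> 'a"
  assume f: "f \<in> x \<rightarrow>\<^sub>E y"
  show "compose x f (\<lambda>x\<in>x. x) = f" using f by (auto simp: compose_def fun_eq_iff)
  show "compose x (\<lambda>x\<in>y. x) f = f" using f by (auto simp: compose_def fun_eq_iff)
next
  fix x y z and f g :: "'a \<Rightarrow> 'a"
  assume "f \<in> x \<rightarrow>\<^sub>E y" "g \<in> y \<rightarrow>\<^sub>E z"
  then show "compose x g f \<in> x \<rightarrow>\<^sub>E z" by (auto simp: compose_def)
qed auto

context
  fixes C :: "('o, 'a) cat"
  assumes C: "category C"
begin

lemma cat_Id: "x \<in> Ob C \<Longrightarrow> Id C x \<in> Hom C x x"
  using C unfolding category_def by simp

lemma cat_Comp:
  "x \<in> Ob C \<Longrightarrow> y \<in> Ob C \<Longrightarrow> z \<in> Ob C \<Longrightarrow> f \<in> Hom C x y \<Longrightarrow> g \<in> Hom C y z \<Longrightarrow>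
    Comp C x y z g f \<in> Hom C x z"
  using C unfolding category_def by simp

lemma cat_Id_right: "x \<in> Ob C \<Longrightarrow> y \<in> Ob C \<Longrightarrow> f \<in> Hom C x y \<Longrightarrow> Comp C x x y f (Id C x) = f"
  using C unfolding category_def by simp

lemma cat_Id_left: "x \<in> Ob C \<Longrightarrow> y \<in> Ob C \<Longrightarrow> f \<in> Hom C x y \<Longrightarrow> Comp C x y y (Id C y) f = f"
  using C unfolding category_def by simp

lemma cat_assoc:
  "w \<in> Ob C \<Longrightarrow> x \<in> Ob C \<Longrightarrow> y \<in> Ob C \<Longrightarrow> z \<in> Ob C \<Longrightarrow>
    f \<in> Hom C w x \<Longrightarrow> g \<in> Hom C x y \<Longrightarrow> h \<in> Hom C y z \<Longrightarrow>
    Comp C w x z (Comp C x y z h g) f = Comp C w y z h (Comp C w x y g f)"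
  using C unfolding category_def by simp

lemma category_op: "category (op_cat C)"
  using cat_Id cat_Comp cat_Id_right cat_Id_left cat_assoc
  unfolding category_def op_cat_def by simp

lemma category_full_subcat: "category (full_subcat C P)"
  using cat_Id cat_Comp cat_Id_right cat_Id_left cat_assoc
  unfolding category_def full_subcat_def by simp

end

lemma category_functor_cat:
  fixes D :: "('p, 'b) cat" and C :: "('o, 'a) cat"
  assumes C: "category C" and D: "category D"
  shows "category (functor_cat C D)"
proof -
  have obj: "on_ob F x \<in> Ob D" if "F \<in> Ob (functor_cat C D)" "x \<in> Ob C" for F x
    using that by (simp add: functor_cat_def is_functor_def)
  have arr: "on_hom F x y f \<in> Hom D (on_ob F x) (on_ob F y)"
    if "F \<in> Ob (functor_cat C D)" "x \<in> Ob C" "y \<in> Ob C" "f \<in> Hom C x y" for F x y f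
    using that by (simp add: functor_cat_def is_functor_def)
  have nt: "\<alpha> x \<in> Hom D (on_ob F x) (on_ob G x)"
    if "\<alpha> \<in> Hom (functor_cat C D) F G" "x \<in> Ob C" for \<alpha> x F G
    using that by (auto simp: functor_cat_def nat_trans_def)
  have nat: "Comp D (on_ob F x) (on_ob F y) (on_ob G y) (\<alpha> y) (on_hom F x y f) =
          Comp D (on_ob F x) (on_ob G x) (on_ob G y) (on_hom G x y f) (\<alpha> x)"
    if "\<alpha> \<in> Hom (functor_cat C D) F G" "x \<in> Ob C" "y \<in> Ob C" "f \<in> Hom C x y" for \<alpha> x y f F G
    using that by (auto simp: functor_cat_def nat_trans_def)
  have ntI: "\<alpha> \<in> Hom (functor_cat C D) F G"
    if "\<alpha> \<in> extensional (Ob C)" "\<And>x. x \<in> Ob C \<Longrightarrow> \<alpha> x \<in> Hom D (on_ob F x) (on_ob G x)"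
      "\<And>x y f. x \<in> Ob C \<Longrightarrow> y \<in> Ob C \<Longrightarrow> f \<in> Hom C x y \<Longrightarrow>
        Comp D (on_ob F x) (on_ob F y) (on_ob G y) (\<alpha> y) (on_hom F x y f) =
          Comp D (on_ob F x) (on_ob G x) (on_ob G y) (on_hom G x y f) (\<alpha> x)" for \<alpha> F G
    using that by (simp add: functor_cat_def nat_trans_def PiE_iff)
  have nt_eq: "\<alpha> = \<beta>" if "\<alpha> \<in> extensional (Ob C)" "\<beta> \<in> extensional (Ob C)"
      "\<And>x. x \<in> Ob C \<Longrightarrow> \<alpha> x = \<beta> x" for \<alpha> \<beta> :: "'o \<Rightarrow> 'b"
    using that by (rule extensionalityI)
  have ext: "\<alpha> \<in> extensional (Ob C)" if "\<alpha> \<in> Hom (functor_cat C D) F G" for \<alpha> F G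
    using that by (auto simp: functor_cat_def nat_trans_def PiE_def)
  have Id: "Id (functor_cat C D) F = (\<lambda>x\<in>Ob C. Id D (on_ob F x))" for F
    by (simp add: functor_cat_def)
  have Comp: "Comp (functor_cat C D) F G H \<beta> \<alpha> = (\<lambda>x\<in>Ob C.
        Comp D (on_ob F x) (on_ob G x) (on_ob H x) (\<beta> x) (\<alpha> x))" for F G H \<alpha> \<beta>
    by (simp add: functor_cat_def)
  note c = cat_Id[OF D] cat_Comp[OF D] cat_Id_left[OF D] cat_Id_right[OF D]
  show ?thesis
    unfolding category_def
  proof (intro conjI ballI)
    fix F assume F: "F \<in> Ob (functor_cat C D)"
    show "Id (functor_cat C D) F \<in> Hom (functor_cat C D) F F"
      by (rule ntI) (simp_all add: Id c obj[OF F] arr[OF F] )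
  next
    fix F G H \<alpha> \<beta>
    assume F: "F \<in> Ob (functor_cat C D)" and G: "G \<in> Ob (functor_cat C D)"
      and H: "H \<in> Ob (functor_cat C D)"
      and a: "\<alpha> \<in> Hom (functor_cat C D) F G" and b: "\<beta> \<in> Hom (functor_cat C D) G H"
    show "Comp (functor_cat C D) F G H \<beta> \<alpha> \<in> Hom (functor_cat C D) F H"
    proof (rule ntI)
      fix x y f assume x: "x \<in> Ob C" and y: "y \<in> Ob C" and f: "f \<in> Hom C x y"
      note o = obj[OF F x] obj[OF G x] obj[OF H x] obj[OF F y] obj[OF G y] obj[OF H y]
      have "Comp D (on_ob F x) (on_ob F y) (on_ob H y)
            (Comp D (on_ob F y) (on_ob G y) (on_ob H y) (\<beta> y) (\<alpha> y)) (on_hom F x y f)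
          = Comp D (on_ob F x) (on_ob G y) (on_ob H y) (\<beta> y)
            (Comp D (on_ob F x) (on_ob F y) (on_ob G y) (\<alpha> y) (on_hom F x y f))"
        using cat_assoc[OF D] o nt[OF a y] nt[OF b y] arr[OF F x y f] by simp
      also have "\<dots> = Comp D (on_ob F x) (on_ob G y) (on_ob H y) (\<beta> y)
            (Comp D (on_ob F x) (on_ob G x) (on_ob G y) (on_hom G x y f) (\<alpha> x))"
        using nat[OF a x y f] by simp
      also have "\<dots> = Comp D (on_ob F x) (on_ob G x) (on_ob H y)
            (Comp D (on_ob G x) (on_ob G y) (on_ob H y) (\<beta> y) (on_hom G x y f)) (\<alpha> x)"
        using cat_assoc[OF D] o nt[OF a x] nt[OF b y] arr[OF G x y f] by simp
      also have "\<dots> = Comp D (on_ob F x) (on_ob G x) (on_ob H y)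
            (Comp D (on_ob G x) (on_ob H x) (on_ob H y) (on_hom H x y f) (\<beta> x)) (\<alpha> x)"
        using nat[OF b x y f] by simp
      also have "\<dots> = Comp D (on_ob F x) (on_ob H x) (on_ob H y) (on_hom H x y f)
            (Comp D (on_ob F x) (on_ob G x) (on_ob H x) (\<beta> x) (\<alpha> x))"
        using cat_assoc[OF D] o nt[OF a x] nt[OF b x] arr[OF H x y f] by simp
      finally show "Comp D (on_ob F x) (on_ob F y) (on_ob H y)
            (Comp (functor_cat C D) F G H \<beta> \<alpha> y) (on_hom F x y f) =
          Comp D (on_ob F x) (on_ob H x) (on_ob H y) (on_hom H x y f)
            (Comp (functor_cat C D) F G H \<beta> \<alpha> x)"
        by (simp add: Comp x y)
    qed (simp_all add: Comp c(2) obj[OF F] obj[OF G] obj[OF H] nt[OF a] nt[OF b])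
  next
    fix F G \<alpha>
    assume F: "F \<in> Ob (functor_cat C D)" and G: "G \<in> Ob (functor_cat C D)"
      and a: "\<alpha> \<in> Hom (functor_cat C D) F G"
    show "Comp (functor_cat C D) F F G \<alpha> (Id (functor_cat C D) F) = \<alpha>"
      by (rule nt_eq[OF _ ext[OF a]]) (simp_all add: Id Comp c obj[OF F] obj[OF G] nt[OF a])
    show "Comp (functor_cat C D) F G G (Id (functor_cat C D) G) \<alpha> = \<alpha>"
      by (rule nt_eq[OF _ ext[OF a]]) (simp_all add: Id Comp c obj[OF F] obj[OF G] nt[OF a])
  next
    fix F G H K \<alpha> \<beta> \<gamma>
    assume F: "F \<in> Ob (functor_cat C D)" and G: "G \<in> Ob (functor_cat C D)"
      and H: "H \<in> Ob (functor_cat C D)" and K: "K \<in> Ob (functor_cat C D)"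
      and a: "\<alpha> \<in> Hom (functor_cat C D) F G" and b: "\<beta> \<in> Hom (functor_cat C D) G H"
      and g: "\<gamma> \<in> Hom (functor_cat C D) H K"
    show "Comp (functor_cat C D) F G K (Comp (functor_cat C D) G H K \<gamma> \<beta>) \<alpha> =
        Comp (functor_cat C D) F H K \<gamma> (Comp (functor_cat C D) F G H \<beta> \<alpha>)"
      by (rule nt_eq) (simp_all add: Comp cat_assoc[OF D] obj[OF F] obj[OF G] obj[OF H] obj[OF K]
          nt[OF a] nt[OF b] nt[OF g])
  qed
qed

lemma FC_simps:
  "Hom (FC u) F G = nat_trans (set_cat u) (set_cat u) F G"
  "Id (FC u) F = (\<lambda>X\<in>{X. small u X}. \<lambda>x\<in>on_ob F X. x)"
  "Comp (FC u) F G H \<beta> \<alpha> = (\<lambda>X\<in>{X. small u X}. compose (on_ob F X) (\<beta> X) (\<alpha> X))"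
  by (simp_all add: FC_def full_subcat_def functor_cat_def)

lemma category_FC: "category (FC u)"
  unfolding FC_def by (intro category_full_subcat category_functor_cat category_set_cat)

type_synonym 'u endo = "('u set, 'u \<Rightarrow> 'u, 'u set, 'u \<Rightarrow> 'u) ftor"

text \<open>\<open>ap F X Y f\<close> is the action of an endofunctor of the category of sets on a map \<open>f\<close> that
  need not be extensional.\<close>

definition ap :: "'u endo \<Rightarrow> 'u set \<Rightarrow> 'u set \<Rightarrow> ('u \<Rightarrow> 'u) \<Rightarrow> 'u \<Rightarrow> 'u" where
  "ap F X Y f x = on_hom F X Y (restrict f X) x"

lemma ap_cong: "(\<And>a. a \<in> X \<Longrightarrow> f a = g a) \<Longrightarrow> ap F X Y f x = ap F X Y g x"
  unfolding ap_def by (metis restrict_ext)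

lemma on_hom_eq_ap: "f \<in> X \<rightarrow>\<^sub>E Y \<Longrightarrow> on_hom F X Y f x = ap F X Y f x"
  unfolding ap_def by (metis PiE_restrict)

abbreviation endofunctor :: "'u itself \<Rightarrow> 'u endo \<Rightarrow> bool" where
  "endofunctor u \<equiv> is_functor (set_cat u) (set_cat u)"

context
  fixes u :: "'u itself" and F :: "'u endo"
  assumes F: "endofunctor u F"
begin

lemma small_on_ob: "small u X \<Longrightarrow> small u (on_ob F X)"
  using F unfolding is_functor_def by simp

lemma on_hom_PiE: "small u X \<Longrightarrow> small u Y \<Longrightarrow> f \<in> X \<rightarrow>\<^sub>E Y \<Longrightarrow> on_hom F X Y f \<in> on_ob F X \<rightarrow>\<^sub>E on_ob F Y"
  using F unfolding is_functor_def by simp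

lemma ap_in: "small u X \<Longrightarrow> small u Y \<Longrightarrow> f \<in> X \<rightarrow> Y \<Longrightarrow> x \<in> on_ob F X \<Longrightarrow> ap F X Y f x \<in> on_ob F Y"
  using on_hom_PiE[of X Y "restrict f X"] unfolding ap_def by (auto dest: PiE_mem)

lemma ap_ident:
  assumes "small u X" "x \<in> on_ob F X" "\<And>a. a \<in> X \<Longrightarrow> f a = a"
  shows "ap F X X f x = x"
proof -
  have "on_hom F X X (\<lambda>x\<in>X. x) = (\<lambda>x\<in>on_ob F X. x)"
    using F assms(1) unfolding is_functor_def by simp
  moreover have "restrict f X = (\<lambda>x\<in>X. x)" using assms(3) by (simp add: restrict_def fun_eq_iff)
  ultimately show ?thesis using assms(2) by (simp add: ap_def)
qed

lemma ap_ap: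
  assumes "small u X" "small u Y" "small u Z" "f \<in> X \<rightarrow> Y" "g \<in> Y \<rightarrow> Z" "x \<in> on_ob F X"
  shows "ap F Y Z g (ap F X Y f x) = ap F X Z (\<lambda>a. g (f a)) x"
proof -
  have f: "restrict f X \<in> X \<rightarrow>\<^sub>E Y" and g: "restrict g Y \<in> Y \<rightarrow>\<^sub>E Z" using assms by auto
  then have "on_hom F X Z (compose X (restrict g Y) (restrict f X)) =
      compose (on_ob F X) (on_hom F Y Z (restrict g Y)) (on_hom F X Y (restrict f X))"
    using F assms(1-3) unfolding is_functor_def by simp
  moreover have "compose X (restrict g Y) (restrict f X) = restrict (\<lambda>a. g (f a)) X"
    using assms(4) by (auto simp: compose_def fun_eq_iff)
  ultimately show ?thesis using assms(6) by (simp add: ap_def compose_def)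
qed

end

lemma nat_trans_iff:
  fixes u :: "'u itself" and F G :: "'u endo"
  assumes F: "endofunctor u F" and G: "endofunctor u G"
  shows "\<alpha> \<in> nat_trans (set_cat u) (set_cat u) F G \<longleftrightarrow>
    \<alpha> \<in> extensional {X. small u X} \<and>
    (\<forall>X. small u X \<longrightarrow> \<alpha> X \<in> on_ob F X \<rightarrow>\<^sub>E on_ob G X) \<and>
    (\<forall>X Y f x. small u X \<longrightarrow> small u Y \<longrightarrow> f \<in> X \<rightarrow> Y \<longrightarrow> x \<in> on_ob F X \<longrightarrow>
       \<alpha> Y (ap F X Y f x) = ap G X Y f (\<alpha> X x))" (is "?L \<longleftrightarrow> ?E \<and> ?P \<and> ?N")
proof
  assume L: ?L
  then have E: ?E and P: ?P by (auto simp: nat_trans_def PiE_def)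
  have ?N
  proof (intro allI impI)
    fix X Y :: "'u set" and f x assume *: "small u X" "small u Y" "f \<in> X \<rightarrow> Y" "x \<in> on_ob F X"
    then have r: "restrict f X \<in> X \<rightarrow>\<^sub>E Y" by auto
    then have "compose (on_ob F X) (\<alpha> Y) (on_hom F X Y (restrict f X)) =
        compose (on_ob F X) (on_hom G X Y (restrict f X)) (\<alpha> X)"
      using L *(1,2) by (simp add: nat_trans_def)
    from fun_cong[OF this, of x] show "\<alpha> Y (ap F X Y f x) = ap G X Y f (\<alpha> X x)"
      using *(4) by (simp add: compose_def ap_def)
  qed
  with E P show "?E \<and> ?P \<and> ?N" by blast
next
  assume R: "?E \<and> ?P \<and> ?N"
  have "compose (on_ob F X) (\<alpha> Y) (on_hom F X Y f) = compose (on_ob F X) (on_hom G X Y f) (\<alpha> X)"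
    if *: "small u X" "small u Y" "f \<in> X \<rightarrow>\<^sub>E Y" for X Y :: "'u set" and f
  proof
    fix x
    have "f \<in> X \<rightarrow> Y" using *(3) by auto
    then show "compose (on_ob F X) (\<alpha> Y) (on_hom F X Y f) x = compose (on_ob F X) (on_hom G X Y f) (\<alpha> X) x"
      using R * by (simp add: compose_def on_hom_eq_ap)
  qed
  then show ?L using R by (simp add: nat_trans_def PiE_iff)
qed

lemma nat_trans_eqI:
  fixes u :: "'u itself" and F G :: "'u endo"
  assumes "\<alpha> \<in> nat_trans (set_cat u) (set_cat u) F G" "\<beta> \<in> nat_trans (set_cat u) (set_cat u) F G"
    and eq: "\<And>X x. small u X \<Longrightarrow> x \<in> on_ob F X \<Longrightarrow> \<alpha> X x = \<beta> X x"
  shows "\<alpha> = \<beta>"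
proof (rule extensionalityI[of _ "{X. small u X}"])
  show "\<alpha> \<in> extensional {X. small u X}" "\<beta> \<in> extensional {X. small u X}"
    using assms(1,2) by (auto simp: nat_trans_def PiE_def)
  fix X :: "'u set" assume "X \<in> {X. small u X}"
  then show "\<alpha> X = \<beta> X"
    using assms(1,2) eq by (intro PiE_ext[of _ "on_ob F X"]) (auto simp: nat_trans_def)
qed

section \<open>Types of elements, and the functors for which they are ultrafilters\<close>

definition tp :: "'u endo \<Rightarrow> 'u set \<Rightarrow> 'u \<Rightarrow> 'u set set" where
  "tp F X x = {A. A \<subseteq> X \<and> x \<in> ap F A X (\<lambda>a. a) ` on_ob F A}"

lemma tp_subset: "A \<in> tp F X x \<Longrightarrow> A \<subseteq> X"
  by (simp add: tp_def)

lemma tpE: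
  assumes "A \<in> tp F X x"
  obtains a where "A \<subseteq> X" "a \<in> on_ob F A" "x = ap F A X (\<lambda>a. a) a"
  using assms by (auto simp: tp_def)

lemma tpI: "A \<subseteq> X \<Longrightarrow> a \<in> on_ob F A \<Longrightarrow> x = ap F A X (\<lambda>a. a) a \<Longrightarrow> A \<in> tp F X x"
  by (auto simp: tp_def)

text \<open>Preservation of finite coproducts, tested only on the empty coproduct and on the
  decompositions of \<open>X\<close> into \<open>A\<close> and \<open>X - A\<close>: each element
  comes from exactly one part. Larger coproducts and injectivity of the coproduct maps follow in
  \<open>preserves_finite_coproducts_iff\<close>.\<close>

definition partitive :: "'u itself \<Rightarrow> 'u endo \<Rightarrow> bool" where
  "partitive u F \<longleftrightarrow> endofunctor u F \<and> on_ob F {} = {} \<and>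
    (\<forall>X A x. small u X \<longrightarrow> A \<subseteq> X \<longrightarrow> x \<in> on_ob F X \<longrightarrow> (A \<in> tp F X x \<longleftrightarrow> X - A \<notin> tp F X x))"

context
  fixes u :: "'u itself" and F :: "'u endo"
  assumes p: "partitive u F"
begin

lemma partitive_endofunctor: "endofunctor u F"
  using p by (simp add: partitive_def)

lemma partitive_empty: "on_ob F {} = {}"
  using p by (simp add: partitive_def)

lemma partitive_compl:
  "small u X \<Longrightarrow> A \<subseteq> X \<Longrightarrow> x \<in> on_ob F X \<Longrightarrow> A \<in> tp F X x \<longleftrightarrow> X - A \<notin> tp F X x"
  using p unfolding partitive_def by blast

lemmas F_rules = small_on_ob[OF partitive_endofunctor] ap_in[OF partitive_endofunctor]
  ap_ident[OF partitive_endofunctor] ap_ap[OF partitive_endofunctor]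

lemma tp_image:
  assumes "small u X" "small u Y" "f \<in> X \<rightarrow> Y" "x \<in> on_ob F X" "B \<subseteq> Y" "f ` X \<subseteq> B"
  shows "B \<in> tp F Y (ap F X Y f x)"
proof (rule tpI)
  have B: "small u B" using assms small_subset by blast
  show "ap F X B f x \<in> on_ob F B" using assms B by (intro F_rules) auto
  have "ap F B Y (\<lambda>a. a) (ap F X B f x) = ap F X Y f x"
    using assms B by (subst F_rules) auto
  then show "ap F X Y f x = ap F B Y (\<lambda>a. a) (ap F X B f x)" by simp
qed (fact assms)

text \<open>The element comes from the preimage of \<open>B\<close>, and there \<open>f\<close>
  takes values in \<open>B\<close>.\<close>

lemma tp_push_subset:
  assumes "small u X" "small u Y" "f \<in> X \<rightarrow> Y" "x \<in> on_ob F X" "B \<subseteq> Y" "{a\<in>X. f a \<in> B} \<in> tp F X x"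
  shows "B \<in> tp F Y (ap F X Y f x)"
proof -
  let ?A = "{a\<in>X. f a \<in> B}"
  have A: "small u ?A" by (rule small_subset[OF assms(1)]) auto
  obtain a where a: "a \<in> on_ob F ?A" "x = ap F ?A X (\<lambda>a. a) a"
    using assms(6) by (rule tpE) blast
  have "ap F X Y f x = ap F ?A Y f a"
    unfolding a(2) by (rule F_rules) (use assms A a in auto)
  moreover have "B \<in> tp F Y (ap F ?A Y f a)"
    using assms A a by (intro tp_image) auto
  ultimately show ?thesis by simp
qed

text \<open>Upward closure is functoriality and the complement law is
  \<open>partitive_compl\<close>. Closure under intersection needs an idea: lift \<open>x\<close> to
  an element \<open>a\<close> over \<open>A\<close> and apply partitivity to
  \<open>a\<close>.\<close>

lemma ultrafilter_tp:
  assumes X: "small u X" and x: "x \<in> on_ob F X"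
  shows "ultrafilter_on X (tp F X x)"
proof (rule ultrafilter_onI)
  have sm: "small u A" if "A \<subseteq> X" for A using X that by (rule small_subset)
  show "X \<in> tp F X x" using X x by (auto intro!: tpI simp: F_rules(3))
  show up: "B \<in> tp F X x" if AB: "A \<in> tp F X x" "A \<subseteq> B" "B \<subseteq> X" for A B
  proof -
    from AB(1) obtain a where a: "A \<subseteq> X" "a \<in> on_ob F A" "x = ap F A X (\<lambda>a. a) a"
      by (rule tpE)
    then show ?thesis using AB X sm by (auto intro!: tp_image)
  qed
  show "A \<inter> B \<in> tp F X x" if A: "A \<in> tp F X x" and B: "B \<in> tp F X x" for A B
  proof -
    from A obtain a where a: "A \<subseteq> X" "a \<in> on_ob F A" "x = ap F A X (\<lambda>a. a) a"
      by (rule tpE)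
    have imp: "C \<in> tp F X x" if "C \<in> tp F A a" for C
    proof -
      have "{b\<in>A. b \<in> C} = C" using tp_subset[OF that] by blast
      then show ?thesis unfolding a(3)
        using that a X sm tp_subset[OF that] by (intro tp_push_subset) auto
    qed
    \<comment> \<open>The other part \<open>A - B\<close> of \<open>A\<close> cannot support
      \<open>a\<close>, since then \<open>X - B\<close> would support \<open>x\<close> along with
      \<open>B\<close>.\<close>
    have "A \<inter> B \<in> tp F A a"
    proof (rule ccontr)
      assume "A \<inter> B \<notin> tp F A a"
      then have "A - A \<inter> B \<in> tp F A a"
        using partitive_compl[of A "A \<inter> B" a] a sm by simp
      then have "A - A \<inter> B \<in> tp F X x" by (rule imp)
      then have "X - B \<in> tp F X x" by (rule up) (use a(1) in auto)
      then show False using partitive_compl[OF X tp_subset[OF B] x] B by simp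
    qed
    then show ?thesis by (rule imp)
  qed
  show "A \<in> tp F X x \<longleftrightarrow> X - A \<notin> tp F X x" if "A \<subseteq> X" for A
    using X that x by (rule partitive_compl)
qed (auto dest: tp_subset)

lemma tp_ap:
  assumes "small u X" "small u Y" "f \<in> X \<rightarrow> Y" "x \<in> on_ob F X"
  shows "tp F Y (ap F X Y f x) = push X Y f (tp F X x)"
proof (rule ultrafilter_subset_eq[symmetric])
  show "ultrafilter_on Y (push X Y f (tp F X x))"
    using assms by (intro ultrafilter_push ultrafilter_tp)
  show "ultrafilter_on Y (tp F Y (ap F X Y f x))"
    using assms by (intro ultrafilter_tp F_rules)
  show "push X Y f (tp F X x) \<subseteq> tp F Y (ap F X Y f x)"
    using tp_push_subset[OF assms] by (auto simp: push_def)
qed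

text \<open>The element comes from the set where \<open>f\<close> and \<open>g\<close> agree, and
  there both have the same restriction. So the action on \<open>x\<close> depends only on germs of
  maps along the type of \<open>x\<close>, which is the link to ultrapowers.\<close>

lemma ap_eq_on:
  assumes "small u X" "small u Y" "f \<in> X \<rightarrow> Y" "g \<in> X \<rightarrow> Y" "x \<in> on_ob F X"
    and eq: "{a\<in>X. f a = g a} \<in> tp F X x"
  shows "ap F X Y f x = ap F X Y g x"
proof -
  let ?A = "{a\<in>X. f a = g a}"
  have A: "small u ?A" by (rule small_subset[OF assms(1)]) auto
  obtain a where a: "a \<in> on_ob F ?A" "x = ap F ?A X (\<lambda>a. a) a"
    using eq by (rule tpE) blast
  have "ap F X Y f x = ap F ?A Y f a"
    unfolding a(2) by (rule F_rules) (use assms A a in auto)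
  also have "\<dots> = ap F ?A Y g a" by (rule ap_cong) auto
  also have "\<dots> = ap F X Y g x"
    unfolding a(2) by (rule F_rules(4)[symmetric]) (use assms A a in auto)
  finally show ?thesis .
qed

lemma inhabited: "x \<in> on_ob F X \<Longrightarrow> X \<noteq> {}"
  using partitive_empty by auto

end

lemma nat_trans_ap:
  fixes u :: "'u itself" and F G :: "'u endo"
  assumes "endofunctor u F" "endofunctor u G" "\<alpha> \<in> nat_trans (set_cat u) (set_cat u) F G"
    and "small u X" "small u Y" "f \<in> X \<rightarrow> Y" "x \<in> on_ob F X"
  shows "\<alpha> Y (ap F X Y f x) = ap G X Y f (\<alpha> X x)"
  using assms(3-) unfolding nat_trans_iff[OF assms(1,2)] by blast

lemma nat_trans_in:
  fixes u :: "'u itself" and F G :: "'u endo"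
  assumes "\<alpha> \<in> nat_trans (set_cat u) (set_cat u) F G" "small u X" "x \<in> on_ob F X"
  shows "\<alpha> X x \<in> on_ob G X"
  using assms by (auto simp: nat_trans_def)

text \<open>Naturality at inclusions of subsets shows that whatever supports \<open>x\<close>
  supports its image; maximality of ultrafilters turns this inclusion into an equality.\<close>

lemma tp_nat_trans:
  fixes u :: "'u itself"
  assumes F: "partitive u F" and G: "partitive u G"
    and a: "\<alpha> \<in> nat_trans (set_cat u) (set_cat u) F G"
    and X: "small u X" and x: "x \<in> on_ob F X"
  shows "tp G X (\<alpha> X x) = tp F X x"
proof (rule ultrafilter_subset_eq[symmetric])
  have ax: "\<alpha> A b \<in> on_ob G A" if "small u A" "b \<in> on_ob F A" for A b
    using a that by (rule nat_trans_in)
  show "ultrafilter_on X (tp F X x)" using F X x by (rule ultrafilter_tp)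
  show "ultrafilter_on X (tp G X (\<alpha> X x))" using G X ax[OF X x] by (rule ultrafilter_tp)
  show "tp F X x \<subseteq> tp G X (\<alpha> X x)"
  proof
    fix A assume "A \<in> tp F X x"
    then obtain b where b: "A \<subseteq> X" "b \<in> on_ob F A" "x = ap F A X (\<lambda>a. a) b" by (rule tpE)
    have A: "small u A" using X b(1) by (rule small_subset)
    have "\<alpha> X x = ap G A X (\<lambda>a. a) (\<alpha> A b)"
      unfolding b(3) by (rule nat_trans_ap[OF partitive_endofunctor[OF F] partitive_endofunctor[OF G] a])
        (use A X b in auto)
    then show "A \<in> tp G X (\<alpha> X x)" using b(1) ax[OF A b(2)] by (rule tpI[rotated 2])
  qed
qed

section \<open>Preservation of finite coproducts of sets in elementary form\<close>

context
  fixes u :: "'u itself"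
  assumes inacc: "inaccessible u"
begin

text \<open>Coproducts of sets are disjoint unions. For the direction from left to right a two-point
  set is enough as test object: uniqueness of induced maps gives joint surjectivity, their existence
  gives joint injectivity.\<close>

lemma is_coproduct_set_cat:
  fixes c :: "'u set"
  shows "is_coproduct (set_cat u) I A c \<iota> \<longleftrightarrow>
    small u c \<and> (\<forall>i\<in>I. small u (A i) \<and> \<iota> i \<in> A i \<rightarrow>\<^sub>E c) \<and>
    (\<forall>y\<in>c. \<exists>!p. p \<in> Sigma I A \<and> \<iota> (fst p) (snd p) = y)" (is "?L \<longleftrightarrow> ?S \<and> ?M \<and> ?B")
proof
  assume L: ?L
  then have S: ?S and M: ?M by (auto simp: is_coproduct_def)
  obtain z w :: 'u where zw: "z \<noteq> w"
    using univ_two_elements[OF inacc] by blast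
  have uniq: "\<exists>!h. h \<in> c \<rightarrow>\<^sub>E {z, w} \<and> (\<forall>i\<in>I. compose (A i) h (\<iota> i) = \<kappa> i)"
    if "\<forall>i\<in>I. \<kappa> i \<in> A i \<rightarrow>\<^sub>E {z, w}" for \<kappa>
    using L that small_finite[OF inacc, of "{z, w}"] by (simp add: is_coproduct_def)
  have ?B
  proof
    fix y assume y: "y \<in> c"
    have ex: "\<exists>i\<in>I. \<exists>a\<in>A i. \<iota> i a = y"
    proof (rule ccontr)
      assume no: "\<not> (\<exists>i\<in>I. \<exists>a\<in>A i. \<iota> i a = y)"
      \<comment> \<open>A constant map and its change at the missed point \<open>y\<close> agree on
        every summand.\<close>
      let ?h = "\<lambda>v\<in>c. z" and ?k = "\<lambda>v\<in>c. if v = y then w else z"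
      have "compose (A i) ?h (\<iota> i) = (\<lambda>a\<in>A i. z)" if "i \<in> I" for i
        using M that by (auto simp: compose_def fun_eq_iff)
      moreover have "compose (A i) ?k (\<iota> i) = (\<lambda>a\<in>A i. z)" if "i \<in> I" for i
        using M no that by (auto simp: compose_def fun_eq_iff)
      moreover have "?h \<in> c \<rightarrow>\<^sub>E {z, w}" "?k \<in> c \<rightarrow>\<^sub>E {z, w}" by auto
      moreover have "\<exists>!h. h \<in> c \<rightarrow>\<^sub>E {z, w} \<and> (\<forall>i\<in>I. compose (A i) h (\<iota> i) = (\<lambda>a\<in>A i. z))"
        by (rule uniq) auto
      then obtain h0 where "\<And>h. h \<in> c \<rightarrow>\<^sub>E {z, w} \<and> (\<forall>i\<in>I. compose (A i) h (\<iota> i) = (\<lambda>a\<in>A i. z)) \<Longrightarrow> h = h0"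
        by (elim ex1E) iprover
      ultimately have "?h = h0" "?k = h0" by blast+
      then have "?h = ?k" by simp
      from fun_cong[OF this, of y] show False using y zw by simp
    qed
    then obtain i a where ia: "i \<in> I" "a \<in> A i" "\<iota> i a = y" by blast
    show "\<exists>!p. p \<in> Sigma I A \<and> \<iota> (fst p) (snd p) = y"
    proof (rule ex1I[of _ "(i, a)"])
      fix p assume p: "p \<in> Sigma I A \<and> \<iota> (fst p) (snd p) = y"
      \<comment> \<open>The cocone singles out the point \<open>(i, a)\<close> of the disjoint
        union; the induced map has value \<open>z\<close> at \<open>y\<close>, so no other point can
        lie over \<open>y\<close>.\<close>
      let ?\<kappa> = "\<lambda>k. \<lambda>v\<in>A k. if (k, v) = (i, a) then z else w"
      have "\<forall>i\<in>I. ?\<kappa> i \<in> A i \<rightarrow>\<^sub>E {z, w}" by auto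
      from ex1_implies_ex[OF uniq[OF this]]
      obtain h where h: "\<And>k. k \<in> I \<Longrightarrow> compose (A k) h (\<iota> k) = ?\<kappa> k" by auto
      have "h y = z" using fun_cong[OF h[OF ia(1)], of a] ia by (simp add: compose_def)
      moreover have "h y = ?\<kappa> (fst p) (snd p)"
        using fun_cong[OF h, of "fst p" "snd p"] p by (auto simp: compose_def)
      ultimately show "p = (i, a)" using p zw by (auto split: if_splits)
    qed (use ia in auto)
  qed
  with S M show "?S \<and> ?M \<and> ?B" by blast
next
  assume R: "?S \<and> ?M \<and> ?B"
  have "\<exists>!h. h \<in> c \<rightarrow>\<^sub>E d \<and> (\<forall>i\<in>I. compose (A i) h (\<iota> i) = \<kappa> i)"
    if \<kappa>: "\<forall>i\<in>I. \<kappa> i \<in> A i \<rightarrow>\<^sub>E d" for d \<kappa>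
  proof -
    define q where "q y = (THE p. p \<in> Sigma I A \<and> \<iota> (fst p) (snd p) = y)" for y
    have q: "q y \<in> Sigma I A \<and> \<iota> (fst (q y)) (snd (q y)) = y" if "y \<in> c" for y
      unfolding q_def by (rule theI') (use R that in blast)
    have q_eq: "q (\<iota> i a) = (i, a)" if "i \<in> I" "a \<in> A i" for i a
    proof -
      have "\<iota> i a \<in> c" using R that by blast
      then show ?thesis using q[of "\<iota> i a"] R that by (metis SigmaI fst_conv snd_conv)
    qed
    show ?thesis
    proof (rule ex1I[of _ "\<lambda>y\<in>c. \<kappa> (fst (q y)) (snd (q y))"], intro conjI ballI)
      show "(\<lambda>y\<in>c. \<kappa> (fst (q y)) (snd (q y))) \<in> c \<rightarrow>\<^sub>E d"
        using q \<kappa> by (force simp: Pi_iff)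
      fix i assume i: "i \<in> I"
      have "\<iota> i a \<in> c" if "a \<in> A i" for a using R i that by blast
      moreover have "\<kappa> i \<in> extensional (A i)" using \<kappa> i by (auto simp: PiE_def)
      ultimately show "compose (A i) (\<lambda>y\<in>c. \<kappa> (fst (q y)) (snd (q y))) (\<iota> i) = \<kappa> i"
        using i by (auto simp: compose_def fun_eq_iff q_eq extensional_def)
    next
      fix h assume h: "h \<in> c \<rightarrow>\<^sub>E d \<and> (\<forall>i\<in>I. compose (A i) h (\<iota> i) = \<kappa> i)"
      show "h = (\<lambda>y\<in>c. \<kappa> (fst (q y)) (snd (q y)))"
      proof (rule extensionalityI[of _ c])
        fix y assume y: "y \<in> c"
        have "h (\<iota> (fst (q y)) (snd (q y))) = \<kappa> (fst (q y)) (snd (q y))"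
          using h q[OF y] by (metis compose_eq mem_Sigma_iff prod.collapse)
        then show "h y = (\<lambda>y\<in>c. \<kappa> (fst (q y)) (snd (q y))) y" using q[OF y] y by simp
      qed (use h in \<open>auto simp: PiE_def\<close>)
    qed
  qed
  then have "\<forall>d. small u d \<longrightarrow> (\<forall>\<kappa>. (\<forall>i\<in>I. \<kappa> i \<in> A i \<rightarrow>\<^sub>E d) \<longrightarrow>
      (\<exists>!h. h \<in> c \<rightarrow>\<^sub>E d \<and> (\<forall>i\<in>I. compose (A i) h (\<iota> i) = \<kappa> i)))"
    by (intro allI impI)
  then show ?L using R by (simp add: is_coproduct_def)
qed

text \<open>Preservation is applied to the empty coproduct and to \<open>X\<close> as the sum of
  \<open>A\<close> and \<open>X - A\<close>. Conversely, by primeness the type of an element over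
  \<open>c\<close> contains the image of one of the finitely many summands, and of only one, since
  disjoint sets cannot both belong to an ultrafilter.\<close>

lemma preserves_finite_coproducts_iff:
  fixes F :: "'u endo"
  assumes F: "endofunctor u F"
  shows "preserves_finite_coproducts (set_cat u) (set_cat u) F \<longleftrightarrow> partitive u F"
proof
  assume P: "preserves_finite_coproducts (set_cat u) (set_cat u) F"
  note pres = P[unfolded preserves_finite_coproducts_def, rule_format, OF conjI]
  have "is_coproduct (set_cat u) ({} :: nat set) (\<lambda>_. {}) ({} :: 'u set) (\<lambda>_. undefined)"
    unfolding is_coproduct_set_cat by (simp add: small_finite[OF inacc])
  from pres[OF finite.emptyI this] have e: "on_ob F {} = {}" unfolding is_coproduct_set_cat by auto
  have "A \<in> tp F X x \<longleftrightarrow> X - A \<notin> tp F X x"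
    if X: "small u X" and A: "A \<subseteq> X" and x: "x \<in> on_ob F X" for X A x
  proof -
    define B where "B i = (if i = (0::nat) then A else X - A)" for i
    have B: "B i \<subseteq> X" for i using A by (auto simp: B_def)
    have sB: "small u (B i)" for i using X B by (rule small_subset)
    have "is_coproduct (set_cat u) {0, 1::nat} B X (\<lambda>i. \<lambda>a\<in>B i. a)"
      unfolding is_coproduct_set_cat
    proof (intro conjI ballI)
      fix y assume y: "y \<in> X"
      show "\<exists>!p. p \<in> Sigma {0, 1} B \<and> (\<lambda>a\<in>B (fst p). a) (snd p) = y"
        by (rule ex1I[of _ "(if y \<in> A then 0 else 1, y)"])
          (use y in \<open>auto simp: B_def split: if_splits\<close>)
    qed (use X B sB in auto)
    from pres[OF _ this]
    have "\<exists>!p. p \<in> Sigma {0, 1} (\<lambda>i. on_ob F (B i)) \<and> ap F (B (fst p)) X (\<lambda>a. a) (snd p) = x"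
      using x unfolding is_coproduct_set_cat ap_def by simp
    then show ?thesis
    proof (elim ex1E conjE)
      fix p assume p: "p \<in> Sigma {0, 1} (\<lambda>i. on_ob F (B i))" "ap F (B (fst p)) X (\<lambda>a. a) (snd p) = x"
        and un: "\<forall>q. q \<in> Sigma {0, 1} (\<lambda>i. on_ob F (B i)) \<and> ap F (B (fst q)) X (\<lambda>a. a) (snd q) = x \<longrightarrow> q = p"
      have iff: "B i \<in> tp F X x \<longleftrightarrow> i = fst p" if "i \<in> {0, 1}" for i
      proof
        assume "B i \<in> tp F X x"
        then obtain b where "b \<in> on_ob F (B i)" "x = ap F (B i) X (\<lambda>a. a) b" by (rule tpE)
        then have "(i, b) = p" using un that by (metis (no_types, lifting) SigmaI fst_conv snd_conv)
        then show "i = fst p" by auto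
      next
        assume "i = fst p"
        then show "B i \<in> tp F X x" using p B[of i] by (auto intro!: tpI[of _ _ "snd p"])
      qed
      have "fst p \<in> {0, 1}" using p by auto
      then show ?thesis using iff[of 0] iff[of 1] by (auto simp: B_def)
    qed
  qed
  with F e show "partitive u F" unfolding partitive_def by blast
next
  assume p: "partitive u F"
  note F_rules = F_rules[OF p]
  show "preserves_finite_coproducts (set_cat u) (set_cat u) F"
    unfolding preserves_finite_coproducts_def
  proof (intro allI impI, elim conjE)
    fix I :: "nat set" and A and c :: "'u set" and \<iota>
    assume I: "finite I" and co: "is_coproduct (set_cat u) I A c \<iota>"
    have c: "small u c" and A: "\<And>i. i \<in> I \<Longrightarrow> small u (A i)"
      and \<iota>E: "\<And>i. i \<in> I \<Longrightarrow> \<iota> i \<in> A i \<rightarrow>\<^sub>E c"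
      and un: "\<And>y. y \<in> c \<Longrightarrow> \<exists>!p. p \<in> Sigma I A \<and> \<iota> (fst p) (snd p) = y"
      using co unfolding is_coproduct_set_cat by blast+
    have \<iota>: "\<iota> i \<in> A i \<rightarrow> c" if "i \<in> I" for i using \<iota>E[OF that] by auto
    have inj: "i = j \<and> a = b" if "i \<in> I" "j \<in> I" "a \<in> A i" "b \<in> A j" "\<iota> i a = \<iota> j b" for i j a b
    proof -
      have "\<iota> i a \<in> c" using \<iota> that by blast
      from un[OF this] show ?thesis using that by (metis (no_types, lifting) SigmaI fst_conv snd_conv)
    qed
    show "is_coproduct (set_cat u) I (\<lambda>i. on_ob F (A i)) (on_ob F c) (\<lambda>i. on_hom F (A i) c (\<iota> i))"
      unfolding is_coproduct_set_cat
    proof (intro conjI ballI)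
      show "small u (on_ob F c)" using c by (rule F_rules)
      show "small u (on_ob F (A i))" if "i \<in> I" for i using A[OF that] by (rule F_rules)
      show "on_hom F (A i) c (\<iota> i) \<in> on_ob F (A i) \<rightarrow>\<^sub>E on_ob F c" if "i \<in> I" for i
        using partitive_endofunctor[OF p] A[OF that] c \<iota>E[OF that] by (rule on_hom_PiE)
      fix y assume y: "y \<in> on_ob F c"
      note uf = ultrafilter_tp[OF p c y]
      have "v \<in> (\<Union>i\<in>I. \<iota> i ` A i)" if "v \<in> c" for v
        using ex1_implies_ex[OF un[OF that]] by force
      then have "(\<Union>i\<in>I. \<iota> i ` A i) = c" using \<iota> by blast
      then obtain i where i: "i \<in> I" "\<iota> i ` A i \<in> tp F c y"
        using uf_finite_UN[OF uf I, of "\<lambda>i. \<iota> i ` A i"] uf_top[OF uf] by auto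
      from i(2) obtain b where b: "\<iota> i ` A i \<subseteq> c" "b \<in> on_ob F (\<iota> i ` A i)"
          "y = ap F (\<iota> i ` A i) c (\<lambda>a. a) b" by (rule tpE)
      let ?s = "inv_into (A i) (\<iota> i)"
      have iA: "small u (\<iota> i ` A i)" using A[OF i(1)] by (rule small_image)
      have s: "?s \<in> \<iota> i ` A i \<rightarrow> A i" by (auto intro: inv_into_into)
      have "ap F (A i) c (\<iota> i) (ap F (\<iota> i ` A i) (A i) ?s b) = ap F (\<iota> i ` A i) c (\<lambda>a. \<iota> i (?s a)) b"
        using iA A[OF i(1)] c s \<iota>[OF i(1)] b(2) by (rule F_rules)
      also have "\<dots> = y" unfolding b(3) by (rule ap_cong) (auto simp: f_inv_into_f)
      finally have ex: "ap F (A i) c (\<iota> i) (ap F (\<iota> i ` A i) (A i) ?s b) = y" .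
      have mem: "ap F (\<iota> i ` A i) (A i) ?s b \<in> on_ob F (A i)"
        using iA A[OF i(1)] s b(2) by (rule F_rules)
      have eq: "on_hom F (A i) c (\<iota> i) a = ap F (A i) c (\<iota> i) a" if "i \<in> I" for i a
        using \<iota>E[OF that] by (rule on_hom_eq_ap)
      show "\<exists>!p. p \<in> Sigma I (\<lambda>i. on_ob F (A i)) \<and> on_hom F (A (fst p)) c (\<iota> (fst p)) (snd p) = y"
      proof (rule ex1I[of _ "(i, ap F (\<iota> i ` A i) (A i) ?s b)"])
        fix q assume "q \<in> Sigma I (\<lambda>i. on_ob F (A i)) \<and> on_hom F (A (fst q)) c (\<iota> (fst q)) (snd q) = y"
        then obtain j a where q: "q = (j, a)" and j: "j \<in> I" and a: "a \<in> on_ob F (A j)"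
          and y_eq: "y = ap F (A j) c (\<iota> j) a" using eq by (cases q) auto
        have "\<iota> j ` A j \<in> tp F c y"
          unfolding y_eq using A[OF j] c \<iota>[OF j] a by (intro tp_image[OF p]) auto
        then have "\<iota> i ` A i \<inter> \<iota> j ` A j \<in> tp F c y" using i(2) by (intro uf_Int[OF uf])
        then have ji: "j = i" using uf_nonempty[OF uf] inj[OF i(1) j] by fastforce
        \<comment> \<open>\<open>A i\<close> is inhabited because there is an element of
          \<open>F\<close> over it and \<open>F\<close> is empty on the empty set. So the injection
          \<open>\<iota> i\<close> has a retraction \<open>r\<close>, with default \<open>z\<close>
          off its image, and functoriality makes the action of \<open>\<iota> i\<close>
          injective.\<close>
        obtain z where z: "z \<in> A i" using inhabited[OF p a] ji by blast
        define r where "r v = (if v \<in> \<iota> i ` A i then ?s v else z)" for v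
        have r: "r \<in> c \<rightarrow> A i" using z s by (auto simp: r_def)
        have ri: "r (\<iota> i v) = v" if "v \<in> A i" for v
        proof -
          have "inj_on (\<iota> i) (A i)" using inj[OF i(1) i(1)] by (auto simp: inj_on_def)
          then show ?thesis using that by (simp add: r_def)
        qed
        have split: "ap F c (A i) r (ap F (A i) c (\<iota> i) v) = v" if "v \<in> on_ob F (A i)" for v
          by (subst F_rules(4)) (use that c A i(1) \<iota> r ri in \<open>auto intro!: F_rules(3)\<close>)
        show "q = (i, ap F (\<iota> i ` A i) (A i) ?s b)"
          using split[OF mem] split[of a] a ji q ex y_eq by simp
      qed (use i ex mem eq[OF i(1)] in simp)
    qed
  qed
qed

lemma FC_Ob_iff: "F \<in> Ob (FC u) \<longleftrightarrow> partitive u F \<and> functor_ext (set_cat u) F"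
proof -
  have "F \<in> Ob (FC u) \<longleftrightarrow> endofunctor u F \<and> functor_ext (set_cat u) F \<and>
      preserves_finite_coproducts (set_cat u) (set_cat u) F"
    by (simp add: FC_def full_subcat_def functor_cat_def)
  then show ?thesis using preserves_finite_coproducts_iff partitive_endofunctor by blast
qed

end

lemma FC_Comp_apply:
  "small u X \<Longrightarrow> x \<in> on_ob F X \<Longrightarrow> Comp (FC u) F G H \<beta> \<alpha> X x = \<beta> X (\<alpha> X x)"
  by (simp add: FC_simps compose_eq)

lemma FC_Id_apply: "small u X \<Longrightarrow> x \<in> on_ob F X \<Longrightarrow> Id (FC u) F X x = x"
  by (simp add: FC_simps)

section \<open>Natural transformations and endofunctors built from uncoded data\<close>

definition mk_nat :: "'u itself \<Rightarrow> 'u endo \<Rightarrow> ('u set \<Rightarrow> 'u \<Rightarrow> 'u) \<Rightarrow> 'u set \<Rightarrow> 'u \<Rightarrow> 'u" where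
  "mk_nat u F p = (\<lambda>X\<in>{X. small u X}. \<lambda>x\<in>on_ob F X. p X x)"

lemma mk_nat_apply [simp]: "small u X \<Longrightarrow> x \<in> on_ob F X \<Longrightarrow> mk_nat u F p X x = p X x"
  by (simp add: mk_nat_def)

text \<open>\<open>T\<close> and \<open>M\<close> describe a functor whose values have elements of
  any type; the values are moved into \<open>'u\<close> along \<open>enc\<close>, and the action
  decodes, applies \<open>M\<close> and encodes again. The value \<open>undefined\<close> outside
  the category is what \<open>functor_ext\<close> demands.\<close>

definition mk_endo :: "'u itself \<Rightarrow> ('u set \<Rightarrow> 't set) \<Rightarrow>
    ('u set \<Rightarrow> 'u set \<Rightarrow> ('u \<Rightarrow> 'u) \<Rightarrow> 't \<Rightarrow> 't) \<Rightarrow> 'u endo" where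
  "mk_endo u T M =
     \<lparr>on_ob = (\<lambda>X\<in>{X. small u X}. enc (T X) ` T X),
      on_hom = (\<lambda>X Y f. if small u X \<and> small u Y \<and> f \<in> X \<rightarrow>\<^sub>E Y
        then (\<lambda>t\<in>enc (T X) ` T X. enc (T Y) (M X Y f (inv_into (T X) (enc (T X)) t))) else undefined)\<rparr>"

text \<open>The maps are arbitrary functions that matter only on their domain
  (\<open>M_cong\<close>), so inclusions and composites can be written without restrictions.\<close>

locale endo_data =
  fixes u :: "'u itself" and T :: "'u set \<Rightarrow> 't set"
    and M :: "'u set \<Rightarrow> 'u set \<Rightarrow> ('u \<Rightarrow> 'u) \<Rightarrow> 't \<Rightarrow> 't"
  assumes T_small: "small u X \<Longrightarrow> small u (T X)"
    and M_in: "small u X \<Longrightarrow> small u Y \<Longrightarrow> f \<in> X \<rightarrow> Y \<Longrightarrow> t \<in> T X \<Longrightarrow> M X Y f t \<in> T Y"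
    and M_id: "small u X \<Longrightarrow> t \<in> T X \<Longrightarrow> M X X (\<lambda>a. a) t = t"
    and M_comp: "small u X \<Longrightarrow> small u Y \<Longrightarrow> small u Z \<Longrightarrow> f \<in> X \<rightarrow> Y \<Longrightarrow> g \<in> Y \<rightarrow> Z \<Longrightarrow> t \<in> T X \<Longrightarrow>
      M Y Z g (M X Y f t) = M X Z (\<lambda>a. g (f a)) t"
    and M_cong: "small u X \<Longrightarrow> t \<in> T X \<Longrightarrow> (\<And>a. a \<in> X \<Longrightarrow> f a = g a) \<Longrightarrow> M X Y f t = M X Y g t"
begin

abbreviation E :: "'u endo" where "E \<equiv> mk_endo u T M"

lemma E_ob: "small u X \<Longrightarrow> on_ob E X = enc (T X) ` T X"
  by (simp add: mk_endo_def)

lemma enc_in: "small u X \<Longrightarrow> t \<in> T X \<Longrightarrow> enc (T X) t \<in> on_ob E X"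
  by (simp add: E_ob)

lemma E_cases:
  assumes "small u X" "x \<in> on_ob E X"
  obtains t where "t \<in> T X" "x = enc (T X) t"
  using assms by (auto simp: E_ob)

lemma E_ap:
  assumes "small u X" "small u Y" "f \<in> X \<rightarrow> Y" "t \<in> T X"
  shows "ap E X Y f (enc (T X) t) = enc (T Y) (M X Y f t)"
proof -
  have "restrict f X \<in> X \<rightarrow>\<^sub>E Y" using assms by auto
  moreover have "inv_into (T X) (enc (T X) :: _ \<Rightarrow> 'u) (enc (T X) t) = t"
    using inj_enc[OF T_small[OF assms(1)]] assms(4) by (rule inv_into_f_f)
  moreover have "M X Y (restrict f X) t = M X Y f t"
    using assms by (intro M_cong) auto
  ultimately show ?thesis using assms by (simp add: ap_def mk_endo_def)
qed

lemma E_ap_in: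
  assumes "small u X" "small u Y" "f \<in> X \<rightarrow> Y" "x \<in> on_ob E X"
  shows "ap E X Y f x \<in> on_ob E Y"
proof -
  obtain t where "t \<in> T X" "x = enc (T X) t" using assms(1,4) by (rule E_cases)
  then show ?thesis using assms(1-3) by (simp add: E_ap M_in enc_in)
qed

lemma E_on_hom: "f \<in> X \<rightarrow>\<^sub>E Y \<Longrightarrow> small u X \<Longrightarrow> small u Y \<Longrightarrow> on_hom E X Y f = (\<lambda>x\<in>on_ob E X. ap E X Y f x)"
  by (auto simp: ap_def mk_endo_def fun_eq_iff PiE_restrict)

lemma E_endofunctor: "endofunctor u E"
  unfolding is_functor_def set_cat_simps mem_Collect_eq
proof (intro conjI ballI allI impI)
  fix X :: "'u set" assume "X \<in> {A. small u A}"
  then have X: "small u X" by simp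
  show "small u (on_ob E X)" using X by (simp add: E_ob small_image T_small)
  have i: "(\<lambda>a\<in>X. a) \<in> X \<rightarrow>\<^sub>E X" by auto
  have "ap E X X (\<lambda>a\<in>X. a) x = x" if "x \<in> on_ob E X" for x
  proof -
    have "ap E X X (\<lambda>a\<in>X. a) x = ap E X X (\<lambda>a. a) x" by (rule ap_cong) auto
    moreover obtain t where "t \<in> T X" "x = enc (T X) t" using E_cases[OF X \<open>x \<in> on_ob E X\<close>] by blast
    ultimately show ?thesis using X by (simp add: E_ap M_id)
  qed
  then show "on_hom E X X (\<lambda>a\<in>X. a) = (\<lambda>x\<in>on_ob E X. x)"
    unfolding E_on_hom[OF i X X] by (auto simp: fun_eq_iff)
next
  fix X Y :: "'u set" and f assume "X \<in> {A. small u A}" "Y \<in> {A. small u A}" and f: "f \<in> X \<rightarrow>\<^sub>E Y"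
  then have X: "small u X" and Y: "small u Y" by simp_all
  show "on_hom E X Y f \<in> on_ob E X \<rightarrow>\<^sub>E on_ob E Y"
    using f unfolding E_on_hom[OF f X Y] by (auto intro: E_ap_in[OF X Y])
next
  fix X Y Z :: "'u set" and f g
  assume "X \<in> {A. small u A}" "Y \<in> {A. small u A}" "Z \<in> {A. small u A}"
    and f: "f \<in> X \<rightarrow>\<^sub>E Y" and g: "g \<in> Y \<rightarrow>\<^sub>E Z"
  then have X: "small u X" and Y: "small u Y" and Z: "small u Z" by simp_all
  have c: "compose X g f \<in> X \<rightarrow>\<^sub>E Z" using f g by (auto simp: compose_def)
  have f': "f \<in> X \<rightarrow> Y" and g': "g \<in> Y \<rightarrow> Z" and gf': "(\<lambda>a. g (f a)) \<in> X \<rightarrow> Z" using f g by auto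
  have "ap E X Z (compose X g f) x = ap E Y Z g (ap E X Y f x)" if "x \<in> on_ob E X" for x
  proof -
    have "ap E X Z (compose X g f) x = ap E X Z (\<lambda>a. g (f a)) x"
      by (rule ap_cong) (simp add: compose_def)
    moreover obtain t where "t \<in> T X" "x = enc (T X) t" using E_cases[OF X \<open>x \<in> on_ob E X\<close>] by blast
    ultimately show ?thesis using X Y Z f' g' gf' by (simp add: E_ap M_comp M_in)
  qed
  then show "on_hom E X Z (compose X g f) = compose (on_ob E X) (on_hom E Y Z g) (on_hom E X Y f)"
    unfolding E_on_hom[OF f X Y] E_on_hom[OF g Y Z] E_on_hom[OF c X Z]
    by (auto simp: fun_eq_iff compose_def E_ap_in[OF X Y f'])
qed

lemma E_functor_ext: "functor_ext (set_cat u) E"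
  by (auto simp: functor_ext_def mk_endo_def)

text \<open>Types can be computed before encoding, because \<open>enc\<close> is injective on
  \<open>T X\<close>.\<close>

lemma E_tp:
  assumes X: "small u X" and t: "t \<in> T X"
  shows "tp E X (enc (T X) t) = {A. A \<subseteq> X \<and> t \<in> M A X (\<lambda>a. a) ` T A}"
proof -
  have "enc (T X) t \<in> ap E A X (\<lambda>a. a) ` on_ob E A \<longleftrightarrow> t \<in> M A X (\<lambda>a. a) ` T A" if "A \<subseteq> X" for A
  proof -
    have A: "small u A" using X that by (rule small_subset)
    have i: "(\<lambda>a. a) \<in> A \<rightarrow> X" using that by auto
    have "ap E A X (\<lambda>a. a) ` on_ob E A = (\<lambda>s. enc (T X) (M A X (\<lambda>a. a) s)) ` T A"
      unfolding E_ob[OF A] image_image by (rule image_cong) (auto simp: E_ap[OF A X i])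
    also have "enc (T X) t \<in> \<dots> \<longleftrightarrow> t \<in> M A X (\<lambda>a. a) ` T A"
      using enc_eq_iff[OF T_small[OF X] t M_in[OF A X i]] by auto
    finally show ?thesis .
  qed
  then show ?thesis by (auto simp: tp_def)
qed

lemma E_in_FC:
  assumes inacc: "inaccessible u" and e: "T {} = {}"
    and part: "\<And>X t. small u X \<Longrightarrow> t \<in> T X \<Longrightarrow> ultrafilter_on X {A. A \<subseteq> X \<and> t \<in> M A X (\<lambda>a. a) ` T A}"
  shows "E \<in> Ob (FC u)"
proof -
  have "partitive u E"
    unfolding partitive_def
  proof (intro conjI allI impI)
    show "on_ob E {} = {}" using E_ob[OF small_finite[OF inacc finite.emptyI]] e by simp
    fix X A x assume X: "small u X" and A: "A \<subseteq> X" and x: "x \<in> on_ob E X"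
    obtain t where t: "t \<in> T X" "x = enc (T X) t" using X x by (rule E_cases)
    show "A \<in> tp E X x \<longleftrightarrow> X - A \<notin> tp E X x"
      using uf_compl[OF part[OF X t(1)] A] unfolding t(2) E_tp[OF X t(1)] by blast
  qed (rule E_endofunctor)
  then show ?thesis using E_functor_ext by (simp add: FC_Ob_iff[OF inacc])
qed

end

context
  fixes u :: "'u itself"
  assumes inacc: "inaccessible u"
begin

lemma FC_partitive: "F \<in> Ob (FC u) \<Longrightarrow> partitive u F"
  by (simp add: FC_Ob_iff[OF inacc])

lemma FC_endofunctor: "F \<in> Ob (FC u) \<Longrightarrow> endofunctor u F"
  by (rule partitive_endofunctor[OF FC_partitive])

context
  fixes F G :: "'u endo"
  assumes F: "F \<in> Ob (FC u)" and G: "G \<in> Ob (FC u)"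
begin

lemma FC_Hom_in: "\<alpha> \<in> Hom (FC u) F G \<Longrightarrow> small u X \<Longrightarrow> x \<in> on_ob F X \<Longrightarrow> \<alpha> X x \<in> on_ob G X"
  unfolding FC_simps by (rule nat_trans_in)

lemma FC_Hom_ap: "\<alpha> \<in> Hom (FC u) F G \<Longrightarrow> small u X \<Longrightarrow> small u Y \<Longrightarrow> f \<in> X \<rightarrow> Y \<Longrightarrow> x \<in> on_ob F X \<Longrightarrow>
    \<alpha> Y (ap F X Y f x) = ap G X Y f (\<alpha> X x)"
  unfolding FC_simps by (rule nat_trans_ap[OF FC_endofunctor[OF F] FC_endofunctor[OF G]])

lemma FC_Hom_tp: "\<alpha> \<in> Hom (FC u) F G \<Longrightarrow> small u X \<Longrightarrow> x \<in> on_ob F X \<Longrightarrow> tp G X (\<alpha> X x) = tp F X x"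
  unfolding FC_simps by (rule tp_nat_trans[OF FC_partitive[OF F] FC_partitive[OF G]])

lemma FC_Hom_eqI: "\<alpha> \<in> Hom (FC u) F G \<Longrightarrow> \<beta> \<in> Hom (FC u) F G \<Longrightarrow>
    (\<And>X x. small u X \<Longrightarrow> x \<in> on_ob F X \<Longrightarrow> \<alpha> X x = \<beta> X x) \<Longrightarrow> \<alpha> = \<beta>"
  unfolding FC_simps by (rule nat_trans_eqI)

lemma mk_nat_in:
  assumes "\<And>X x. small u X \<Longrightarrow> x \<in> on_ob F X \<Longrightarrow> p X x \<in> on_ob G X"
    and "\<And>X Y f x. small u X \<Longrightarrow> small u Y \<Longrightarrow> f \<in> X \<rightarrow> Y \<Longrightarrow> x \<in> on_ob F X \<Longrightarrow>
      p Y (ap F X Y f x) = ap G X Y f (p X x)"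
  shows "mk_nat u F p \<in> Hom (FC u) F G"
  unfolding FC_simps nat_trans_iff[OF FC_endofunctor[OF F] FC_endofunctor[OF G]]
proof (intro conjI allI impI)
  show "mk_nat u F p \<in> extensional {X. small u X}" by (simp add: mk_nat_def)
  fix X :: "'u set" assume X: "small u X"
  show "mk_nat u F p X \<in> on_ob F X \<rightarrow>\<^sub>E on_ob G X"
    using X assms(1) by (simp add: mk_nat_def)
  fix Y :: "'u set" and f x assume "small u Y" "f \<in> X \<rightarrow> Y" "x \<in> on_ob F X"
  then show "mk_nat u F p Y (ap F X Y f x) = ap G X Y f (mk_nat u F p X x)"
    using X assms(2) ap_in[OF FC_endofunctor[OF F] X] by simp
qed

end

end

section \<open>Cofree functors\<close>

text \<open>
  An element over \<open>Y\<close> is an ultrafilter on \<open>Y\<close> with an \<open>S\<close>-valued function of germs of maps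
  \<open>Y \<rightarrow> Z\<close>.  For \<open>\<theta> a b = a\<close> this is the right adjoint of evaluation at \<open>Z\<close>, applied to \<open>S\<close>.  For
  \<open>\<theta> = (=)\<close> the function sees the germs only up to their kernels, so that \<open>Z\<close> may be large and,
  with \<open>Z = UNIV\<close> and two values, the functor classifies subfunctors.
\<close>

definition cof_T :: "'u set \<Rightarrow> ('u \<Rightarrow> 'u \<Rightarrow> 't) \<Rightarrow> 'u set \<Rightarrow> 'u set \<Rightarrow> ('u set set \<times> (('u \<Rightarrow> 'u) \<Rightarrow> 'u)) set" where
  "cof_T Z \<theta> S Y = {(\<V>, h). ultrafilter_on Y \<V> \<and> h \<in> (Y \<rightarrow>\<^sub>E Z) \<rightarrow>\<^sub>E S \<and>
     (\<forall>g\<in>Y \<rightarrow>\<^sub>E Z. \<forall>g'\<in>Y \<rightarrow>\<^sub>E Z. \<forall>A\<in>\<V>.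
        (\<forall>a\<in>A. \<forall>b\<in>A. \<theta> (g a) (g b) = \<theta> (g' a) (g' b)) \<longrightarrow> h g = h g')}"

definition cof_M :: "'u set \<Rightarrow> 'u set \<Rightarrow> 'u set \<Rightarrow> ('u \<Rightarrow> 'u) \<Rightarrow>
    'u set set \<times> (('u \<Rightarrow> 'u) \<Rightarrow> 'u) \<Rightarrow> 'u set set \<times> (('u \<Rightarrow> 'u) \<Rightarrow> 'u)" where
  "cof_M Z Y Y' f = (\<lambda>(\<V>, h). (push Y Y' f \<V>, \<lambda>g\<in>Y' \<rightarrow>\<^sub>E Z. h (compose Y g f)))"

definition cofree :: "'u itself \<Rightarrow> 'u set \<Rightarrow> ('u \<Rightarrow> 'u \<Rightarrow> 't) \<Rightarrow> 'u set \<Rightarrow> 'u endo" where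
  "cofree u Z \<theta> S = mk_endo u (cof_T Z \<theta> S) (cof_M Z)"

lemma compose_PiE: "f \<in> X \<rightarrow> Y \<Longrightarrow> g \<in> Y \<rightarrow>\<^sub>E Z \<Longrightarrow> compose X g f \<in> X \<rightarrow>\<^sub>E Z"
  by (auto simp: compose_def)

lemma cof_T_I:
  assumes "ultrafilter_on Y \<V>" "h \<in> (Y \<rightarrow>\<^sub>E Z) \<rightarrow>\<^sub>E S"
    and "\<And>g g' A. g \<in> Y \<rightarrow>\<^sub>E Z \<Longrightarrow> g' \<in> Y \<rightarrow>\<^sub>E Z \<Longrightarrow> A \<in> \<V> \<Longrightarrow>
      (\<And>a b. a \<in> A \<Longrightarrow> b \<in> A \<Longrightarrow> \<theta> (g a) (g b) = \<theta> (g' a) (g' b)) \<Longrightarrow> h g = h g'"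
  shows "(\<V>, h) \<in> cof_T Z \<theta> S Y"
  unfolding cof_T_def mem_Collect_eq prod.case
proof (intro conjI ballI impI)
  fix g g' A assume "g \<in> Y \<rightarrow>\<^sub>E Z" "g' \<in> Y \<rightarrow>\<^sub>E Z" "A \<in> \<V>"
    and "\<forall>a\<in>A. \<forall>b\<in>A. \<theta> (g a) (g b) = \<theta> (g' a) (g' b)"
  then show "h g = h g'" by (intro assms(3)) blast+
qed (fact assms)+

lemma cof_T_E:
  assumes "(\<V>, h) \<in> cof_T Z \<theta> S Y"
  shows "ultrafilter_on Y \<V>" "h \<in> (Y \<rightarrow>\<^sub>E Z) \<rightarrow>\<^sub>E S"
    "g \<in> Y \<rightarrow>\<^sub>E Z \<Longrightarrow> g' \<in> Y \<rightarrow>\<^sub>E Z \<Longrightarrow> A \<in> \<V> \<Longrightarrow>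
      (\<And>a b. a \<in> A \<Longrightarrow> b \<in> A \<Longrightarrow> \<theta> (g a) (g b) = \<theta> (g' a) (g' b)) \<Longrightarrow> h g = h g'"
proof -
  show "ultrafilter_on Y \<V>" "h \<in> (Y \<rightarrow>\<^sub>E Z) \<rightarrow>\<^sub>E S"
    using assms unfolding cof_T_def by simp_all
  assume *: "g \<in> Y \<rightarrow>\<^sub>E Z" "g' \<in> Y \<rightarrow>\<^sub>E Z" "A \<in> \<V>"
    and "\<And>a b. a \<in> A \<Longrightarrow> b \<in> A \<Longrightarrow> \<theta> (g a) (g b) = \<theta> (g' a) (g' b)"
  then have "\<forall>a\<in>A. \<forall>b\<in>A. \<theta> (g a) (g b) = \<theta> (g' a) (g' b)" by blast
  moreover have "\<forall>g\<in>Y \<rightarrow>\<^sub>E Z. \<forall>g'\<in>Y \<rightarrow>\<^sub>E Z. \<forall>A\<in>\<V>.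
      (\<forall>a\<in>A. \<forall>b\<in>A. \<theta> (g a) (g b) = \<theta> (g' a) (g' b)) \<longrightarrow> h g = h g'"
    using assms unfolding cof_T_def by blast
  ultimately show "h g = h g'" using * by blast
qed

lemma cof_M_comp:
  assumes "f \<in> X \<rightarrow> Y" "g \<in> Y \<rightarrow> Y'"
  shows "cof_M Z Y Y' g (cof_M Z X Y f t) = cof_M Z X Y' (\<lambda>a. g (f a)) t"
proof -
  obtain \<V> h where t: "t = (\<V>, h)" by (cases t)
  have eq: "compose X (compose Y k g) f = compose X k (\<lambda>a. g (f a))" for k :: "'a \<Rightarrow> 'a"
    using assms by (auto simp: compose_def fun_eq_iff)
  have "(\<lambda>k\<in>Y' \<rightarrow>\<^sub>E Z. (\<lambda>g\<in>Y \<rightarrow>\<^sub>E Z. h (compose X g f)) (compose Y k g)) =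
      (\<lambda>k\<in>Y' \<rightarrow>\<^sub>E Z. h (compose X k (\<lambda>a. g (f a))))"
  proof (rule restrict_ext)
    fix k assume "k \<in> Y' \<rightarrow>\<^sub>E Z"
    then have "compose Y k g \<in> Y \<rightarrow>\<^sub>E Z" by (rule compose_PiE[OF assms(2)])
    then show "(\<lambda>g\<in>Y \<rightarrow>\<^sub>E Z. h (compose X g f)) (compose Y k g) = h (compose X k (\<lambda>a. g (f a)))"
      by (simp only: restrict_apply if_True eq)
  qed
  then show ?thesis using assms by (simp add: t cof_M_def push_push)
qed

lemma cof_M_in:
  assumes f: "f \<in> X \<rightarrow> Y" and t: "t \<in> cof_T Z \<theta> S X"
  shows "cof_M Z X Y f t \<in> cof_T Z \<theta> S Y"
proof -
  obtain \<V> h where t_eq: "t = (\<V>, h)" by (cases t)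
  note T = cof_T_E[OF t[unfolded t_eq]]
  have "(push X Y f \<V>, \<lambda>g\<in>Y \<rightarrow>\<^sub>E Z. h (compose X g f)) \<in> cof_T Z \<theta> S Y"
  proof (rule cof_T_I)
    show "ultrafilter_on Y (push X Y f \<V>)" using T(1) f by (rule ultrafilter_push)
    show "(\<lambda>g\<in>Y \<rightarrow>\<^sub>E Z. h (compose X g f)) \<in> (Y \<rightarrow>\<^sub>E Z) \<rightarrow>\<^sub>E S"
      using PiE_mem[OF T(2)] compose_PiE[OF f] by auto
    fix g g' A assume g: "g \<in> Y \<rightarrow>\<^sub>E Z" "g' \<in> Y \<rightarrow>\<^sub>E Z" and A: "A \<in> push X Y f \<V>"
      and eq: "\<And>a b. a \<in> A \<Longrightarrow> b \<in> A \<Longrightarrow> \<theta> (g a) (g b) = \<theta> (g' a) (g' b)"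
    have "{x\<in>X. f x \<in> A} \<in> \<V>" using A by (simp add: push_def)
    then have "h (compose X g f) = h (compose X g' f)"
      by (rule T(3)[OF compose_PiE[OF f g(1)] compose_PiE[OF f g(2)]]) (auto simp: compose_def eq)
    then show "(\<lambda>g\<in>Y \<rightarrow>\<^sub>E Z. h (compose X g f)) g = (\<lambda>g\<in>Y \<rightarrow>\<^sub>E Z. h (compose X g f)) g'"
      using g by simp
  qed
  then show ?thesis by (simp add: t_eq cof_M_def)
qed

text \<open>The ultrafilter is unchanged since \<open>f\<close> is the identity on one of its sets,
  and \<open>h\<close> is unchanged since \<open>compose X g f\<close> and \<open>g\<close> agree on
  that set. With \<open>A = X\<close> this gives the identity law; for smaller \<open>A\<close> it
  shows that the pair comes from \<open>A\<close>.\<close>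

lemma cof_M_fix:
  assumes f: "f \<in> X \<rightarrow> X" and t: "(\<V>, h) \<in> cof_T Z \<theta> S X" and A: "A \<in> \<V>" and id: "\<And>a. a \<in> A \<Longrightarrow> f a = a"
  shows "cof_M Z X X f (\<V>, h) = (\<V>, h)"
proof -
  note T = cof_T_E[OF t]
  have AX: "A \<subseteq> X" using uf_subset[OF T(1) A] .
  then have "{a\<in>X. f a = a} \<in> \<V>" using id by (intro uf_mono[OF T(1) A]) auto
  then have "push X X f \<V> = \<V>" using push_cong_uf[OF T(1)] push_id[OF T(1)] by metis
  moreover have "h (compose X g f) = h g" if "g \<in> X \<rightarrow>\<^sub>E Z" for g
    by (rule T(3)[OF compose_PiE[OF f that] that A]) (use AX in \<open>auto simp: compose_def id\<close>)
  moreover have "h \<in> extensional (X \<rightarrow>\<^sub>E Z)" using T(2) by (simp add: PiE_def)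
  ultimately show ?thesis
    by (auto simp: cof_M_def fun_eq_iff extensional_def)
qed

context
  fixes u :: "'u itself" and Z :: "'u set" and \<theta> :: "'u \<Rightarrow> 'u \<Rightarrow> 't" and S :: "'u set" and \<Theta> :: "'t set"
  assumes inacc: "inaccessible u" and S: "small u S"
    and \<Theta>: "small u \<Theta>" "\<And>a b. a \<in> Z \<Longrightarrow> b \<in> Z \<Longrightarrow> \<theta> a b \<in> \<Theta>"
begin

text \<open>With \<open>Z\<close> large, \<open>h\<close> is a function on a large set. But it sees
  \<open>g\<close> only through the pattern of the values \<open>\<theta> (g a) (g b)\<close> in the
  small set \<open>\<Theta>\<close>, so it is determined by a small set of pairs of a pattern and a
  value.\<close>

lemma small_cof_T:
  assumes Y: "small u Y" shows "small u (cof_T Z \<theta> S Y)"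
proof -
  define pat where "pat g = (\<lambda>(a, b)\<in>Y \<times> Y. \<theta> (g a) (g b))" for g
  define q where "q = (\<lambda>(\<V> :: 'u set set, h :: ('u \<Rightarrow> 'u) \<Rightarrow> 'u). (\<V>, (\<lambda>g. (pat g, h g)) ` (Y \<rightarrow>\<^sub>E Z)))"
  have "small u (Pow (Pow Y) \<times> Pow ((Y \<times> Y \<rightarrow>\<^sub>E \<Theta>) \<times> S))"
    using inacc S \<Theta>(1) Y by (intro small_Times small_Pow small_PiE)
  moreover have "inj_on q (cof_T Z \<theta> S Y)"
  proof (rule inj_onI, clarify)
    fix \<V> h \<V>' h' assume t: "(\<V>, h) \<in> cof_T Z \<theta> S Y" "(\<V>', h') \<in> cof_T Z \<theta> S Y"
      and eq: "q (\<V>, h) = q (\<V>', h')"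
    have V: "\<V> = \<V>'" using eq by (simp add: q_def)
    have "h g = h' g" if g: "g \<in> Y \<rightarrow>\<^sub>E Z" for g
    proof -
      have "(pat g, h g) \<in> (\<lambda>g. (pat g, h' g)) ` (Y \<rightarrow>\<^sub>E Z)" using eq g by (auto simp: q_def)
      then obtain g' where g': "g' \<in> Y \<rightarrow>\<^sub>E Z" "pat g = pat g'" "h g = h' g'" by auto
      \<comment> \<open>Equal patterns on all of \<open>Y\<close> force equal values, as
        \<open>Y\<close> belongs to the ultrafilter.\<close>
      have "h' g = h' g'"
      proof (rule cof_T_E(3)[OF t(2) g g'(1) uf_top[OF cof_T_E(1)[OF t(2)]]])
        fix a b assume "a \<in> Y" "b \<in> Y"
        then show "\<theta> (g a) (g b) = \<theta> (g' a) (g' b)"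
          using fun_cong[OF g'(2), of "(a, b)"] by (simp add: pat_def)
      qed
      then show ?thesis using g' by simp
    qed
    then show "\<V> = \<V>' \<and> h = h'" using V PiE_ext[OF cof_T_E(2)[OF t(1)] cof_T_E(2)[OF t(2)]] by auto
  qed
  moreover have "q ` cof_T Z \<theta> S Y \<subseteq> Pow (Pow Y) \<times> Pow ((Y \<times> Y \<rightarrow>\<^sub>E \<Theta>) \<times> S)"
  proof (rule image_subsetI)
    fix s assume s: "s \<in> cof_T Z \<theta> S Y"
    obtain \<V> h where s_eq: "s = (\<V>, h)" by (cases s)
    note t = s[unfolded s_eq]
    have "\<V> \<in> Pow (Pow Y)" using uf_subset[OF cof_T_E(1)[OF t]] by auto
    moreover have "pat g \<in> Y \<times> Y \<rightarrow>\<^sub>E \<Theta>" if "g \<in> Y \<rightarrow>\<^sub>E Z" for g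
      using that \<Theta>(2) by (auto simp: pat_def PiE_mem)
    ultimately show "q s \<in> Pow (Pow Y) \<times> Pow ((Y \<times> Y \<rightarrow>\<^sub>E \<Theta>) \<times> S)"
      using PiE_mem[OF cof_T_E(2)[OF t]] unfolding s_eq by (auto simp: q_def)
  qed
  ultimately show ?thesis by (rule small_inj_on)
qed

lemma cofree_data: "endo_data u (cof_T Z \<theta> S) (cof_M Z)"
proof
  fix X :: "'u set" and f g :: "'u \<Rightarrow> 'u" and t :: "'u set set \<times> (('u \<Rightarrow> 'u) \<Rightarrow> 'u)"
  assume t: "t \<in> cof_T Z \<theta> S X"
  obtain \<V> h where t_eq: "t = (\<V>, h)" by (cases t)
  show "cof_M Z X X (\<lambda>a. a) t = t"
    using cof_M_fix[OF _ t[unfolded t_eq] uf_top[OF cof_T_E(1)[OF t[unfolded t_eq]]]] unfolding t_eq by simp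
  fix Y :: "'u set" assume "\<And>a. a \<in> X \<Longrightarrow> f a = g a"
  then show "cof_M Z X Y f t = cof_M Z X Y g t"
    unfolding cof_M_def t_eq by (auto simp: fun_eq_iff compose_def cong: push_cong restrict_cong)
qed (simp_all add: small_cof_T cof_M_in cof_M_comp)

interpretation cof: endo_data u "cof_T Z \<theta> S" "cof_M Z"
  by (rule cofree_data)

text \<open>A retraction of \<open>X\<close> onto a set \<open>A\<close> of \<open>\<V>\<close>
  fixes the pair, which therefore comes from \<open>A\<close>; conversely whatever comes from
  \<open>A\<close> has \<open>A\<close> in its ultrafilter. So the first component of a pair is its
  type.\<close>

lemma cof_T_tp:
  assumes X: "small u X" and t: "(\<V>, h) \<in> cof_T Z \<theta> S X"
  shows "{A. A \<subseteq> X \<and> (\<V>, h) \<in> cof_M Z A X (\<lambda>a. a) ` cof_T Z \<theta> S A} = \<V>"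
proof (intro equalityI subsetI)
  note uf = cof_T_E(1)[OF t]
  fix A assume "A \<in> {A. A \<subseteq> X \<and> (\<V>, h) \<in> cof_M Z A X (\<lambda>a. a) ` cof_T Z \<theta> S A}"
  then obtain \<W> k where AX: "A \<subseteq> X" and k: "(\<W>, k) \<in> cof_T Z \<theta> S A"
    and eq: "(\<V>, h) = cof_M Z A X (\<lambda>a. a) (\<W>, k)" by auto
  have "A \<in> push A X (\<lambda>a. a) \<W>" using AX uf_top[OF cof_T_E(1)[OF k]] by (simp add: push_def)
  then show "A \<in> \<V>" using eq by (simp add: cof_M_def)
next
  note uf = cof_T_E(1)[OF t]
  fix A assume A: "A \<in> \<V>"
  then have AX: "A \<subseteq> X" by (rule uf_subset[OF uf])
  obtain a0 where a0: "a0 \<in> A" using uf_nonempty[OF uf A] by blast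
  let ?r = "\<lambda>y. if y \<in> A then y else a0"
  have r: "?r \<in> X \<rightarrow> A" using a0 by auto
  have "cof_M Z A X (\<lambda>a. a) (cof_M Z X A ?r (\<V>, h)) = cof_M Z X X ?r (\<V>, h)"
    using r AX by (intro cof_M_comp) auto
  also have "\<dots> = (\<V>, h)" by (rule cof_M_fix[OF _ t A]) (use r AX in auto)
  finally have "(\<V>, h) \<in> cof_M Z A X (\<lambda>a. a) ` cof_T Z \<theta> S A"
    using cof_M_in[OF r t] by (rule image_eqI[OF sym])
  then show "A \<in> {A. A \<subseteq> X \<and> (\<V>, h) \<in> cof_M Z A X (\<lambda>a. a) ` cof_T Z \<theta> S A}" using AX by simp
qed

lemma cofree_in_FC: "cofree u Z \<theta> S \<in> Ob (FC u)"
  unfolding cofree_def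
proof (rule cof.E_in_FC[OF inacc])
  show "cof_T Z \<theta> S {} = {}" using uf_nonempty[OF cof_T_E(1)] uf_top[OF cof_T_E(1)] by fastforce
  fix X t assume "small u X" "t \<in> cof_T Z \<theta> S X"
  then show "ultrafilter_on X {A. A \<subseteq> X \<and> t \<in> cof_M Z A X (\<lambda>a. a) ` cof_T Z \<theta> S A}"
    by (cases t) (simp add: cof_T_tp cof_T_E(1))
qed

text \<open>A map into the cofree functor has no choice in the first component, since types are
  preserved; the rest is a natural family \<open>h\<close>, invariant along the type. With
  \<open>h X x g = p (ap F X Z g x)\<close> this yields the adjunction, with membership in a
  subfunctor the classifying map.\<close>

lemma cofree_Hom:
  assumes F: "F \<in> Ob (FC u)"
    and h: "\<And>X x g. small u X \<Longrightarrow> x \<in> on_ob F X \<Longrightarrow> g \<in> X \<rightarrow>\<^sub>E Z \<Longrightarrow> h X x g \<in> S"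
    and inv: "\<And>X x g g' A. small u X \<Longrightarrow> x \<in> on_ob F X \<Longrightarrow> g \<in> X \<rightarrow>\<^sub>E Z \<Longrightarrow> g' \<in> X \<rightarrow>\<^sub>E Z \<Longrightarrow> A \<in> tp F X x \<Longrightarrow>
      (\<And>a b. a \<in> A \<Longrightarrow> b \<in> A \<Longrightarrow> \<theta> (g a) (g b) = \<theta> (g' a) (g' b)) \<Longrightarrow> h X x g = h X x g'"
    and nat: "\<And>X Y x f g. small u X \<Longrightarrow> small u Y \<Longrightarrow> f \<in> X \<rightarrow> Y \<Longrightarrow> x \<in> on_ob F X \<Longrightarrow> g \<in> Y \<rightarrow>\<^sub>E Z \<Longrightarrow>
      h Y (ap F X Y f x) g = h X x (compose X g f)"
  shows "mk_nat u F (\<lambda>X x. enc (cof_T Z \<theta> S X) (tp F X x, \<lambda>g\<in>X \<rightarrow>\<^sub>E Z. h X x g)) \<in> Hom (FC u) F (cofree u Z \<theta> S)"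
    and "small u X \<Longrightarrow> x \<in> on_ob F X \<Longrightarrow> (tp F X x, \<lambda>g\<in>X \<rightarrow>\<^sub>E Z. h X x g) \<in> cof_T Z \<theta> S X"
proof -
  show T: "(tp F X x, \<lambda>g\<in>X \<rightarrow>\<^sub>E Z. h X x g) \<in> cof_T Z \<theta> S X"
    if "small u X" "x \<in> on_ob F X" for X x
  proof (rule cof_T_I)
    show "ultrafilter_on X (tp F X x)" using FC_partitive[OF inacc F] that by (rule ultrafilter_tp)
    show "(\<lambda>g\<in>X \<rightarrow>\<^sub>E Z. h X x g) \<in> (X \<rightarrow>\<^sub>E Z) \<rightarrow>\<^sub>E S"
      unfolding restrict_PiE_iff using h[OF that] by blast
    fix g g' A assume g: "g \<in> X \<rightarrow>\<^sub>E Z" "g' \<in> X \<rightarrow>\<^sub>E Z"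
      and "A \<in> tp F X x" "\<And>a b. a \<in> A \<Longrightarrow> b \<in> A \<Longrightarrow> \<theta> (g a) (g b) = \<theta> (g' a) (g' b)"
    then have "h X x g = h X x g'" by (rule inv[OF that])
    then show "(\<lambda>g\<in>X \<rightarrow>\<^sub>E Z. h X x g) g = (\<lambda>g\<in>X \<rightarrow>\<^sub>E Z. h X x g) g'"
      using g by (simp only: restrict_apply if_True)
  qed
  show "mk_nat u F (\<lambda>X x. enc (cof_T Z \<theta> S X) (tp F X x, \<lambda>g\<in>X \<rightarrow>\<^sub>E Z. h X x g)) \<in> Hom (FC u) F (cofree u Z \<theta> S)"
  proof (rule mk_nat_in[OF inacc F cofree_in_FC])
    fix X x assume X: "small u X" and x: "x \<in> on_ob F X"
    show "enc (cof_T Z \<theta> S X) (tp F X x, \<lambda>g\<in>X \<rightarrow>\<^sub>E Z. h X x g) \<in> on_ob (cofree u Z \<theta> S) X"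
      unfolding cofree_def using X T[OF X x] by (rule cof.enc_in)
    fix Y :: "'u set" and f assume Y: "small u Y" and f: "f \<in> X \<rightarrow> Y"
    have "(\<lambda>g\<in>Y \<rightarrow>\<^sub>E Z. (\<lambda>g\<in>X \<rightarrow>\<^sub>E Z. h X x g) (compose X g f)) = (\<lambda>g\<in>Y \<rightarrow>\<^sub>E Z. h Y (ap F X Y f x) g)"
    proof (rule restrict_ext)
      fix g assume g: "g \<in> Y \<rightarrow>\<^sub>E Z"
      then have "compose X g f \<in> X \<rightarrow>\<^sub>E Z" by (rule compose_PiE[OF f])
      then show "(\<lambda>g\<in>X \<rightarrow>\<^sub>E Z. h X x g) (compose X g f) = h Y (ap F X Y f x) g"
        by (simp only: restrict_apply if_True nat[OF X Y f x g])
    qed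
    then have "cof_M Z X Y f (tp F X x, \<lambda>g\<in>X \<rightarrow>\<^sub>E Z. h X x g) =
        (tp F Y (ap F X Y f x), \<lambda>g\<in>Y \<rightarrow>\<^sub>E Z. h Y (ap F X Y f x) g)"
      using tp_ap[OF FC_partitive[OF inacc F] X Y f x] by (simp only: cof_M_def prod.case)
    then show "enc (cof_T Z \<theta> S Y) (tp F Y (ap F X Y f x), \<lambda>g\<in>Y \<rightarrow>\<^sub>E Z. h Y (ap F X Y f x) g) =
        ap (cofree u Z \<theta> S) X Y f (enc (cof_T Z \<theta> S X) (tp F X x, \<lambda>g\<in>X \<rightarrow>\<^sub>E Z. h X x g))"
      unfolding cofree_def by (simp only: cof.E_ap[OF X Y f T[OF X x]])
  qed
qed

end

context
  fixes u :: "'u itself"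
  assumes inacc: "inaccessible u"
begin

subsection \<open>Evaluation preserves colimits\<close>

context
  fixes Z S :: "'u set"
  assumes Z: "small u Z" and S: "small u S"
begin

abbreviation (input) evadj where "evadj \<equiv> cofree u Z (\<lambda>a b. a) S"
abbreviation (input) evadj_T where "evadj_T \<equiv> cof_T Z (\<lambda>a b. a) S"

text \<open>The transpose of a map \<open>p\<close> from \<open>on_ob F Z\<close> to
  \<open>S\<close> under the adjunction between evaluation at \<open>Z\<close> and the cofree
  functor.\<close>

definition tr :: "'u endo \<Rightarrow> ('u \<Rightarrow> 'u) \<Rightarrow> 'u set \<Rightarrow> 'u \<Rightarrow> 'u" where
  "tr F p = mk_nat u F (\<lambda>X x. enc (evadj_T X) (tp F X x, \<lambda>g\<in>X \<rightarrow>\<^sub>E Z. p (ap F X Z g x)))"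

lemma tr_Hom:
  assumes F: "F \<in> Ob (FC u)" and p: "p \<in> on_ob F Z \<rightarrow> S"
  shows "tr F p \<in> Hom (FC u) F evadj"
    and "small u X \<Longrightarrow> x \<in> on_ob F X \<Longrightarrow> (tp F X x, \<lambda>g\<in>X \<rightarrow>\<^sub>E Z. p (ap F X Z g x)) \<in> evadj_T X"
proof -
  note P = FC_partitive[OF inacc F] and E = FC_endofunctor[OF inacc F]
  have 1: "p (ap F X Z g x) \<in> S" if "small u X" "x \<in> on_ob F X" "g \<in> X \<rightarrow>\<^sub>E Z" for X x g
  proof -
    have "ap F X Z g x \<in> on_ob F Z" using that by (intro ap_in[OF E _ Z]) auto
    then show ?thesis using p by blast
  qed
  have 2: "p (ap F X Z g x) = p (ap F X Z g' x)"
    if "small u X" "x \<in> on_ob F X" "g \<in> X \<rightarrow>\<^sub>E Z" "g' \<in> X \<rightarrow>\<^sub>E Z" "A \<in> tp F X x"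
      "\<And>a b. a \<in> A \<Longrightarrow> b \<in> A \<Longrightarrow> g a = g' a" for X x g g' A
  proof -
    have "A \<subseteq> X" using that(5) by (rule tp_subset)
    then have "{a\<in>X. g a = g' a} \<in> tp F X x"
      using that(6) by (intro uf_mono[OF ultrafilter_tp[OF P that(1,2)] that(5)]) auto
    then have "ap F X Z g x = ap F X Z g' x"
      using that by (intro ap_eq_on[OF P _ Z]) auto
    then show ?thesis by simp
  qed
  have 3: "p (ap F Y Z g (ap F X Y f x)) = p (ap F X Z (compose X g f) x)"
    if "small u X" "small u Y" "f \<in> X \<rightarrow> Y" "x \<in> on_ob F X" "g \<in> Y \<rightarrow>\<^sub>E Z" for X Y x f g
  proof -
    have "ap F Y Z g (ap F X Y f x) = ap F X Z (\<lambda>a. g (f a)) x"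
      using that by (intro ap_ap[OF E _ _ Z]) auto
    also have "\<dots> = ap F X Z (compose X g f) x" by (rule ap_cong) (simp add: compose_def)
    finally show ?thesis by simp
  qed
  note c = cofree_Hom[of u S Z Z "\<lambda>a b. a", OF inacc S Z _ F 1 2 3]
  show "tr F p \<in> Hom (FC u) F evadj" unfolding tr_def by (rule c(1))
  show "(tp F X x, \<lambda>g\<in>X \<rightarrow>\<^sub>E Z. p (ap F X Z g x)) \<in> evadj_T X" if "small u X" "x \<in> on_ob F X"
    using that by (intro c(2))
qed

text \<open>Transposition is natural in the functor, because \<open>\<beta>\<close> commutes with
  the action and preserves types.\<close>

lemma tr_nat:
  assumes F: "F \<in> Ob (FC u)" and G: "G \<in> Ob (FC u)" and b: "\<beta> \<in> Hom (FC u) F G"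
    and eq: "\<And>x. x \<in> on_ob F Z \<Longrightarrow> q (\<beta> Z x) = p x" and X: "small u X" and x: "x \<in> on_ob F X"
  shows "tr G q X (\<beta> X x) = tr F p X x"
proof -
  have "(\<lambda>g\<in>X \<rightarrow>\<^sub>E Z. q (ap G X Z g (\<beta> X x))) = (\<lambda>g\<in>X \<rightarrow>\<^sub>E Z. p (ap F X Z g x))"
  proof (rule restrict_ext)
    fix g assume "g \<in> X \<rightarrow>\<^sub>E Z"
    then have g: "g \<in> X \<rightarrow> Z" by auto
    have "ap F X Z g x \<in> on_ob F Z" using FC_endofunctor[OF inacc F] X Z g x by (rule ap_in)
    from eq[OF this] show "q (ap G X Z g (\<beta> X x)) = p (ap F X Z g x)"
      by (simp add: FC_Hom_ap[OF inacc F G b X Z g x])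
  qed
  then show ?thesis
    using FC_Hom_tp[OF inacc F G b X x] FC_Hom_in[OF inacc F G b X x] X x by (simp add: tr_def)
qed

text \<open>The counit of the adjunction: the function component is evaluated at the identity of
  \<open>Z\<close>.\<close>

definition untr :: "'u \<Rightarrow> 'u" where
  "untr y = snd (inv_into (evadj_T Z) (enc (evadj_T Z)) y) (\<lambda>a\<in>Z. a)"

lemma small_T: "small u X \<Longrightarrow> small u (evadj_T X)"
  using inacc S Z by (rule small_cof_T[where \<Theta> = Z]) auto

lemma untr_enc: "t \<in> evadj_T Z \<Longrightarrow> untr (enc (evadj_T Z) t) = snd t (\<lambda>a\<in>Z. a)"
  using inv_into_f_f[OF inj_enc[OF small_T[OF Z]]] by (simp add: untr_def)

lemma untr_tr:
  assumes F: "F \<in> Ob (FC u)" and p: "p \<in> on_ob F Z \<rightarrow> S" and x: "x \<in> on_ob F Z"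
  shows "untr (tr F p Z x) = p x"
proof -
  have "ap F Z Z (\<lambda>a\<in>Z. a) x = x"
    using FC_endofunctor[OF inacc F] Z x by (rule ap_ident) simp
  then show ?thesis using untr_enc[OF tr_Hom(2)[OF F p Z x]] Z x by (simp add: tr_def)
qed

lemma untr_in:
  assumes "y \<in> on_ob evadj Z" shows "untr y \<in> S"
proof -
  interpret cof: endo_data u evadj_T "cof_M Z"
    using inacc S Z by (rule cofree_data) auto
  obtain t where t: "t \<in> evadj_T Z" "y = enc (evadj_T Z) t"
    using cof.E_cases[OF Z] assms unfolding cofree_def by blast
  then have "snd t \<in> (Z \<rightarrow>\<^sub>E Z) \<rightarrow>\<^sub>E S" using cof_T_E(2)[of "fst t" "snd t"] by simp
  moreover have "(\<lambda>a\<in>Z. a) \<in> Z \<rightarrow>\<^sub>E Z" by auto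
  ultimately show ?thesis unfolding t(2) untr_enc[OF t(1)] by (rule PiE_mem)
qed

text \<open>A compatible family \<open>p\<close> transposes to a cocone with vertex
  \<open>evadj\<close>. The map induced from the colimit, followed by the counit, is the extension;
  and any two extensions have transposes that solve the same factorisation problem. As
  \<open>S\<close> is an arbitrary small set, this is the colimit property of the values at
  \<open>Z\<close>.\<close>

lemma eval_colimit:
  assumes D: "is_functor J (FC u) D" and col: "is_colimit J (FC u) D c \<iota>"
    and p: "\<And>j. j \<in> Ob J \<Longrightarrow> p j \<in> on_ob (on_ob D j) Z \<rightarrow> S"
    and compat: "\<And>i j f x. i \<in> Ob J \<Longrightarrow> j \<in> Ob J \<Longrightarrow> f \<in> Hom J i j \<Longrightarrow> x \<in> on_ob (on_ob D i) Z \<Longrightarrow>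
      p j (on_hom D i j f Z x) = p i x"
  shows "\<exists>h \<in> on_ob c Z \<rightarrow> S. \<forall>j\<in>Ob J. \<forall>x\<in>on_ob (on_ob D j) Z. h (\<iota> j Z x) = p j x"
    and "h \<in> on_ob c Z \<rightarrow> S \<Longrightarrow> k \<in> on_ob c Z \<rightarrow> S \<Longrightarrow>
      (\<And>j x. j \<in> Ob J \<Longrightarrow> x \<in> on_ob (on_ob D j) Z \<Longrightarrow> h (\<iota> j Z x) = p j x) \<Longrightarrow>
      (\<And>j x. j \<in> Ob J \<Longrightarrow> x \<in> on_ob (on_ob D j) Z \<Longrightarrow> k (\<iota> j Z x) = p j x) \<Longrightarrow>
      x \<in> on_ob c Z \<Longrightarrow> h x = k x"
proof -
  have Dob: "on_ob D j \<in> Ob (FC u)" if "j \<in> Ob J" for j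
    using D that by (simp add: is_functor_def)
  have Dhom: "on_hom D i j f \<in> Hom (FC u) (on_ob D i) (on_ob D j)"
    if "i \<in> Ob J" "j \<in> Ob J" "f \<in> Hom J i j" for i j f
    using D that by (simp add: is_functor_def)
  have c: "c \<in> Ob (FC u)" and \<iota>: "\<And>j. j \<in> Ob J \<Longrightarrow> \<iota> j \<in> Hom (FC u) (on_ob D j) c"
    using col by (auto simp: is_colimit_def is_cocone_def)
  have C: "evadj \<in> Ob (FC u)" using inacc S Z by (rule cofree_in_FC) auto
  have trD: "tr (on_ob D j) (p j) \<in> Hom (FC u) (on_ob D j) evadj" if "j \<in> Ob J" for j
    using Dob[OF that] p[OF that] by (rule tr_Hom)
  have "is_cocone J (FC u) D evadj (\<lambda>j. tr (on_ob D j) (p j))"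
    unfolding is_cocone_def
  proof (intro conjI ballI C trD)
    fix i j f assume i: "i \<in> Ob J" and j: "j \<in> Ob J" and f: "f \<in> Hom J i j"
    show "Comp (FC u) (on_ob D i) (on_ob D j) evadj (tr (on_ob D j) (p j)) (on_hom D i j f) = tr (on_ob D i) (p i)"
    proof (rule FC_Hom_eqI[OF inacc Dob[OF i] C _ trD[OF i]])
      show "Comp (FC u) (on_ob D i) (on_ob D j) evadj (tr (on_ob D j) (p j)) (on_hom D i j f) \<in> Hom (FC u) (on_ob D i) evadj"
        using category_FC Dob[OF i] Dob[OF j] C Dhom[OF i j f] trD[OF j] by (rule cat_Comp)
      fix X x assume "small u X" "x \<in> on_ob (on_ob D i) X"
      then show "Comp (FC u) (on_ob D i) (on_ob D j) evadj (tr (on_ob D j) (p j)) (on_hom D i j f) X x =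
          tr (on_ob D i) (p i) X x"
        using tr_nat[OF Dob[OF i] Dob[OF j] Dhom[OF i j f], of "p j" "p i"] compat[OF i j f]
        by (simp add: FC_Comp_apply)
    qed
  qed
  then have ex1: "\<exists>!h. h \<in> Hom (FC u) c evadj \<and>
      (\<forall>j\<in>Ob J. Comp (FC u) (on_ob D j) c evadj h (\<iota> j) = tr (on_ob D j) (p j))"
    using col unfolding is_colimit_def by blast
  show "\<exists>h \<in> on_ob c Z \<rightarrow> S. \<forall>j\<in>Ob J. \<forall>x\<in>on_ob (on_ob D j) Z. h (\<iota> j Z x) = p j x"
  proof -
    obtain h where h: "h \<in> Hom (FC u) c evadj"
      and hj: "\<And>j. j \<in> Ob J \<Longrightarrow> Comp (FC u) (on_ob D j) c evadj h (\<iota> j) = tr (on_ob D j) (p j)"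
      using ex1_implies_ex[OF ex1] by blast
    show ?thesis
    proof (intro bexI[of _ "\<lambda>x. untr (h Z x)"] ballI)
      show "(\<lambda>x. untr (h Z x)) \<in> on_ob c Z \<rightarrow> S"
        using FC_Hom_in[OF inacc c C h Z] untr_in by blast
      fix j x assume j: "j \<in> Ob J" and x: "x \<in> on_ob (on_ob D j) Z"
      have "h Z (\<iota> j Z x) = tr (on_ob D j) (p j) Z x"
        using FC_Comp_apply[OF Z x] hj[OF j] by metis
      then show "untr (h Z (\<iota> j Z x)) = p j x" using untr_tr[OF Dob[OF j] p[OF j] x] by simp
    qed
  qed
  assume h: "h \<in> on_ob c Z \<rightarrow> S" and k: "k \<in> on_ob c Z \<rightarrow> S"
    and hj: "\<And>j x. j \<in> Ob J \<Longrightarrow> x \<in> on_ob (on_ob D j) Z \<Longrightarrow> h (\<iota> j Z x) = p j x"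
    and kj: "\<And>j x. j \<in> Ob J \<Longrightarrow> x \<in> on_ob (on_ob D j) Z \<Longrightarrow> k (\<iota> j Z x) = p j x"
    and x: "x \<in> on_ob c Z"
  have fac: "tr c q \<in> Hom (FC u) c evadj \<and> (\<forall>j\<in>Ob J. Comp (FC u) (on_ob D j) c evadj (tr c q) (\<iota> j) = tr (on_ob D j) (p j))"
    if q: "q \<in> on_ob c Z \<rightarrow> S"
      and qj: "\<And>j x. j \<in> Ob J \<Longrightarrow> x \<in> on_ob (on_ob D j) Z \<Longrightarrow> q (\<iota> j Z x) = p j x" for q
  proof (intro conjI ballI)
    show tq: "tr c q \<in> Hom (FC u) c evadj" using c q by (rule tr_Hom)
    fix j assume j: "j \<in> Ob J"
    show "Comp (FC u) (on_ob D j) c evadj (tr c q) (\<iota> j) = tr (on_ob D j) (p j)"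
    proof (rule FC_Hom_eqI[OF inacc Dob[OF j] C _ trD[OF j]])
      show "Comp (FC u) (on_ob D j) c evadj (tr c q) (\<iota> j) \<in> Hom (FC u) (on_ob D j) evadj"
        using category_FC Dob[OF j] c C \<iota>[OF j] tq by (rule cat_Comp)
      fix X x assume "small u X" "x \<in> on_ob (on_ob D j) X"
      then show "Comp (FC u) (on_ob D j) c evadj (tr c q) (\<iota> j) X x = tr (on_ob D j) (p j) X x"
        using tr_nat[OF Dob[OF j] c \<iota>[OF j], of q "p j"] qj[OF j] by (simp add: FC_Comp_apply)
    qed
  qed
  obtain m where "\<And>q. q \<in> Hom (FC u) c evadj \<and>
      (\<forall>j\<in>Ob J. Comp (FC u) (on_ob D j) c evadj q (\<iota> j) = tr (on_ob D j) (p j)) \<Longrightarrow> q = m"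
    using ex1 by (elim ex1E) iprover
  then have "tr c h = m" "tr c k = m" using fac[of h] fac[of k] h k hj kj by blast+
  then show "h x = k x" using untr_tr[OF c h x] untr_tr[OF c k x] by simp
qed

end

end

subsection \<open>Subfunctors\<close>

text \<open>The value at \<open>Y\<close> of the subfunctor of \<open>F\<close> generated by
  \<open>on_ob F L\<close>.\<close>

definition genby :: "'u endo \<Rightarrow> 'u set \<Rightarrow> 'u set \<Rightarrow> 'u set" where
  "genby F L Y = {ap F L Y g x | g x. g \<in> L \<rightarrow> Y \<and> x \<in> on_ob F L}"

context
  fixes u :: "'u itself" and F :: "'u endo"
  assumes inacc: "inaccessible u" and F: "F \<in> Ob (FC u)"
begin

lemma genby_ap:
  assumes "small u L" "small u Y" "small u Y'" "f \<in> Y \<rightarrow> Y'" "y \<in> genby F L Y"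
  shows "ap F Y Y' f y \<in> genby F L Y'"
proof -
  obtain g x where g: "g \<in> L \<rightarrow> Y" "x \<in> on_ob F L" "y = ap F L Y g x"
    using assms(5) by (auto simp: genby_def)
  then have "ap F Y Y' f y = ap F L Y' (\<lambda>a. f (g a)) x"
    unfolding g(3) using assms by (intro ap_ap[OF FC_endofunctor[OF inacc F]])
  moreover have "(\<lambda>a. f (g a)) \<in> L \<rightarrow> Y'" using g assms by auto
  ultimately show ?thesis using g(2) by (auto simp: genby_def)
qed

text \<open>On \<open>A\<close> the map \<open>g'\<close> factors through \<open>g\<close>; the
  factor \<open>s\<close> carries \<open>ap F Y W g y\<close> to \<open>ap F Y W' g' y\<close>, and
  the generated subfunctor is closed under it. Used in both directions, this makes membership depend
  only on the kernel of \<open>g\<close> on a set of the type, which is the invariance that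
  \<open>\<theta> = (=)\<close> demands.\<close>

lemma genby_kernel:
  assumes L: "small u L" and Y: "small u Y" and W: "small u W" and W': "small u W'"
    and y: "y \<in> on_ob F Y" and A: "A \<in> tp F Y y" and g: "g \<in> Y \<rightarrow> W" and g': "g' \<in> Y \<rightarrow> W'"
    and ker: "\<And>a b. a \<in> A \<Longrightarrow> b \<in> A \<Longrightarrow> g a = g b \<Longrightarrow> g' a = g' b"
    and mem: "ap F Y W g y \<in> genby F L W"
  shows "ap F Y W' g' y \<in> genby F L W'"
proof -
  note P = FC_partitive[OF inacc F] and E = FC_endofunctor[OF inacc F]
  note uf = ultrafilter_tp[OF P Y y]
  obtain a0 where a0: "a0 \<in> A" using uf_nonempty[OF uf A] by blast
  have AY: "A \<subseteq> Y" using A by (rule tp_subset)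
  \<comment> \<open>Off the image of \<open>A\<close> the factor takes the default
    \<open>g' a0\<close>; the equation with \<open>g'\<close> is only needed on \<open>A\<close>, a
    set of the type of \<open>y\<close>.\<close>
  define s where "s w = (if w \<in> g ` A then g' (inv_into A g w) else g' a0)" for w
  have inv: "inv_into A g w \<in> A" if "w \<in> g ` A" for w using that by (rule inv_into_into)
  have "g' a \<in> W'" if "a \<in> A" for a using g' AY that by blast
  then have s: "s \<in> W \<rightarrow> W'" using inv a0 by (simp add: s_def)
  have sg: "s (g a) = g' a" if "a \<in> A" for a
    unfolding s_def using ker[OF inv that] f_inv_into_f[of "g a" g A] that by auto
  have "ap F Y W' g' y = ap F Y W' (\<lambda>a. s (g a)) y"
  proof (rule ap_eq_on[OF P Y W' g' _ y])
    show "(\<lambda>a. s (g a)) \<in> Y \<rightarrow> W'" using s g by auto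
    show "{a \<in> Y. g' a = s (g a)} \<in> tp F Y y" by (rule uf_mono[OF uf A]) (use AY sg in auto)
  qed
  also have "\<dots> = ap F W W' s (ap F Y W g y)" using ap_ap[OF E Y W W' g s y] by simp
  also have "\<dots> \<in> genby F L W'" using L W W' s mem by (rule genby_ap)
  finally show ?thesis .
qed

text \<open>Each small \<open>L\<close> has a classifying map \<open>\<chi> L\<close>, and equal
  classifying maps mean equal generated subfunctors. The hom-set into the classifier is small, so a
  small family of sets \<open>rep r\<close> accounts for all \<open>L\<close>. Their union generates
  \<open>F\<close>, because an element over \<open>Y\<close> is generated by \<open>Y\<close>
  itself.\<close>

lemma FC_bounded:
  assumes hom: "\<And>G. G \<in> Ob (FC u) \<Longrightarrow> small u (Hom (FC u) F G)"
  obtains L where "small u L" "\<And>Y. small u Y \<Longrightarrow> on_ob F Y \<subseteq> genby F L Y"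
proof -
  note P = FC_partitive[OF inacc F] and E = FC_endofunctor[OF inacc F]
  obtain z w :: 'u where zw: "z \<noteq> w"
    using univ_two_elements[OF inacc] by blast
  \<comment> \<open>The two elements of \<open>S\<close> serve as truth values, \<open>w\<close>
    standing for membership.\<close>
  define S where "S = {z, w}"
  have S: "small u S" unfolding S_def by (rule small_finite[OF inacc]) simp
  have \<Theta>: "small u (UNIV :: bool set)" by (rule small_finite[OF inacc]) simp
  define T where "T = cof_T UNIV (=) S"
  \<comment> \<open>\<open>UNIV\<close> is not small, so \<open>F\<close> cannot be applied to it.
    The map \<open>g\<close> is therefore tested over its image; \<open>genby_kernel\<close> makes
    the result independent of the chosen codomain.\<close>
  define h where "h L Y y g = (if ap F Y (g ` Y) g y \<in> genby F L (g ` Y) then w else z)" for L Y y and g :: "'u \<Rightarrow> 'u"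
  define \<chi> where "\<chi> L = mk_nat u F (\<lambda>Y y. enc (T Y) (tp F Y y, \<lambda>g\<in>Y \<rightarrow>\<^sub>E UNIV. h L Y y g))" for L
  have h_cong: "h L Y y g = h L Y y g'"
    if L: "small u L" and Y: "small u Y" and y: "y \<in> on_ob F Y" and A: "A \<in> tp F Y y"
      and eq: "\<And>a b. a \<in> A \<Longrightarrow> b \<in> A \<Longrightarrow> (g a = g b) = (g' a = g' b)" for L Y y A and g g' :: "'u \<Rightarrow> 'u"
  proof -
    have g: "g \<in> Y \<rightarrow> g ` Y" "g' \<in> Y \<rightarrow> g' ` Y" by auto
    note k = genby_kernel[OF L Y small_image[OF Y] small_image[OF Y] y A]
    have "ap F Y (g ` Y) g y \<in> genby F L (g ` Y) \<longleftrightarrow> ap F Y (g' ` Y) g' y \<in> genby F L (g' ` Y)"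
      using k[OF g(1,2)] k[OF g(2,1)] eq by blast
    then show ?thesis by (simp add: h_def)
  qed
  have h_nat: "h L Y (ap F X Y f x) g = h L X x (compose X g f)"
    if L: "small u L" and X: "small u X" and Y: "small u Y" and f: "f \<in> X \<rightarrow> Y" and x: "x \<in> on_ob F X"
    for L X Y f x and g :: "'u \<Rightarrow> 'u"
  proof -
    let ?k = "compose X g f"
    have gY: "g \<in> Y \<rightarrow> g ` Y" and k: "?k \<in> X \<rightarrow> ?k ` X" and gf: "(\<lambda>a. g (f a)) \<in> X \<rightarrow> g ` Y"
      using f by auto
    have eq: "ap F Y (g ` Y) g (ap F X Y f x) = ap F X (g ` Y) (\<lambda>a. g (f a)) x"
      using X Y small_image[OF Y] f gY x by (rule ap_ap[OF E])
    note ker = genby_kernel[OF L X _ _ x uf_top[OF ultrafilter_tp[OF P X x]]]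
    have "ap F X (g ` Y) (\<lambda>a. g (f a)) x \<in> genby F L (g ` Y) \<longleftrightarrow> ap F X (?k ` X) ?k x \<in> genby F L (?k ` X)"
      using ker[OF small_image[OF Y] small_image[OF X] gf k] ker[OF small_image[OF X] small_image[OF Y] k gf]
      by (auto simp: compose_def)
    then show ?thesis by (simp add: h_def eq)
  qed
  have hS: "h L Y y g \<in> S" for L Y y and g :: "'u \<Rightarrow> 'u" by (simp add: h_def S_def)
  have \<chi>: "\<chi> L \<in> Hom (FC u) F (cofree u UNIV (=) S)"
    and \<chi>T: "\<And>Y y. small u Y \<Longrightarrow> y \<in> on_ob F Y \<Longrightarrow> (tp F Y y, \<lambda>g\<in>Y \<rightarrow>\<^sub>E UNIV. h L Y y g) \<in> T Y"
    if L: "small u L" for L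
  proof -
    note c = cofree_Hom[of u S UNIV UNIV "(=)" F "h L", OF inacc S \<Theta> UNIV_I F hS h_cong[OF L] h_nat[OF L]]
    show "\<chi> L \<in> Hom (FC u) F (cofree u UNIV (=) S)" unfolding \<chi>_def T_def by (rule c(1)) assumption+
    show "(tp F Y y, \<lambda>g\<in>Y \<rightarrow>\<^sub>E UNIV. h L Y y g) \<in> T Y" if "small u Y" "y \<in> on_ob F Y" for Y y
      using that unfolding T_def by (intro c(2))
  qed
  \<comment> \<open>The function component at the identity of \<open>Y\<close> tests membership of
    \<open>y\<close> itself, so \<open>\<chi> L\<close> determines the generated subfunctor.\<close>
  have \<chi>_eq: "genby F L Y \<inter> {y} = genby F L' Y \<inter> {y}"
    if L: "small u L" "small u L'" and eq: "\<chi> L = \<chi> L'" and Y: "small u Y" and y: "y \<in> on_ob F Y" for L L' Y y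
  proof -
    let ?i = "\<lambda>a\<in>Y. a"
    have sT: "small u (T Y)" unfolding T_def using inacc S \<Theta> _ Y by (rule small_cof_T) auto
    have "enc (T Y) (tp F Y y, \<lambda>g\<in>Y \<rightarrow>\<^sub>E UNIV. h L Y y g) = (enc (T Y) (tp F Y y, \<lambda>g\<in>Y \<rightarrow>\<^sub>E UNIV. h L' Y y g) :: 'u)"
      using fun_cong[OF fun_cong[OF eq, of Y], of y] Y y by (simp add: \<chi>_def)
    then have "(\<lambda>g\<in>Y \<rightarrow>\<^sub>E UNIV. h L Y y g) = (\<lambda>g\<in>Y \<rightarrow>\<^sub>E UNIV. h L' Y y g)"
      using enc_eq_iff[OF sT \<chi>T[OF L(1) Y y] \<chi>T[OF L(2) Y y]] by blast
    from fun_cong[OF this, of ?i] have "h L Y y ?i = h L' Y y ?i" by simp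
    moreover have "ap F Y Y ?i y = y" by (rule ap_ident[OF E Y y]) simp
    moreover have "?i ` Y = Y" by simp
    ultimately show ?thesis using zw by (auto simp: h_def split: if_splits)
  qed
  define R where "R = \<chi> ` {L. small u L}"
  have "cofree u UNIV (=) S \<in> Ob (FC u)" using inacc S \<Theta> UNIV_I by (rule cofree_in_FC)
  from hom[OF this] have "small u R"
    by (rule small_subset) (use \<chi> in \<open>auto simp: R_def\<close>)
  define rep where "rep r = (SOME L. small u L \<and> \<chi> L = r)" for r
  have rep: "small u (rep r)" "\<chi> (rep r) = r" if "r \<in> R" for r
    using someI_ex[of "\<lambda>L. small u L \<and> \<chi> L = r"] that unfolding rep_def R_def by blast+
  define M where "M = (\<Union>r\<in>R. rep r)"
  have M: "small u M" unfolding M_def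
    by (rule small_Union[OF inacc]) (use rep \<open>small u R\<close> in \<open>auto intro: small_image\<close>)
  show thesis
  proof (rule that[OF M], rule subsetI)
    fix Y y assume Y: "small u Y" and y: "y \<in> on_ob F Y"
    have r: "\<chi> Y \<in> R" using Y by (simp add: R_def)
    have "y = ap F Y Y (\<lambda>a. a) y" using ap_ident[OF E Y y] by simp
    then have "y \<in> genby F Y Y" unfolding genby_def using y by blast
    then have "y \<in> genby F (rep (\<chi> Y)) Y"
      using \<chi>_eq[OF Y rep(1)[OF r] rep(2)[OF r, symmetric] Y y] by blast
    then obtain g x where g: "g \<in> rep (\<chi> Y) \<rightarrow> Y" "x \<in> on_ob F (rep (\<chi> Y))" "y = ap F (rep (\<chi> Y)) Y g x"
      by (auto simp: genby_def)
    let ?N = "rep (\<chi> Y)"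
    have N: "small u ?N" "?N \<subseteq> M" using rep r by (auto simp: M_def)
    obtain a0 where a0: "a0 \<in> ?N" using inhabited[OF P g(2)] by blast
    \<comment> \<open>The inclusion of \<open>?N\<close> into \<open>M\<close> has a retraction with
      default \<open>a0\<close>; it extends \<open>g\<close> to \<open>M\<close>, so that the
      generator can be moved from \<open>?N\<close> to \<open>M\<close>.\<close>
    let ?r = "\<lambda>a. if a \<in> ?N then a else a0"
    have gr: "(\<lambda>a. g (?r a)) \<in> M \<rightarrow> Y" and i: "(\<lambda>a. a) \<in> ?N \<rightarrow> M" using g(1) a0 N by auto
    have "ap F M Y (\<lambda>a. g (?r a)) (ap F ?N M (\<lambda>a. a) x) = ap F ?N Y (\<lambda>a. g (?r a)) x"
      using N(1) M Y i gr g(2) by (rule ap_ap[OF E])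
    also have "\<dots> = y" unfolding g(3) by (rule ap_cong) simp
    finally show "y \<in> genby F M Y"
      using ap_in[OF E N(1) M i g(2)] gr unfolding genby_def by blast
  qed
qed

end

section \<open>Ultrapowers\<close>

text \<open>The class contains all functions that agree with \<open>g\<close> almost everywhere,
  whatever their codomain. So the germ does not depend on \<open>Y\<close>, and an inclusion of
  codomains acts as the identity on germs.\<close>

definition germ :: "'u set \<Rightarrow> 'u set set \<Rightarrow> ('u \<Rightarrow> 'u) \<Rightarrow> ('u \<Rightarrow> 'u) set" where
  "germ X \<U> g = {g'. {x\<in>X. g' x = g x} \<in> \<U>}"

definition upow_T :: "'u set \<Rightarrow> 'u set set \<Rightarrow> 'u set \<Rightarrow> ('u \<Rightarrow> 'u) set set" where
  "upow_T X \<U> Y = germ X \<U> ` (X \<rightarrow> Y)"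

definition upow_M :: "'u set \<Rightarrow> 'u set set \<Rightarrow> 'u set \<Rightarrow> 'u set \<Rightarrow> ('u \<Rightarrow> 'u) \<Rightarrow> ('u \<Rightarrow> 'u) set \<Rightarrow> ('u \<Rightarrow> 'u) set" where
  "upow_M X \<U> Y Y' f t = germ X \<U> (\<lambda>a. f (inv_into (X \<rightarrow> Y) (germ X \<U>) t a))"

text \<open>Its value at \<open>Y\<close> is the ultrapower of \<open>Y\<close> along
  \<open>\<U>\<close>, coded in \<open>'u\<close>; \<open>elt\<close> names the element with a given
  representative.\<close>

definition upow :: "'u itself \<Rightarrow> 'u set \<Rightarrow> 'u set set \<Rightarrow> 'u endo" where
  "upow u X \<U> = mk_endo u (upow_T X \<U>) (upow_M X \<U>)"

definition elt :: "'u set \<Rightarrow> 'u set set \<Rightarrow> 'u set \<Rightarrow> ('u \<Rightarrow> 'u) \<Rightarrow> 'u" where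
  "elt X \<U> Y g = enc (upow_T X \<U> Y) (germ X \<U> g)"

lemma germ_eq_iff:
  assumes uf: "ultrafilter_on X \<U>"
  shows "germ X \<U> g = germ X \<U> g' \<longleftrightarrow> {x\<in>X. g x = g' x} \<in> \<U>"
proof
  assume "germ X \<U> g = germ X \<U> g'"
  moreover have "g \<in> germ X \<U> g" using uf_top[OF uf] by (simp add: germ_def)
  ultimately show "{x\<in>X. g x = g' x} \<in> \<U>" by (simp add: germ_def)
next
  assume *: "{x\<in>X. g x = g' x} \<in> \<U>"
  have "{x\<in>X. k x = g x} \<in> \<U> \<longleftrightarrow> {x\<in>X. k x = g' x} \<in> \<U>" for k
  proof
    assume "{x\<in>X. k x = g x} \<in> \<U>"
    from this * show "{x\<in>X. k x = g' x} \<in> \<U>" by (rule uf_Collect_conj[OF uf]) simp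
  next
    assume "{x\<in>X. k x = g' x} \<in> \<U>"
    from this * show "{x\<in>X. k x = g x} \<in> \<U>" by (rule uf_Collect_conj[OF uf]) simp
  qed
  then show "germ X \<U> g = germ X \<U> g'" by (simp add: germ_def)
qed

context
  fixes u :: "'u itself" and X :: "'u set" and \<U> :: "'u set set"
  assumes inacc: "inaccessible u" and X: "small u X" and uf: "ultrafilter_on X \<U>"
begin

lemma upow_M_germ:
  assumes "g \<in> X \<rightarrow> Y" shows "upow_M X \<U> Y Y' f (germ X \<U> g) = germ X \<U> (\<lambda>a. f (g a))"
proof -
  let ?k = "inv_into (X \<rightarrow> Y) (germ X \<U>) (germ X \<U> g)"
  have "germ X \<U> ?k = germ X \<U> g" using f_inv_into_f[OF imageI[OF assms, of "germ X \<U>"]] .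
  then have "{x\<in>X. ?k x = g x} \<in> \<U>" unfolding germ_eq_iff[OF uf] .
  then have "{x\<in>X. f (?k x) = f (g x)} \<in> \<U>" by (rule uf_Collect_mono[OF uf]) simp
  then show ?thesis unfolding upow_M_def germ_eq_iff[OF uf] .
qed

lemma small_upow_T:
  assumes "small u Y" shows "small u (upow_T X \<U> Y)"
proof -
  have "germ X \<U> g = germ X \<U> (restrict g X)" for g
    unfolding germ_eq_iff[OF uf] by (rule uf_Collect_True[OF uf]) simp
  moreover have "restrict g X \<in> X \<rightarrow>\<^sub>E Y" if "g \<in> X \<rightarrow> Y" for g
    using that by auto
  ultimately have "upow_T X \<U> Y \<subseteq> germ X \<U> ` (X \<rightarrow>\<^sub>E Y)"
    unfolding upow_T_def by blast
  then show ?thesis using small_image[OF small_PiE[OF inacc X assms]] by (rule small_subset[rotated])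
qed

lemma upow_data: "endo_data u (upow_T X \<U>) (upow_M X \<U>)"
proof
  fix Y :: "'u set" assume "small u Y"
  then show "small u (upow_T X \<U> Y)" by (rule small_upow_T)
  fix t assume "t \<in> upow_T X \<U> Y"
  then obtain g where g: "g \<in> X \<rightarrow> Y" "t = germ X \<U> g" by (auto simp: upow_T_def)
  show "upow_M X \<U> Y Y (\<lambda>a. a) t = t" unfolding g(2) by (subst upow_M_germ[OF g(1)]) simp
  fix Y' :: "'u set" and f assume f: "f \<in> Y \<rightarrow> Y'"
  have fg: "(\<lambda>a. f (g a)) \<in> X \<rightarrow> Y'" using f g(1) by auto
  then show "upow_M X \<U> Y Y' f t \<in> upow_T X \<U> Y'"
    unfolding g(2) upow_M_germ[OF g(1)] upow_T_def by (rule imageI)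
  fix Y'' :: "'u set" and f'
  show "upow_M X \<U> Y' Y'' f' (upow_M X \<U> Y Y' f t) = upow_M X \<U> Y Y'' (\<lambda>a. f' (f a)) t"
    unfolding g(2) upow_M_germ[OF g(1)] upow_M_germ[OF fg] ..
next
  fix Y Y' :: "'u set" and f f' :: "'u \<Rightarrow> 'u" and t assume "t \<in> upow_T X \<U> Y"
    and eq: "\<And>a. a \<in> Y \<Longrightarrow> f a = f' a"
  then obtain g where g: "g \<in> X \<rightarrow> Y" "t = germ X \<U> g" by (auto simp: upow_T_def)
  have "{x\<in>X. f (g x) = f' (g x)} \<in> \<U>" using g(1) eq by (intro uf_Collect_True[OF uf]) auto
  then show "upow_M X \<U> Y Y' f t = upow_M X \<U> Y Y' f' t"
    unfolding g(2) upow_M_germ[OF g(1)] germ_eq_iff[OF uf] .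
qed

interpretation up: endo_data u "upow_T X \<U>" "upow_M X \<U>"
  by (rule upow_data)

text \<open>The germ of \<open>g\<close> comes from \<open>A\<close> exactly when \<open>g\<close>
  takes values in \<open>A\<close> almost everywhere: the other values can be replaced by a fixed
  element of \<open>A\<close>. In particular the germ of the identity has type
  \<open>\<U>\<close>.\<close>

lemma upow_T_tp:
  assumes g: "g \<in> X \<rightarrow> Y"
  shows "{A. A \<subseteq> Y \<and> germ X \<U> g \<in> upow_M X \<U> A Y (\<lambda>a. a) ` upow_T X \<U> A} = push X Y g \<U>"
proof -
  have "germ X \<U> g \<in> upow_M X \<U> A Y (\<lambda>a. a) ` upow_T X \<U> A \<longleftrightarrow> {x\<in>X. g x \<in> A} \<in> \<U>" for A
  proof
    assume "germ X \<U> g \<in> upow_M X \<U> A Y (\<lambda>a. a) ` upow_T X \<U> A"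
    then obtain k where k: "k \<in> X \<rightarrow> A" "germ X \<U> g = upow_M X \<U> A Y (\<lambda>a. a) (germ X \<U> k)"
      by (auto simp: upow_T_def)
    then have "{x\<in>X. g x = k x} \<in> \<U>" using upow_M_germ[OF k(1)] germ_eq_iff[OF uf] by simp
    then show "{x\<in>X. g x \<in> A} \<in> \<U>" by (rule uf_Collect_mono[OF uf]) (use k(1) in auto)
  next
    assume *: "{x\<in>X. g x \<in> A} \<in> \<U>"
    then obtain a where a: "a \<in> A" using uf_nonempty[OF uf] by blast
    let ?k = "\<lambda>x. if g x \<in> A then g x else a"
    have k: "?k \<in> X \<rightarrow> A" using a by auto
    have "{x\<in>X. g x = ?k x} \<in> \<U>" using * by (rule uf_Collect_mono[OF uf]) simp
    then have "germ X \<U> g = upow_M X \<U> A Y (\<lambda>a. a) (germ X \<U> ?k)"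
      unfolding upow_M_germ[OF k] germ_eq_iff[OF uf] .
    then show "germ X \<U> g \<in> upow_M X \<U> A Y (\<lambda>a. a) ` upow_T X \<U> A"
      unfolding upow_T_def using k by blast
  qed
  then show ?thesis by (simp add: push_def)
qed

lemma upow_in_FC: "upow u X \<U> \<in> Ob (FC u)"
  unfolding upow_def
proof (rule up.E_in_FC[OF inacc])
  have "X \<noteq> {}" using uf_top[OF uf] uf_empty[OF uf] by auto
  then show "upow_T X \<U> {} = {}" by (auto simp: upow_T_def)
  fix Y t assume "t \<in> upow_T X \<U> Y"
  then obtain g where g: "g \<in> X \<rightarrow> Y" "t = germ X \<U> g" by (auto simp: upow_T_def)
  show "ultrafilter_on Y {A. A \<subseteq> Y \<and> t \<in> upow_M X \<U> A Y (\<lambda>a. a) ` upow_T X \<U> A}"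
    unfolding g(2) upow_T_tp[OF g(1)] using uf g(1) by (rule ultrafilter_push)
qed

lemma germ_in: "g \<in> X \<rightarrow> Y \<Longrightarrow> germ X \<U> g \<in> upow_T X \<U> Y"
  by (simp add: upow_T_def)

lemma elt_in: "small u Y \<Longrightarrow> g \<in> X \<rightarrow> Y \<Longrightarrow> elt X \<U> Y g \<in> on_ob (upow u X \<U>) Y"
  unfolding elt_def upow_def by (intro up.enc_in germ_in)

lemma elt_cases:
  assumes "small u Y" "t \<in> on_ob (upow u X \<U>) Y"
  obtains g where "g \<in> X \<rightarrow> Y" "t = elt X \<U> Y g"
  using up.E_cases[OF assms(1)] assms(2) unfolding elt_def upow_def upow_T_def by blast

lemma elt_eq_iff:
  assumes "small u Y" "g \<in> X \<rightarrow> Y" "g' \<in> X \<rightarrow> Y"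
  shows "elt X \<U> Y g = elt X \<U> Y g' \<longleftrightarrow> {x\<in>X. g x = g' x} \<in> \<U>"
  unfolding elt_def enc_eq_iff[OF small_upow_T[OF assms(1)] germ_in[OF assms(2)] germ_in[OF assms(3)]]
  by (rule germ_eq_iff[OF uf])

lemma ap_elt:
  assumes "small u Y" "small u Y'" "f \<in> Y \<rightarrow> Y'" "g \<in> X \<rightarrow> Y"
  shows "ap (upow u X \<U>) Y Y' f (elt X \<U> Y g) = elt X \<U> Y' (\<lambda>a. f (g a))"
  unfolding elt_def upow_def up.E_ap[OF assms(1-3) germ_in[OF assms(4)]] upow_M_germ[OF assms(4)] ..

lemma tp_elt:
  assumes "small u Y" "g \<in> X \<rightarrow> Y"
  shows "tp (upow u X \<U>) Y (elt X \<U> Y g) = push X Y g \<U>"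
  unfolding elt_def upow_def up.E_tp[OF assms(1) germ_in[OF assms(2)]] upow_T_tp[OF assms(2)] ..

lemma id_X: "(\<lambda>a. a) \<in> X \<rightarrow> X" by simp

lemma tp_elt_id: "tp (upow u X \<U>) X (elt X \<U> X (\<lambda>a. a)) = \<U>"
  using tp_elt[OF X id_X] push_id[OF uf] by simp

section \<open>The Yoneda correspondence for ultrapowers\<close>

definition yo :: "'u endo \<Rightarrow> 'u \<Rightarrow> 'u set \<Rightarrow> 'u \<Rightarrow> 'u" where
  "yo F x = mk_nat u (upow u X \<U>) (\<lambda>Y t. ap F X Y (SOME g. g \<in> X \<rightarrow> Y \<and> elt X \<U> Y g = t) x)"

context
  fixes F assumes F: "F \<in> Ob (FC u)"
begin

text \<open>Two representatives of one germ agree on a set of \<open>\<U>\<close>, the type of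
  \<open>x\<close>, so by \<open>ap_eq_on\<close> the chosen one acts on \<open>x\<close> as
  \<open>g\<close> does. This is where the type condition of the correspondence enters.\<close>

lemma yo_elt:
  assumes x: "x \<in> on_ob F X" "tp F X x = \<U>" and Y: "small u Y" and g: "g \<in> X \<rightarrow> Y"
  shows "yo F x Y (elt X \<U> Y g) = ap F X Y g x"
proof -
  let ?k = "SOME k. k \<in> X \<rightarrow> Y \<and> elt X \<U> Y k = elt X \<U> Y g"
  have k: "?k \<in> X \<rightarrow> Y \<and> elt X \<U> Y ?k = elt X \<U> Y g"
    by (rule someI[of _ g]) (use g in simp)
  then have "{a\<in>X. ?k a = g a} \<in> tp F X x" using elt_eq_iff[OF Y _ g] x(2) by blast
  then have "ap F X Y ?k x = ap F X Y g x"
    using k g x Y by (intro ap_eq_on[OF FC_partitive[OF inacc F] X]) auto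
  then show ?thesis unfolding yo_def using Y elt_in[OF Y g] by simp
qed

lemma yo_Hom:
  assumes x: "x \<in> on_ob F X" "tp F X x = \<U>"
  shows "yo F x \<in> Hom (FC u) (upow u X \<U>) F"
proof -
  note E = FC_endofunctor[OF inacc F]
  have eq: "yo F x = mk_nat u (upow u X \<U>) (yo F x)"
    by (auto simp: yo_def mk_nat_def fun_eq_iff)
  show ?thesis
  proof (subst eq, rule mk_nat_in[OF inacc upow_in_FC F])
    fix Y t assume Y: "small u Y" and t: "t \<in> on_ob (upow u X \<U>) Y"
    obtain g where g: "g \<in> X \<rightarrow> Y" "t = elt X \<U> Y g" using Y t by (rule elt_cases)
    show "yo F x Y t \<in> on_ob F Y"
      unfolding g(2) yo_elt[OF x Y g(1)] using X Y g(1) x(1) by (rule ap_in[OF E])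
    fix Y' :: "'u set" and f assume Y': "small u Y'" and f: "f \<in> Y \<rightarrow> Y'"
    have fg: "(\<lambda>a. f (g a)) \<in> X \<rightarrow> Y'" using f g(1) by auto
    show "yo F x Y' (ap (upow u X \<U>) Y Y' f t) = ap F Y Y' f (yo F x Y t)"
      unfolding g(2) ap_elt[OF Y Y' f g(1)] yo_elt[OF x Y g(1)] yo_elt[OF x Y' fg]
      using X Y Y' g(1) f x(1) by (rule ap_ap[OF E, symmetric])
  qed
qed

lemma yo_id:
  assumes "x \<in> on_ob F X" "tp F X x = \<U>"
  shows "yo F x X (elt X \<U> X (\<lambda>a. a)) = x"
  unfolding yo_elt[OF assms X id_X] using X assms(1) by (rule ap_ident[OF FC_endofunctor[OF inacc F]]) simp

text \<open>Every element of the ultrapower is the image of the germ of the identity under some map,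
  so naturality determines a transformation by its value there.\<close>

lemma Hom_upow_eqI:
  assumes a: "\<alpha> \<in> Hom (FC u) (upow u X \<U>) F" and b: "\<beta> \<in> Hom (FC u) (upow u X \<U>) F"
    and eq: "\<alpha> X (elt X \<U> X (\<lambda>a. a)) = \<beta> X (elt X \<U> X (\<lambda>a. a))"
  shows "\<alpha> = \<beta>"
proof (rule FC_Hom_eqI[OF inacc upow_in_FC F a b])
  fix Y t assume Y: "small u Y" and t: "t \<in> on_ob (upow u X \<U>) Y"
  obtain g where g: "g \<in> X \<rightarrow> Y" "t = elt X \<U> Y g" using Y t by (rule elt_cases)
  have "t = ap (upow u X \<U>) X Y g (elt X \<U> X (\<lambda>a. a))"
    unfolding g(2) ap_elt[OF X Y g(1) id_X] ..
  then show "\<alpha> Y t = \<beta> Y t"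
    using FC_Hom_ap[OF inacc upow_in_FC F a X Y g(1) elt_in[OF X id_X]]
      FC_Hom_ap[OF inacc upow_in_FC F b X Y g(1) elt_in[OF X id_X]] eq by simp
qed

lemma Hom_upow_elt:
  assumes a: "\<alpha> \<in> Hom (FC u) (upow u X \<U>) F"
  shows "\<alpha> X (elt X \<U> X (\<lambda>a. a)) \<in> on_ob F X" "tp F X (\<alpha> X (elt X \<U> X (\<lambda>a. a))) = \<U>"
    "\<alpha> = yo F (\<alpha> X (elt X \<U> X (\<lambda>a. a)))"
proof -
  show 1: "\<alpha> X (elt X \<U> X (\<lambda>a. a)) \<in> on_ob F X"
    using FC_Hom_in[OF inacc upow_in_FC F a X elt_in[OF X id_X]] .
  show 2: "tp F X (\<alpha> X (elt X \<U> X (\<lambda>a. a))) = \<U>"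
    using FC_Hom_tp[OF inacc upow_in_FC F a X elt_in[OF X id_X]] tp_elt_id by simp
  show "\<alpha> = yo F (\<alpha> X (elt X \<U> X (\<lambda>a. a)))"
    using a yo_Hom[OF 1 2] yo_id[OF 1 2] by (intro Hom_upow_eqI) simp_all
qed

lemma small_Hom_upow: "small u (Hom (FC u) (upow u X \<U>) F)"
proof (rule small_inj_on)
  show "small u (on_ob F X)" using FC_endofunctor[OF inacc F] X by (rule small_on_ob)
  show "inj_on (\<lambda>\<alpha>. \<alpha> X (elt X \<U> X (\<lambda>a. a))) (Hom (FC u) (upow u X \<U>) F)"
    by (rule inj_onI) (rule Hom_upow_eqI)
  show "(\<lambda>\<alpha>. \<alpha> X (elt X \<U> X (\<lambda>a. a))) ` Hom (FC u) (upow u X \<U>) F \<subseteq> on_ob F X"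
    using Hom_upow_elt(1) by blast
qed

end

end

section \<open>Hom-functors and the projectivity of ultrapowers\<close>

lemma hom_ftor_simps [simp]:
  "on_ob (hom_ftor C x) y = Hom C x y"
  "on_hom (hom_ftor C x) y z g = (\<lambda>f\<in>Hom C x y. Comp C x y z g f)"
  by (simp_all add: hom_ftor_def)

lemma hom_ftor_functor:
  assumes C: "category C" and x: "x \<in> Ob C" and sm: "\<And>y. y \<in> Ob C \<Longrightarrow> small u (Hom C x y)"
  shows "is_functor C (set_cat u) (hom_ftor C x)"
  unfolding is_functor_def set_cat_simps hom_ftor_simps
proof (intro conjI ballI)
  fix y assume y: "y \<in> Ob C"
  show "Hom C x y \<in> {A. small u A}" using sm[OF y] by simp
  show "(\<lambda>f\<in>Hom C x y. Comp C x y y (Id C y) f) = (\<lambda>f\<in>Hom C x y. f)"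
    by (rule restrict_ext) (rule cat_Id_left[OF C x y])
next
  fix y z g assume y: "y \<in> Ob C" and z: "z \<in> Ob C" and g: "g \<in> Hom C y z"
  show "(\<lambda>f\<in>Hom C x y. Comp C x y z g f) \<in> Hom C x y \<rightarrow>\<^sub>E Hom C x z"
    unfolding restrict_PiE_iff using cat_Comp[OF C x y z _ g] by blast
next
  fix y z w g k assume y: "y \<in> Ob C" and z: "z \<in> Ob C" and w: "w \<in> Ob C"
    and g: "g \<in> Hom C y z" and k: "k \<in> Hom C z w"
  show "(\<lambda>f\<in>Hom C x y. Comp C x y w (Comp C y z w k g) f) =
      compose (Hom C x y) (\<lambda>f\<in>Hom C x z. Comp C x z w k f) (\<lambda>f\<in>Hom C x y. Comp C x y z g f)"
    unfolding compose_def
  proof (rule restrict_ext)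
    fix f assume f: "f \<in> Hom C x y"
    then have "Comp C x y z g f \<in> Hom C x z" by (intro cat_Comp[OF C x y z _ g])
    then show "Comp C x y w (Comp C y z w k g) f =
        (\<lambda>f\<in>Hom C x z. Comp C x z w k f) ((\<lambda>f\<in>Hom C x y. Comp C x y z g f) f)"
      using f cat_assoc[OF C x y z w f g k] by simp
  qed
qed

lemma hom_ftor_cocone:
  assumes C: "category C" and x: "x \<in> Ob C" and sm: "\<And>y. y \<in> Ob C \<Longrightarrow> small u (Hom C x y)"
    and D: "is_functor J C D" and co: "is_cocone J C D c \<iota>"
  shows "is_cocone J (set_cat u) (comp_ftor (hom_ftor C x) D) (Hom C x c)
    (\<lambda>j. \<lambda>f\<in>Hom C x (on_ob D j). Comp C x (on_ob D j) c (\<iota> j) f)"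
  unfolding is_cocone_def set_cat_simps comp_ftor_def hom_ftor_simps ftor.simps
proof (intro conjI ballI)
  have c: "c \<in> Ob C" using co by (simp add: is_cocone_def)
  then show "Hom C x c \<in> {A. small u A}" using sm by simp
  fix i assume i: "i \<in> Ob J"
  have Di: "on_ob D i \<in> Ob C" using D i by (simp add: is_functor_def)
  have \<iota>i: "\<iota> i \<in> Hom C (on_ob D i) c" using co i by (simp add: is_cocone_def)
  show "(\<lambda>f\<in>Hom C x (on_ob D i). Comp C x (on_ob D i) c (\<iota> i) f) \<in> Hom C x (on_ob D i) \<rightarrow>\<^sub>E Hom C x c"
    unfolding restrict_PiE_iff using cat_Comp[OF C x Di c _ \<iota>i] by blast
  fix j f assume j: "j \<in> Ob J" and f: "f \<in> Hom J i j"
  have Dj: "on_ob D j \<in> Ob C" using D j by (simp add: is_functor_def)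
  have \<iota>j: "\<iota> j \<in> Hom C (on_ob D j) c" using co j by (simp add: is_cocone_def)
  have Df: "on_hom D i j f \<in> Hom C (on_ob D i) (on_ob D j)" using D i j f by (simp add: is_functor_def)
  have eq: "Comp C (on_ob D i) (on_ob D j) c (\<iota> j) (on_hom D i j f) = \<iota> i"
    using co i j f by (simp add: is_cocone_def)
  show "compose (Hom C x (on_ob D i)) (\<lambda>f\<in>Hom C x (on_ob D j). Comp C x (on_ob D j) c (\<iota> j) f)
      (\<lambda>g\<in>Hom C x (on_ob D i). Comp C x (on_ob D i) (on_ob D j) (on_hom D i j f) g) =
      (\<lambda>f\<in>Hom C x (on_ob D i). Comp C x (on_ob D i) c (\<iota> i) f)"
    unfolding compose_def
  proof (rule restrict_ext)
    fix g assume g: "g \<in> Hom C x (on_ob D i)"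
    then have "Comp C x (on_ob D i) (on_ob D j) (on_hom D i j f) g \<in> Hom C x (on_ob D j)"
      by (intro cat_Comp[OF C x Di Dj _ Df])
    then show "(\<lambda>f\<in>Hom C x (on_ob D j). Comp C x (on_ob D j) c (\<iota> j) f)
        ((\<lambda>g\<in>Hom C x (on_ob D i). Comp C x (on_ob D i) (on_ob D j) (on_hom D i j f) g) g) =
        Comp C x (on_ob D i) c (\<iota> i) g"
      using g cat_assoc[OF C x Di Dj c g Df \<iota>j] eq by simp
  qed
qed

context
  fixes u :: "'u itself"
  assumes inacc: "inaccessible u"
begin

text \<open>By \<open>eval_colimit\<close>, two-valued functions on \<open>on_ob c Z\<close> are
  determined by their restrictions along \<open>\<iota>\<close>; at a missed element
  \<open>x\<close>, the constant function and its change at \<open>x\<close> would contradict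
  this.\<close>

lemma colimit_jointly_surjective:
  assumes D: "is_functor J (FC u) D" and col: "is_colimit J (FC u) D c \<iota>"
    and Z: "small u Z" and x: "x \<in> on_ob c Z"
  shows "\<exists>j\<in>Ob J. \<exists>t\<in>on_ob (on_ob D j) Z. x = \<iota> j Z t"
proof (rule ccontr)
  assume no: "\<not> (\<exists>j\<in>Ob J. \<exists>t\<in>on_ob (on_ob D j) Z. x = \<iota> j Z t)"
  obtain z w :: 'u where zw: "z \<noteq> w"
    using univ_two_elements[OF inacc] by blast
  have S: "small u {z, w}" by (rule small_finite[OF inacc]) simp
  have "(\<lambda>_. z) x = (\<lambda>v. if v = x then w else z) x"
    by (rule eval_colimit(2)[OF inacc Z S D col, where p = "\<lambda>_ _. z" and h = "\<lambda>_. z" and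
          k = "\<lambda>v. if v = x then w else z"]) (use x no in auto)
  then show False using zw by simp
qed

text \<open>By Yoneda, maps from the ultrapower to \<open>F\<close> are the elements of
  \<open>on_ob F X\<close> of type \<open>\<U>\<close>. Arrows preserve types, so in every diagram
  these elements split off as a summand of the values at \<open>X\<close>, and the colimit property
  of \<open>eval_colimit\<close> passes to the summand.\<close>

lemma upow_small_projective:
  assumes X: "small u X" and uf: "ultrafilter_on X \<U>"
  shows "small_projective u (FC u) (upow u X \<U>)"
  unfolding small_projective_def preserves_small_colimits_def
proof (intro conjI allI impI)
  let ?y = "upow u X \<U>" and ?e = "elt X \<U> X (\<lambda>a. a)"
  note y = upow_in_FC[OF inacc X uf]
  note sm = small_Hom_upow[OF inacc X uf]
  note cat = category_FC[of u]
  show "is_functor (FC u) (set_cat u) (hom_ftor (FC u) ?y)"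
    using cat y sm by (rule hom_ftor_functor)
  fix J :: "('u, 'u) cat" and D c \<iota>
  assume "small_category u J \<and> is_functor J (FC u) D \<and> is_colimit J (FC u) D c \<iota>"
  then have D: "is_functor J (FC u) D" and col: "is_colimit J (FC u) D c \<iota>" by blast+
  have co: "is_cocone J (FC u) D c \<iota>" using col by (simp add: is_colimit_def)
  have c: "c \<in> Ob (FC u)" using co by (simp add: is_cocone_def)
  have Dob: "on_ob D j \<in> Ob (FC u)" if "j \<in> Ob J" for j
    using D that by (simp add: is_functor_def)
  have Dhom: "on_hom D i j f \<in> Hom (FC u) (on_ob D i) (on_ob D j)"
    if "i \<in> Ob J" "j \<in> Ob J" "f \<in> Hom J i j" for i j f
    using D that by (simp add: is_functor_def)
  have \<iota>: "\<And>j. j \<in> Ob J \<Longrightarrow> \<iota> j \<in> Hom (FC u) (on_ob D j) c"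
    using col by (auto simp: is_colimit_def is_cocone_def)
  note eX = elt_in[OF inacc X uf X id_X[OF inacc X uf]]
  let ?H = "Hom (FC u) ?y"
  let ?\<iota> = "\<lambda>j. \<lambda>\<alpha>\<in>?H (on_ob D j). Comp (FC u) ?y (on_ob D j) c (\<iota> j) \<alpha>"
  \<comment> \<open>An element of the colimit comes from some \<open>on_ob D j\<close>, and its
    preimage has the same type; Yoneda turns the preimage into a map.\<close>
  have lift: "\<exists>j\<in>Ob J. \<exists>\<beta>\<in>?H (on_ob D j). \<alpha> = Comp (FC u) ?y (on_ob D j) c (\<iota> j) \<beta>" if a: "\<alpha> \<in> ?H c" for \<alpha>
  proof -
    note ae = Hom_upow_elt[OF inacc X uf c a]
    obtain j t where j: "j \<in> Ob J" and t: "t \<in> on_ob (on_ob D j) X" and eq: "\<alpha> X ?e = \<iota> j X t"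
      using colimit_jointly_surjective[OF D col X ae(1)] by blast
    have tpt: "tp (on_ob D j) X t = \<U>"
      using FC_Hom_tp[OF inacc Dob[OF j] c \<iota>[OF j] X t] ae(2) eq by simp
    note b = yo_Hom[OF inacc X uf Dob[OF j] t tpt]
    have "\<alpha> = Comp (FC u) ?y (on_ob D j) c (\<iota> j) (yo u X \<U> (on_ob D j) t)"
    proof (rule Hom_upow_eqI[OF inacc X uf c a])
      show "Comp (FC u) ?y (on_ob D j) c (\<iota> j) (yo u X \<U> (on_ob D j) t) \<in> ?H c"
        using cat y Dob[OF j] c b \<iota>[OF j] by (rule cat_Comp)
      show "\<alpha> X ?e = Comp (FC u) ?y (on_ob D j) c (\<iota> j) (yo u X \<U> (on_ob D j) t) X ?e"
        using FC_Comp_apply[OF X eX] yo_id[OF inacc X uf Dob[OF j] t tpt] eq by simp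
    qed
    then show ?thesis using j b by blast
  qed
  show "is_colimit J (set_cat u) (comp_ftor (hom_ftor (FC u) ?y) D) (on_ob (hom_ftor (FC u) ?y) c)
      (\<lambda>j. on_hom (hom_ftor (FC u) ?y) (on_ob D j) c (\<iota> j))"
    unfolding is_colimit_def hom_ftor_simps
  proof (intro conjI allI impI)
    show "is_cocone J (set_cat u) (comp_ftor (hom_ftor (FC u) ?y) D) (?H c) ?\<iota>"
      using cat y sm D co by (rule hom_ftor_cocone)
    fix d \<kappa> assume cone: "is_cocone J (set_cat u) (comp_ftor (hom_ftor (FC u) ?y) D) d \<kappa>"
    have d: "small u d" and \<kappa>: "\<And>j. j \<in> Ob J \<Longrightarrow> \<kappa> j \<in> ?H (on_ob D j) \<rightarrow>\<^sub>E d"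
      using cone by (auto simp: is_cocone_def comp_ftor_def)
    have \<kappa>_nat: "\<kappa> j (Comp (FC u) ?y (on_ob D i) (on_ob D j) (on_hom D i j f) \<alpha>) = \<kappa> i \<alpha>"
      if "i \<in> Ob J" "j \<in> Ob J" "f \<in> Hom J i j" "\<alpha> \<in> ?H (on_ob D i)" for i j f \<alpha>
    proof -
      have "compose (?H (on_ob D i)) (\<kappa> j)
          (\<lambda>\<alpha>\<in>?H (on_ob D i). Comp (FC u) ?y (on_ob D i) (on_ob D j) (on_hom D i j f) \<alpha>) = \<kappa> i"
        using cone that(1-3) by (simp add: is_cocone_def comp_ftor_def)
      from fun_cong[OF this, of \<alpha>] show ?thesis using that(4) by (simp add: compose_def)
    qed
    define e where "e = (enc d :: _ \<Rightarrow> 'u)"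
    have e: "inj_on e d" unfolding e_def using d by (rule inj_enc)
    have "e ` d \<noteq> UNIV"
    proof
      assume "e ` d = UNIV"
      then have "small u (UNIV :: 'u set)" using small_image[OF d, of e] by simp
      then show False by (simp add: small_def)
    qed
    then obtain z where z: "z \<notin> e ` d" by blast
    define S where "S = insert z (e ` d)"
    have S: "small u S"
    proof -
      have "S = \<Union>{{z}, e ` d}" by (simp add: S_def)
      moreover have "small u (\<Union>{{z}, e ` d})"
        by (rule small_Union[OF inacc]) (auto intro: small_finite[OF inacc] small_image[OF d])
      ultimately show ?thesis by simp
    qed
    \<comment> \<open>The cocone \<open>\<kappa>\<close> on the elements of type \<open>\<U>\<close>
      is extended to all elements by the extra value \<open>z\<close>. It remains compatible because
      the maps of the diagram preserve types.\<close>
    define p where "p j t = (if tp (on_ob D j) X t = \<U> then e (\<kappa> j (yo u X \<U> (on_ob D j) t)) else z)" for j t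
    have pS: "p j \<in> on_ob (on_ob D j) X \<rightarrow> S" if j: "j \<in> Ob J" for j
    proof
      fix t assume t: "t \<in> on_ob (on_ob D j) X"
      show "p j t \<in> S"
        using yo_Hom[OF inacc X uf Dob[OF j] t] PiE_mem[OF \<kappa>[OF j]] by (auto simp: p_def S_def)
    qed
    have p_nat: "p j (on_hom D i j f X t) = p i t"
      if i: "i \<in> Ob J" and j: "j \<in> Ob J" and f: "f \<in> Hom J i j" and t: "t \<in> on_ob (on_ob D i) X" for i j f t
    proof -
      have tpe: "tp (on_ob D j) X (on_hom D i j f X t) = tp (on_ob D i) X t"
        using FC_Hom_tp[OF inacc Dob[OF i] Dob[OF j] Dhom[OF i j f] X t] .
      show ?thesis
      proof (cases "tp (on_ob D i) X t = \<U>")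
        case True
        note b = yo_Hom[OF inacc X uf Dob[OF i] t True]
        have in': "on_hom D i j f X t \<in> on_ob (on_ob D j) X"
          using FC_Hom_in[OF inacc Dob[OF i] Dob[OF j] Dhom[OF i j f] X t] .
        have "yo u X \<U> (on_ob D j) (on_hom D i j f X t) =
            Comp (FC u) ?y (on_ob D i) (on_ob D j) (on_hom D i j f) (yo u X \<U> (on_ob D i) t)"
        proof (rule Hom_upow_eqI[OF inacc X uf Dob[OF j]])
          show "yo u X \<U> (on_ob D j) (on_hom D i j f X t) \<in> ?H (on_ob D j)"
            using yo_Hom[OF inacc X uf Dob[OF j] in'] True tpe by simp
          show "Comp (FC u) ?y (on_ob D i) (on_ob D j) (on_hom D i j f) (yo u X \<U> (on_ob D i) t) \<in> ?H (on_ob D j)"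
            using cat y Dob[OF i] Dob[OF j] b Dhom[OF i j f] by (rule cat_Comp)
          show "yo u X \<U> (on_ob D j) (on_hom D i j f X t) X ?e =
              Comp (FC u) ?y (on_ob D i) (on_ob D j) (on_hom D i j f) (yo u X \<U> (on_ob D i) t) X ?e"
            using FC_Comp_apply[OF X eX] yo_id[OF inacc X uf Dob[OF i] t True]
              yo_id[OF inacc X uf Dob[OF j] in'] True tpe by simp
        qed
        then show ?thesis using \<kappa>_nat[OF i j f b] True tpe by (simp add: p_def)
      qed (simp add: p_def tpe)
    qed
    obtain h where h: "\<And>j t. j \<in> Ob J \<Longrightarrow> t \<in> on_ob (on_ob D j) X \<Longrightarrow> h (\<iota> j X t) = p j t"
      using eval_colimit(1)[OF inacc X S D col pS p_nat] by blast
    \<comment> \<open>The extension is read off at the image of the generic element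
      \<open>?e\<close>. This image has type \<open>\<U>\<close>, so \<open>h\<close> takes its
      value in the copy of \<open>d\<close> there.\<close>
    define H where "H = (\<lambda>\<alpha>\<in>?H c. inv_into d e (h (\<alpha> X ?e)))"
    have H_eq: "H (Comp (FC u) ?y (on_ob D j) c (\<iota> j) \<beta>) = \<kappa> j \<beta>"
      if j: "j \<in> Ob J" and b: "\<beta> \<in> ?H (on_ob D j)" for j \<beta>
    proof -
      note be = Hom_upow_elt[OF inacc X uf Dob[OF j] b]
      have "h (\<iota> j X (\<beta> X ?e)) = e (\<kappa> j \<beta>)"
        using h[OF j be(1)] be(2) be(3)[symmetric] by (simp add: p_def)
      moreover have "Comp (FC u) ?y (on_ob D j) c (\<iota> j) \<beta> \<in> ?H c"
        using cat y Dob[OF j] c b \<iota>[OF j] by (rule cat_Comp)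
      ultimately show ?thesis
        using FC_Comp_apply[OF X eX] inv_into_f_f[OF e PiE_mem[OF \<kappa>[OF j] b]] by (simp add: H_def)
    qed
    have comp_iff: "Comp (set_cat u) (on_ob (comp_ftor (hom_ftor (FC u) ?y) D) j) (?H c) d K (?\<iota> j) = \<kappa> j \<longleftrightarrow>
        (\<forall>\<beta>\<in>?H (on_ob D j). K (Comp (FC u) ?y (on_ob D j) c (\<iota> j) \<beta>) = \<kappa> j \<beta>)" if "j \<in> Ob J" for j K
    proof -
      have "\<kappa> j \<in> extensional (?H (on_ob D j))" using \<kappa>[OF that] by (simp add: PiE_def)
      then show ?thesis by (auto simp: comp_ftor_def compose_def fun_eq_iff extensional_def)
    qed
    show "\<exists>!K. K \<in> Hom (set_cat u) (?H c) d \<and>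
        (\<forall>j\<in>Ob J. Comp (set_cat u) (on_ob (comp_ftor (hom_ftor (FC u) ?y) D) j) (?H c) d K (?\<iota> j) = \<kappa> j)"
    proof (rule ex1I[of _ H], intro conjI ballI)
      have "H \<alpha> \<in> d" if a: "\<alpha> \<in> ?H c" for \<alpha>
      proof -
        obtain j \<beta> where "j \<in> Ob J" "\<beta> \<in> ?H (on_ob D j)" "\<alpha> = Comp (FC u) ?y (on_ob D j) c (\<iota> j) \<beta>"
          using lift[OF a] by blast
        then show ?thesis using H_eq PiE_mem[OF \<kappa>] by metis
      qed
      then show "H \<in> Hom (set_cat u) (?H c) d" by (simp add: PiE_iff) (simp add: H_def)
      show "Comp (set_cat u) (on_ob (comp_ftor (hom_ftor (FC u) ?y) D) j) (?H c) d H (?\<iota> j) = \<kappa> j"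
        if "j \<in> Ob J" for j
        unfolding comp_iff[OF that] using H_eq[OF that] by blast
      fix K assume K: "K \<in> Hom (set_cat u) (?H c) d \<and>
        (\<forall>j\<in>Ob J. Comp (set_cat u) (on_ob (comp_ftor (hom_ftor (FC u) ?y) D) j) (?H c) d K (?\<iota> j) = \<kappa> j)"
      show "K = H"
      proof (rule extensionalityI[of _ "?H c"])
        show "K \<in> extensional (?H c)" using K by (simp add: PiE_def)
        show "H \<in> extensional (?H c)" by (simp add: H_def)
        fix \<alpha> assume "\<alpha> \<in> ?H c"
        then obtain j \<beta> where j: "j \<in> Ob J" and b: "\<beta> \<in> ?H (on_ob D j)"
          and eq: "\<alpha> = Comp (FC u) ?y (on_ob D j) c (\<iota> j) \<beta>" using lift by blast
        have "K \<alpha> = \<kappa> j \<beta>" using K comp_iff[OF j] j b unfolding eq by blast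
        then show "K \<alpha> = H \<alpha>" unfolding eq H_eq[OF j b] .
      qed
    qed
  qed
qed

end

section \<open>Endomorphisms of ultrafilters\<close>

text \<open>The components of the graph of \<open>f\<close> are trees, up to a loop at a fixed
  point. With a fixed point, colour by the parity of the distance to it (\<open>k\<close>); without
  one, by the parity of \<open>m + n\<close> where the orbits of \<open>x\<close> and of a chosen
  representative meet (\<open>P\<close>). One step changes either parity.\<close>

lemma two_colouring:
  fixes f :: "'a \<Rightarrow> 'a"
  assumes acyclic: "\<And>n x. (f ^^ n) x = x \<Longrightarrow> n > 0 \<Longrightarrow> f x = x"
  shows "\<exists>c :: 'a \<Rightarrow> bool. \<forall>x. f x \<noteq> x \<longrightarrow> c (f x) \<noteq> c x"
proof -
  have pow_Suc: "(f ^^ n) (f x) = (f ^^ Suc n) x" for n x by (simp add: funpow_swap1)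
  have pow_add: "(f ^^ m) ((f ^^ n) x) = (f ^^ (m + n)) x" for m n x by (simp add: funpow_add)
  have fixed: "(f ^^ n) x = x" if "f x = x" for n x using that by (induction n) auto
  \<comment> \<open>The classes of this relation, of having meeting orbits, are the
    components.\<close>
  define R where "R x y \<longleftrightarrow> (\<exists>m n. (f ^^ m) x = (f ^^ n) y)" for x y
  have R_trans: "R x z" if xy: "R x y" and yz: "R y z" for x y z
  proof -
    obtain m n m' n' where "(f ^^ m) x = (f ^^ n) y" "(f ^^ m') y = (f ^^ n') z"
      using xy yz unfolding R_def by blast
    then have "(f ^^ (m' + m)) x = (f ^^ (n + n')) z"
      by (metis pow_add add.commute)
    then show ?thesis unfolding R_def by blast
  qed
  have R_sym: "R x y \<Longrightarrow> R y x" for x y unfolding R_def by metis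
  have R_f: "R x (f x)" for x unfolding R_def by (intro exI[of _ 1] exI[of _ 0]) simp
  define rep where "rep x = (SOME y. R x y)" for x
  have rep: "R x (rep x)" for x unfolding rep_def by (rule someI[of _ "f x"]) (rule R_f)
  have rep_f: "rep (f x) = rep x" for x
  proof -
    have "R (f x) = R x" using R_trans R_sym R_f by blast
    then show ?thesis by (simp add: rep_def)
  qed
  \<comment> \<open>The orbits that reach a fixed point; \<open>k\<close> counts the steps they
    need.\<close>
  define W where "W x \<longleftrightarrow> (\<exists>n. f ((f ^^ n) x) = (f ^^ n) x)" for x
  define k where "k x = (LEAST n. f ((f ^^ n) x) = (f ^^ n) x)" for x
  define P where "P x \<longleftrightarrow> (\<exists>m n. (f ^^ m) x = (f ^^ n) (rep x) \<and> even (m + n))" for x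
  have W_f: "W (f x) = W x" for x
  proof
    assume "W x"
    then obtain n where n: "f ((f ^^ n) x) = (f ^^ n) x" unfolding W_def by blast
    then have "f ((f ^^ n) (f x)) = (f ^^ n) (f x)" by (simp add: funpow_swap1[symmetric])
    then show "W (f x)" unfolding W_def by blast
  next
    assume "W (f x)"
    then show "W x" unfolding W_def pow_Suc by blast
  qed
  have k_f: "k x = Suc (k (f x))" if "W x" "f x \<noteq> x" for x
  proof -
    obtain n where "f ((f ^^ n) x) = (f ^^ n) x" using \<open>W x\<close> unfolding W_def by blast
    then show ?thesis unfolding k_def pow_Suc using that(2) by (intro Least_Suc) auto
  qed
  \<comment> \<open>If the orbit never reaches a fixed point, the iterates of \<open>rep x\<close>
    are pairwise distinct, so the integer \<open>n - m\<close> is the same for all meeting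
    points.\<close>
  have parity: "even (m + n) = even (m' + n')"
    if nW: "\<not> W x" and e: "(f ^^ m) x = (f ^^ n) (rep x)" and e': "(f ^^ m') x = (f ^^ n') (rep x)" for x m n m' n'
  proof -
    let ?r = "rep x"
    have eq: "(f ^^ (m' + n)) ?r = (f ^^ (m + n')) ?r"
      using e e' by (metis pow_add add.commute)
    have no: "a \<ge> b" if ab: "(f ^^ a) ?r = (f ^^ b) ?r" for a b
    proof (rule ccontr)
      assume "\<not> a \<ge> b"
      then have "(f ^^ (b - a)) ((f ^^ a) ?r) = (f ^^ b) ?r" and pos: "b - a > 0"
        by (simp_all only: pow_add) simp_all
      then have fx: "f ((f ^^ a) ?r) = (f ^^ a) ?r" using ab by (intro acyclic[OF _ pos]) simp
      have "(f ^^ (a + m)) x = (f ^^ n) ((f ^^ a) ?r)" using e by (metis pow_add add.commute)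
      then have "(f ^^ (a + m)) x = (f ^^ a) ?r" using fixed[OF fx] by simp
      then show False using nW fx unfolding W_def by metis
    qed
    have "m' + n = m + n'" using no[OF eq] no[OF eq[symmetric]] by simp
    then show ?thesis by presburger
  qed
  have P_f: "P (f x) \<noteq> P x" if nW: "\<not> W x" for x
  proof -
    obtain m n where "(f ^^ m) (f x) = (f ^^ n) (rep (f x))" using rep[of "f x"] unfolding R_def by blast
    then have e: "(f ^^ m) (f x) = (f ^^ n) (rep x)" by (simp only: rep_f)
    then have e': "(f ^^ Suc m) x = (f ^^ n) (rep x)" by (simp only: pow_Suc)
    have nW': "\<not> W (f x)" using nW W_f by simp
    have "P (f x) \<longleftrightarrow> even (m + n)"
      unfolding P_def rep_f using e parity[OF nW', unfolded rep_f, OF e] by blast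
    moreover have "P x \<longleftrightarrow> even (Suc m + n)"
      unfolding P_def using e' parity[OF nW e'] by blast
    ultimately show ?thesis by simp
  qed
  show ?thesis
  proof (intro exI allI impI)
    fix x assume "f x \<noteq> x"
    then show "(if W (f x) then even (k (f x)) else P (f x)) \<noteq> (if W x then even (k x) else P x)"
      using W_f[of x] k_f[of x] P_f[of x] by auto
  qed
qed

text \<open>Replacing \<open>f\<close> by the identity where it does not move up along
  \<open>r\<close> gives a map \<open>g\<close> whose only cycles are fixed points, so
  \<open>two_colouring\<close> applies. If almost every point moved up, \<open>f\<close> would
  almost everywhere exchange the two colour classes; but one class belongs to \<open>\<U>\<close>,
  and then so does its preimage.\<close>

lemma uf_not_increasing:
  fixes r :: "('x \<times> 'x) set"
  assumes uf: "ultrafilter_on X \<U>" and push: "push X X f \<U> = \<U>"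
    and r: "refl r" "trans r" "antisym r"
  shows "{x\<in>X. f x \<noteq> x \<and> (x, f x) \<in> r} \<notin> \<U>"
proof
  assume E: "{x\<in>X. f x \<noteq> x \<and> (x, f x) \<in> r} \<in> \<U>"
  define g where "g x = (if (x, f x) \<in> r then f x else x)" for x
  have g: "(x, g x) \<in> r" for x using r(1) by (auto simp: g_def refl_on_def)
  have gn: "(x, (g ^^ n) x) \<in> r" for n x
  proof (induction n)
    case 0 then show ?case using r(1) by (simp add: refl_on_def)
  next
    case (Suc n) then show ?case using g[of "(g ^^ n) x"] r(2) by (auto elim: transE)
  qed
  have "g x = x" if "(g ^^ n) x = x" "n > 0" for n x
  proof -
    obtain m where m: "n = Suc m" using \<open>n > 0\<close> gr0_implies_Suc by blast
    then have "(g ^^ m) (g x) = x" using that(1) by (simp add: funpow_swap1)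
    then have "(g x, x) \<in> r" using gn[of "g x" m] by simp
    then show ?thesis using g[of x] r(3) by (auto dest: antisymD)
  qed
  then obtain c :: "'x \<Rightarrow> bool" where "\<And>x. g x \<noteq> x \<Longrightarrow> c (g x) \<noteq> c x"
    using two_colouring[of g] by blast
  then have c: "c (f x) \<noteq> c x" if "f x \<noteq> x" "(x, f x) \<in> r" for x
    using that by (metis g_def)
  have inv: "{x\<in>X. f x \<in> C} \<in> \<U>" if "C \<in> \<U>" for C
    using that push unfolding push_def by blast
  have no: False if D: "{x\<in>X. c x = b} \<in> \<U>" for b
  proof -
    have "{x\<in>X. f x \<in> {x\<in>X. c x = b}} \<in> \<U>" using D by (rule inv)
    from this E have "{x\<in>X. c x \<noteq> b} \<in> \<U>"
      by (rule uf_Collect_conj[OF uf]) (use c in auto)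
    from this D have "{x\<in>X. False} \<in> \<U>" by (rule uf_Collect_conj[OF uf]) simp
    then show False using uf_empty[OF uf] by simp
  qed
  have eq: "X - {x\<in>X. c x = True} = {x\<in>X. c x = False}" by auto
  have "{x\<in>X. c x = True} \<subseteq> X" by auto
  from uf_compl[OF uf this, THEN iffD2] have "X - {x\<in>X. c x = True} \<in> \<U>" using no by blast
  then show False unfolding eq by (rule no)
qed

text \<open>\<open>f\<close> may have cycles, and an odd one such as a 3-cycle has no 2-colouring.
  So a total order on the type splits the moved points into those that go up and those that go down;
  neither set belongs to \<open>\<U>\<close>, the second by the same argument for the converse
  order.\<close>

lemma uf_endomorphism_identity:
  assumes uf: "ultrafilter_on X \<U>" and push: "push X X f \<U> = \<U>"
  shows "{x\<in>X. f x = x} \<in> \<U>"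
proof -
  obtain r :: "('a \<times> 'a) set" where wo: "well_order_on UNIV r" using well_order_on by blast
  then have r: "refl r" "trans r" "antisym r" and tot: "total r"
    unfolding well_order_on_def linear_order_on_def partial_order_on_def preorder_on_def by auto
  have "refl (r\<inverse>)" "trans (r\<inverse>)" "antisym (r\<inverse>)" using r by auto
  note 1 = uf_not_increasing[OF uf push r] and 2 = uf_not_increasing[OF uf push this]
  let ?A = "{x\<in>X. f x \<noteq> x \<and> (x, f x) \<in> r}" and ?B = "{x\<in>X. f x \<noteq> x \<and> (x, f x) \<in> r\<inverse>}"
  have "X - ?A \<in> \<U>" "X - ?B \<in> \<U>" using 1 2 uf_compl[OF uf, of ?A] uf_compl[OF uf, of ?B] by auto
  then have "(X - ?A) \<inter> (X - ?B) \<in> \<U>" by (rule uf_Int[OF uf])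
  then show ?thesis
    by (rule uf_mono[OF uf]) (use tot in \<open>auto simp: total_on_def\<close>)
qed

section \<open>Small-projective functors are ultrapowers\<close>

lemma is_functor_comp:
  assumes F: "is_functor C D F" and G: "is_functor D E G"
  shows "is_functor C E (comp_ftor G F)"
  using assms unfolding is_functor_def comp_ftor_def by simp

text \<open>A two-point set detects a missed element: the constant map and its change at
  \<open>y\<close> have the same restrictions. The two points have to be supplied by the element
  type.\<close>

lemma set_colimit_jointly_surjective:
  fixes c :: "'x set" and z w :: 'x
  assumes inacc: "inaccessible u" and zw: "z \<noteq> w" and D: "is_functor J (set_cat u) D"
    and col: "is_colimit J (set_cat u) D c \<iota>" and y: "y \<in> c"
  shows "\<exists>j\<in>Ob J. \<exists>t\<in>on_ob D j. y = \<iota> j t"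
proof (rule ccontr)
  assume no: "\<not> (\<exists>j\<in>Ob J. \<exists>t\<in>on_ob D j. y = \<iota> j t)"
  let ?\<kappa> = "\<lambda>j. \<lambda>t\<in>on_ob D j. z"
  have \<iota>: "\<iota> j t \<in> c" if "j \<in> Ob J" "t \<in> on_ob D j" for j t
    using col that by (auto simp: is_colimit_def is_cocone_def)
  have Df: "on_hom D i j f t \<in> on_ob D j" if "i \<in> Ob J" "j \<in> Ob J" "f \<in> Hom J i j" "t \<in> on_ob D i" for i j f t
  proof -
    have "on_hom D i j f \<in> on_ob D i \<rightarrow>\<^sub>E on_ob D j" using D that(1-3) by (simp add: is_functor_def)
    then show ?thesis using that(4) by (rule PiE_mem)
  qed
  have "is_cocone J (set_cat u) D {z, w} ?\<kappa>"
    unfolding is_cocone_def set_cat_simps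
  proof (intro conjI ballI)
    show "{z, w} \<in> {A. small u A}" using small_finite[OF inacc, of "{z, w}"] by simp
    show "compose (on_ob D i) (?\<kappa> j) (on_hom D i j f) = ?\<kappa> i"
      if "i \<in> Ob J" "j \<in> Ob J" "f \<in> Hom J i j" for i j f
      unfolding compose_def using Df[OF that] by (intro restrict_ext) simp
  qed simp
  then have ex1: "\<exists>!h. h \<in> c \<rightarrow>\<^sub>E {z, w} \<and> (\<forall>j\<in>Ob J. compose (on_ob D j) h (\<iota> j) = ?\<kappa> j)"
    using col by (simp add: is_colimit_def)
  let ?h = "\<lambda>v\<in>c. z" and ?k = "\<lambda>v\<in>c. if v = y then w else z"
  have "compose (on_ob D j) ?h (\<iota> j) = ?\<kappa> j" "compose (on_ob D j) ?k (\<iota> j) = ?\<kappa> j" if "j \<in> Ob J" for j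
  proof -
    have "\<iota> j t \<noteq> y" if "t \<in> on_ob D j" for t using no \<open>j \<in> Ob J\<close> that by blast
    then show "compose (on_ob D j) ?h (\<iota> j) = ?\<kappa> j" "compose (on_ob D j) ?k (\<iota> j) = ?\<kappa> j"
      unfolding compose_def using \<iota>[OF that] by (auto intro!: restrict_ext)
  qed
  moreover have "?h \<in> c \<rightarrow>\<^sub>E {z, w}" "?k \<in> c \<rightarrow>\<^sub>E {z, w}" by auto
  moreover obtain m where "\<And>h. h \<in> c \<rightarrow>\<^sub>E {z, w} \<and> (\<forall>j\<in>Ob J. compose (on_ob D j) h (\<iota> j) = ?\<kappa> j) \<Longrightarrow> h = m"
    using ex1 by (elim ex1E) iprover
  ultimately have "?h = m" "?k = m" by blast+
  then have "?h y = ?k y" by simp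
  then show False using y zw by simp
qed

text \<open>The category of elements of \<open>F\<close> over \<open>L\<close>, with the maps coded in the universe; the arrows
  are reversed, since ultrapowers are contravariant in the ultrafilter.\<close>

definition elt_cat :: "'u endo \<Rightarrow> 'u set \<Rightarrow> ('u, 'u) cat" where
  "elt_cat F L =
     \<lparr>Ob = on_ob F L,
      Hom = (\<lambda>x y. enc (L \<rightarrow>\<^sub>E L) ` {f \<in> L \<rightarrow>\<^sub>E L. ap F L L f y = x}),
      Id = (\<lambda>x. enc (L \<rightarrow>\<^sub>E L) (\<lambda>a\<in>L. a)),
      Comp = (\<lambda>x y z g f. enc (L \<rightarrow>\<^sub>E L) (compose L (inv_into (L \<rightarrow>\<^sub>E L) (enc (L \<rightarrow>\<^sub>E L)) f)
        (inv_into (L \<rightarrow>\<^sub>E L) (enc (L \<rightarrow>\<^sub>E L)) g)))\<rparr>"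

text \<open>An arrow from \<open>x\<close> to \<open>y\<close> codes a map \<open>f\<close> with
  \<open>ap F L L f y = x\<close>. Its germ is an element of type \<open>tp F L x\<close> in the
  ultrapower of \<open>tp F L y\<close>, and the Yoneda map of this element is the
  transition.\<close>

definition elt_diagram :: "'u itself \<Rightarrow> 'u endo \<Rightarrow> 'u set \<Rightarrow> ('u, 'u, 'u endo, 'u set \<Rightarrow> 'u \<Rightarrow> 'u) ftor" where
  "elt_diagram u F L =
     \<lparr>on_ob = (\<lambda>x. upow u L (tp F L x)),
      on_hom = (\<lambda>x y f. yo u L (tp F L x) (upow u L (tp F L y))
        (elt L (tp F L y) L (inv_into (L \<rightarrow>\<^sub>E L) (enc (L \<rightarrow>\<^sub>E L)) f)))\<rparr>"

context
  fixes u :: "'u itself" and F :: "'u endo" and L :: "'u set"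
  assumes inacc: "inaccessible u" and F: "F \<in> Ob (FC u)" and L: "small u L"
begin

abbreviation (input) code :: "('u \<Rightarrow> 'u) \<Rightarrow> 'u" where "code \<equiv> enc (L \<rightarrow>\<^sub>E L)"
abbreviation (input) decode :: "'u \<Rightarrow> 'u \<Rightarrow> 'u" where "decode \<equiv> inv_into (L \<rightarrow>\<^sub>E L) (enc (L \<rightarrow>\<^sub>E L))"

lemma decode_code: "f \<in> L \<rightarrow>\<^sub>E L \<Longrightarrow> decode (code f) = f"
  by (rule inv_into_f_f[OF inj_enc[OF small_PiE[OF inacc L L]]])

lemma elt_cat_Hom_E:
  assumes "k \<in> Hom (elt_cat F L) x y"
  obtains f where "f \<in> L \<rightarrow>\<^sub>E L" "f \<in> L \<rightarrow> L" "ap F L L f y = x" "k = code f" "decode k = f"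
proof -
  obtain f where "f \<in> L \<rightarrow>\<^sub>E L" "ap F L L f y = x" "k = code f" using assms by (auto simp: elt_cat_def)
  then show thesis using decode_code by (intro that[of f]) auto
qed

lemma elt_cat_Ob [simp]: "Ob (elt_cat F L) = on_ob F L"
  by (simp add: elt_cat_def)

lemma elt_cat_Hom_I: "f \<in> L \<rightarrow>\<^sub>E L \<Longrightarrow> ap F L L f y = x \<Longrightarrow> code f \<in> Hom (elt_cat F L) x y"
  by (auto simp: elt_cat_def)

lemma elt_cat_Comp: "f \<in> L \<rightarrow>\<^sub>E L \<Longrightarrow> g \<in> L \<rightarrow>\<^sub>E L \<Longrightarrow>
    Comp (elt_cat F L) x y z (code g) (code f) = code (compose L f g)"
  by (simp add: elt_cat_def decode_code)

lemma elt_cat_Id: "Id (elt_cat F L) x = code (\<lambda>a\<in>L. a)"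
  by (simp add: elt_cat_def)

lemma small_category_elt_cat: "small_category u (elt_cat F L)"
  unfolding small_category_def category_def elt_cat_Ob elt_cat_Id
proof (intro conjI ballI)
  note E = FC_endofunctor[OF inacc F]
  show "small u (on_ob F L)" using E L by (rule small_on_ob)
  show "small u (Hom (elt_cat F L) x y)" for x y
    unfolding elt_cat_def by (auto intro: small_image small_subset[OF small_PiE[OF inacc L L]])
  fix x assume x: "x \<in> on_ob F L"
  show "code (\<lambda>a\<in>L. a) \<in> Hom (elt_cat F L) x x"
    by (rule elt_cat_Hom_I) (auto intro!: ap_ident[OF E L x])
  fix y k assume "k \<in> Hom (elt_cat F L) x y"
  then obtain f where f: "f \<in> L \<rightarrow>\<^sub>E L" "f \<in> L \<rightarrow> L" "ap F L L f y = x" "k = code f" "decode k = f"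
    by (rule elt_cat_Hom_E)
  have i: "(\<lambda>a\<in>L. a) \<in> L \<rightarrow>\<^sub>E L" by auto
  have "compose L f (\<lambda>a\<in>L. a) = f" "compose L (\<lambda>a\<in>L. a) f = f"
    using f(1,2) by (simp_all add: compose_Id Id_compose PiE_def)
  then show "Comp (elt_cat F L) x x y k (code (\<lambda>a\<in>L. a)) = k"
      "Comp (elt_cat F L) x y y (code (\<lambda>a\<in>L. a)) k = k"
    unfolding f(4) elt_cat_Comp[OF f(1) i] elt_cat_Comp[OF i f(1)] by simp_all
  fix z k' assume z: "z \<in> on_ob F L" and "k' \<in> Hom (elt_cat F L) y z"
  then obtain g where g: "g \<in> L \<rightarrow>\<^sub>E L" "g \<in> L \<rightarrow> L" "ap F L L g z = y" "k' = code g" "decode k' = g"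
    by (rule_tac elt_cat_Hom_E)
  have "ap F L L (compose L f g) z = ap F L L (\<lambda>a. f (g a)) z"
    by (rule ap_cong) (simp add: compose_def)
  also have "\<dots> = x" using ap_ap[OF E L L L g(2) f(2) z] f(3) g(3) by simp
  finally have *: "ap F L L (compose L f g) z = x" .
  have fg: "compose L f g \<in> L \<rightarrow>\<^sub>E L" using g(2) f(1) by (rule compose_PiE)
  show "Comp (elt_cat F L) x y z k' k \<in> Hom (elt_cat F L) x z"
    unfolding f(4) g(4) elt_cat_Comp[OF f(1) g(1)] using fg * by (rule elt_cat_Hom_I)
  fix w k'' assume "k'' \<in> Hom (elt_cat F L) z w"
  then obtain h where h: "h \<in> L \<rightarrow>\<^sub>E L" "h \<in> L \<rightarrow> L" "ap F L L h w = z" "k'' = code h" "decode k'' = h"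
    by (rule elt_cat_Hom_E)
  have gh: "compose L g h \<in> L \<rightarrow>\<^sub>E L" using h(2) g(1) by (rule compose_PiE)
  have "compose L f (compose L g h) = compose L (compose L f g) h"
    using h(2) by (rule compose_assoc)
  then show "Comp (elt_cat F L) x y w (Comp (elt_cat F L) y z w k'' k') k =
      Comp (elt_cat F L) x z w k'' (Comp (elt_cat F L) x y z k' k)"
    unfolding f(4) g(4) h(4) elt_cat_Comp[OF f(1) g(1)] elt_cat_Comp[OF g(1) h(1)]
      elt_cat_Comp[OF f(1) gh] elt_cat_Comp[OF fg h(1)] by simp
qed

lemma uf_tp: "x \<in> on_ob F L \<Longrightarrow> ultrafilter_on L (tp F L x)"
  using FC_partitive[OF inacc F] L by (rule ultrafilter_tp)

abbreviation (input) upw where "upw x \<equiv> upow u L (tp F L x)"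
abbreviation (input) elm where "elm x \<equiv> elt L (tp F L x)"

lemma upw_in: "x \<in> on_ob F L \<Longrightarrow> upw x \<in> Ob (FC u)"
  by (rule upow_in_FC[OF inacc L uf_tp])

lemma transition:
  assumes y: "y \<in> on_ob F L" and f: "f \<in> L \<rightarrow> L" and x: "ap F L L f y = x"
  shows "x \<in> on_ob F L" "yo u L (tp F L x) (upw y) (elm y L f) \<in> Hom (FC u) (upw x) (upw y)"
    "small u Z \<Longrightarrow> g \<in> L \<rightarrow> Z \<Longrightarrow> yo u L (tp F L x) (upw y) (elm y L f) Z (elm x Z g) = elm y Z (\<lambda>a. g (f a))"
proof -
  note P = FC_partitive[OF inacc F] and E = FC_endofunctor[OF inacc F]
  show x': "x \<in> on_ob F L" unfolding x[symmetric] using L L f y by (rule ap_in[OF E])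
  have e: "elm y L f \<in> on_ob (upw y) L" using elt_in[OF inacc L uf_tp[OF y] L f] .
  have t: "tp (upw y) L (elm y L f) = tp F L x"
    unfolding x[symmetric] tp_ap[OF P L L f y] by (rule tp_elt[OF inacc L uf_tp[OF y] L f])
  show "yo u L (tp F L x) (upw y) (elm y L f) \<in> Hom (FC u) (upw x) (upw y)"
    using yo_Hom[OF inacc L uf_tp[OF x'] upw_in[OF y] e t] .
  show "yo u L (tp F L x) (upw y) (elm y L f) Z (elm x Z g) = elm y Z (\<lambda>a. g (f a))"
    if "small u Z" "g \<in> L \<rightarrow> Z"
    using yo_elt[OF inacc L uf_tp[OF x'] upw_in[OF y] e t that] ap_elt[OF inacc L uf_tp[OF y] L that f] by simp
qed

lemma elt_diagram_functor: "is_functor (elt_cat F L) (FC u) (elt_diagram u F L)"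
  unfolding is_functor_def elt_cat_Ob elt_cat_Id elt_diagram_def ftor.simps
proof (intro conjI ballI)
  note E = FC_endofunctor[OF inacc F]
  have iL: "(\<lambda>a. a) \<in> L \<rightarrow> L" by simp
  fix x assume x: "x \<in> on_ob F L"
  show "upw x \<in> Ob (FC u)" using x by (rule upw_in)
  have i: "(\<lambda>a\<in>L. a) \<in> L \<rightarrow>\<^sub>E L" "(\<lambda>a\<in>L. a) \<in> L \<rightarrow> L" by auto
  have xi: "ap F L L (\<lambda>a\<in>L. a) x = x" by (rule ap_ident[OF E L x]) simp
  note id = transition[OF x i(2) xi]
  show "yo u L (tp F L x) (upw x) (elm x L (decode (code (\<lambda>a\<in>L. a)))) = Id (FC u) (upw x)"
    unfolding decode_code[OF i(1)]
  proof (rule Hom_upow_eqI[OF inacc L uf_tp[OF x] upw_in[OF x] id(2)])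
    show "Id (FC u) (upw x) \<in> Hom (FC u) (upw x) (upw x)" using category_FC upw_in[OF x] by (rule cat_Id)
    have eq: "elm x L (\<lambda>a\<in>L. a) = elm x L (\<lambda>a. a)"
      unfolding elt_eq_iff[OF inacc L uf_tp[OF x] L i(2) iL]
      by (rule uf_Collect_True[OF uf_tp[OF x]]) simp
    show "yo u L (tp F L x) (upw x) (elm x L (\<lambda>a\<in>L. a)) L (elm x L (\<lambda>a. a)) = Id (FC u) (upw x) L (elm x L (\<lambda>a. a))"
      by (rule trans[OF trans[OF id(3)[OF L iL] eq]
            FC_Id_apply[OF L elt_in[OF inacc L uf_tp[OF x] L iL], symmetric]])
  qed
next
  fix x y k assume x: "x \<in> on_ob F L" and y: "y \<in> on_ob F L" and "k \<in> Hom (elt_cat F L) x y"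
  then obtain f where f: "f \<in> L \<rightarrow>\<^sub>E L" "f \<in> L \<rightarrow> L" "ap F L L f y = x" "k = code f" "decode k = f"
    by (rule_tac elt_cat_Hom_E)
  show "yo u L (tp F L x) (upw y) (elm y L (decode k)) \<in> Hom (FC u) (upw x) (upw y)"
    unfolding f(5) using y f(2,3) by (rule transition)
next
  fix x y z k k' assume x: "x \<in> on_ob F L" and y: "y \<in> on_ob F L" and z: "z \<in> on_ob F L"
    and "k \<in> Hom (elt_cat F L) x y" and k': "k' \<in> Hom (elt_cat F L) y z"
  note E = FC_endofunctor[OF inacc F]
  have iL: "(\<lambda>a. a) \<in> L \<rightarrow> L" by simp
  obtain f where f: "f \<in> L \<rightarrow>\<^sub>E L" "f \<in> L \<rightarrow> L" "ap F L L f y = x" "k = code f" "decode k = f"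
    using \<open>k \<in> Hom (elt_cat F L) x y\<close> by (rule elt_cat_Hom_E)
  obtain g where g: "g \<in> L \<rightarrow>\<^sub>E L" "g \<in> L \<rightarrow> L" "ap F L L g z = y" "k' = code g" "decode k' = g"
    using k' by (rule elt_cat_Hom_E)
  have fg: "compose L f g \<in> L \<rightarrow>\<^sub>E L" using g(2) f(1) by (rule compose_PiE)
  then have fg': "compose L f g \<in> L \<rightarrow> L" by auto
  have gf: "(\<lambda>a. f (g a)) \<in> L \<rightarrow> L" using f g by auto
  have "ap F L L (compose L f g) z = ap F L L (\<lambda>a. f (g a)) z"
    by (rule ap_cong) (simp add: compose_def)
  also have "\<dots> = x" using ap_ap[OF E L L L g(2) f(2) z] f(3) g(3) by simp
  finally have *: "ap F L L (compose L f g) z = x" .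
  note tf = transition[OF y f(2,3)] and tg = transition[OF z g(2,3)] and tfg = transition[OF z fg' *]
  show "yo u L (tp F L x) (upw z) (elm z L (decode (Comp (elt_cat F L) x y z k' k))) =
      Comp (FC u) (upw x) (upw y) (upw z) (yo u L (tp F L y) (upw z) (elm z L (decode k')))
        (yo u L (tp F L x) (upw y) (elm y L (decode k)))"
    unfolding f(5) g(5) unfolding f(4) g(4) elt_cat_Comp[OF f(1) g(1)] decode_code[OF fg]
  proof (rule Hom_upow_eqI[OF inacc L uf_tp[OF x] upw_in[OF z] tfg(2)])
    show "Comp (FC u) (upw x) (upw y) (upw z) (yo u L (tp F L y) (upw z) (elm z L g)) (yo u L (tp F L x) (upw y) (elm y L f))
        \<in> Hom (FC u) (upw x) (upw z)"
      using category_FC upw_in[OF x] upw_in[OF y] upw_in[OF z] tf(2) tg(2) by (rule cat_Comp)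
    have "elm z L (compose L f g) = elm z L (\<lambda>a. f (g a))"
      unfolding elt_eq_iff[OF inacc L uf_tp[OF z] L fg' gf]
      by (rule uf_Collect_True[OF uf_tp[OF z]]) (simp add: compose_def)
    then show "yo u L (tp F L x) (upw z) (elm z L (compose L f g)) L (elm x L (\<lambda>a. a)) =
        Comp (FC u) (upw x) (upw y) (upw z) (yo u L (tp F L y) (upw z) (elm z L g)) (yo u L (tp F L x) (upw y) (elm y L f))
          L (elm x L (\<lambda>a. a))"
      using tfg(3)[OF L iL] tf(3)[OF L iL] tg(3)[OF L f(2)]
        FC_Comp_apply[OF L elt_in[OF inacc L uf_tp[OF x] L iL]] by simp
  qed
qed

text \<open>The density form of the Yoneda lemma, with elements taken over the single set
  \<open>L\<close>. By \<open>gen\<close> every element is some \<open>ap F L Z g x\<close>, where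
  the value of a factorisation is forced to be that of \<open>\<kappa> x\<close> at the germ of
  \<open>g\<close>; the content is that this value does not depend on the presentation
  (\<open>well\<close>).\<close>

lemma elt_diagram_colimit:
  assumes gen: "\<And>X. small u X \<Longrightarrow> on_ob F X \<subseteq> genby F L X"
  shows "is_colimit (elt_cat F L) (FC u) (elt_diagram u F L) F (\<lambda>x. yo u L (tp F L x) F x)"
proof -
  note P = FC_partitive[OF inacc F] and E = FC_endofunctor[OF inacc F]
  have iL: "(\<lambda>a. a) \<in> L \<rightarrow> L" by simp
  have \<iota>: "yo u L (tp F L x) F x \<in> Hom (FC u) (upw x) F" if "x \<in> on_ob F L" for x
    using yo_Hom[OF inacc L uf_tp[OF that] F that refl] .
  have \<iota>_elt: "yo u L (tp F L x) F x Z (elm x Z g) = ap F L Z g x"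
    if "x \<in> on_ob F L" "small u Z" "g \<in> L \<rightarrow> Z" for x Z g
    using yo_elt[OF inacc L uf_tp[OF that(1)] F that(1) refl that(2,3)] .
  have Dob: "on_ob (elt_diagram u F L) x = upw x" for x by (simp add: elt_diagram_def)
  have Dhom: "on_hom (elt_diagram u F L) x y k = yo u L (tp F L x) (upw y)
        (elm y L (inv_into (L \<rightarrow>\<^sub>E L) (enc (L \<rightarrow>\<^sub>E L)) k))" for x y k by (simp add: elt_diagram_def)
  show ?thesis
    unfolding is_colimit_def
  proof (intro conjI allI impI)
    show "is_cocone (elt_cat F L) (FC u) (elt_diagram u F L) F (\<lambda>x. yo u L (tp F L x) F x)"
      unfolding is_cocone_def elt_cat_Ob Dob Dhom
    proof (intro conjI ballI F \<iota>)
      fix x y k assume x: "x \<in> on_ob F L" and y: "y \<in> on_ob F L" and k: "k \<in> Hom (elt_cat F L) x y"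
      obtain f where f: "f \<in> L \<rightarrow>\<^sub>E L" "f \<in> L \<rightarrow> L" "ap F L L f y = x"
          "inv_into (L \<rightarrow>\<^sub>E L) (enc (L \<rightarrow>\<^sub>E L)) k = f"
        using k by (rule elt_cat_Hom_E)
      note t = transition[OF y f(2,3)]
      show "Comp (FC u) (upw x) (upw y) F (yo u L (tp F L y) F y) (yo u L (tp F L x) (upw y)
          (elm y L (inv_into (L \<rightarrow>\<^sub>E L) (enc (L \<rightarrow>\<^sub>E L)) k))) = yo u L (tp F L x) F x"
        unfolding f(4)
      proof (rule Hom_upow_eqI[OF inacc L uf_tp[OF x] F _ \<iota>[OF x]])
        show "Comp (FC u) (upw x) (upw y) F (yo u L (tp F L y) F y) (yo u L (tp F L x) (upw y) (elm y L f))
            \<in> Hom (FC u) (upw x) F"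
          using category_FC upw_in[OF x] upw_in[OF y] F t(2) \<iota>[OF y] by (rule cat_Comp)
        show "Comp (FC u) (upw x) (upw y) F (yo u L (tp F L y) F y) (yo u L (tp F L x) (upw y) (elm y L f))
            L (elm x L (\<lambda>a. a)) = yo u L (tp F L x) F x L (elm x L (\<lambda>a. a))"
          using t(3)[OF L iL] FC_Comp_apply[OF L elt_in[OF inacc L uf_tp[OF x] L iL]]
            \<iota>_elt[OF y L f(2)] yo_id[OF inacc L uf_tp[OF x] F x refl] f(3) by simp
      qed
    qed
    fix d \<kappa> assume cone: "is_cocone (elt_cat F L) (FC u) (elt_diagram u F L) d \<kappa>"
    have d: "d \<in> Ob (FC u)" and \<kappa>: "\<And>x. x \<in> on_ob F L \<Longrightarrow> \<kappa> x \<in> Hom (FC u) (upw x) d"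
      using cone unfolding is_cocone_def elt_cat_Ob Dob by blast+
    \<comment> \<open>The cocone law read on germs: changing the presentation along a self-map of
      \<open>L\<close> does not change the value.\<close>
    have \<kappa>_shift: "\<kappa> x Z (elm x Z g) = \<kappa> y Z (elm y Z (\<lambda>a. g (f a)))"
      if y: "y \<in> on_ob F L" and f: "f \<in> L \<rightarrow> L" and x: "ap F L L f y = x" and Z: "small u Z" and g: "g \<in> L \<rightarrow> Z"
      for x y f g Z
    proof -
      let ?f = "restrict f L"
      have f': "?f \<in> L \<rightarrow>\<^sub>E L" "?f \<in> L \<rightarrow> L" using f by auto
      have "ap F L L ?f y = ap F L L f y" by (rule ap_cong) simp
      then have x': "ap F L L ?f y = x" using x by simp
      note t = transition[OF y f'(2) x']
      have "Comp (FC u) (upw x) (upw y) d (\<kappa> y) (on_hom (elt_diagram u F L) x y (enc (L \<rightarrow>\<^sub>E L) ?f)) = \<kappa> x"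
        using cone elt_cat_Hom_I[OF f'(1) x'] t(1) y
        unfolding is_cocone_def elt_cat_Ob Dob by blast
      then have "\<kappa> x Z (elm x Z g) = \<kappa> y Z (yo u L (tp F L x) (upw y) (elm y L ?f) Z (elm x Z g))"
        unfolding Dhom decode_code[OF f'(1)]
        using FC_Comp_apply[OF Z elt_in[OF inacc L uf_tp[OF t(1)] Z g]] by metis
      also have "\<dots> = \<kappa> y Z (elm y Z (\<lambda>a. g (?f a)))" unfolding t(3)[OF Z g] ..
      also have "elm y Z (\<lambda>a. g (?f a)) = elm y Z (\<lambda>a. g (f a))"
        by (subst elt_eq_iff[OF inacc L uf_tp[OF y] Z]) (use f f'(2) g uf_top[OF uf_tp[OF y]] in auto)
      finally show ?thesis .
    qed
    have well: "\<kappa> x Z (elm x Z g) = \<kappa> x' Z (elm x' Z g')"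
      if x: "x \<in> on_ob F L" "x' \<in> on_ob F L" and Z: "small u Z" and g: "g \<in> L \<rightarrow> Z" "g' \<in> L \<rightarrow> Z"
        and eq: "ap F L Z g x = ap F L Z g' x'" for x x' Z g g'
    proof -
      let ?y = "ap F L Z g x"
      obtain l where l: "l \<in> L" using inhabited[OF P x(1)] by blast
      \<comment> \<open>The section \<open>r\<close> of \<open>g\<close> on its image pulls
        \<open>?y\<close> back to an element \<open>w\<close> over \<open>L\<close>. Any
        presentation \<open>(k, v)\<close> of \<open>?y\<close> is linked to \<open>(g, w)\<close>
        by the self-map sending \<open>a\<close> to \<open>r (k a)\<close>, so both given
        presentations have the value of \<open>(g, w)\<close>.\<close>
      define r where "r b = (if b \<in> g ` L then inv_into L g b else l)" for b
      have r: "r \<in> Z \<rightarrow> L" using l by (auto simp: r_def inv_into_into)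
      have gr: "g (r b) = b" if "b \<in> g ` L" for b using that by (simp add: r_def f_inv_into_f)
      define w where "w = ap F Z L r ?y"
      have yF: "?y \<in> on_ob F Z" using L Z g(1) x(1) by (rule ap_in[OF E])
      have w: "w \<in> on_ob F L" unfolding w_def using Z L r yF by (rule ap_in[OF E])
      have step: "\<kappa> w Z (elm w Z g) = \<kappa> v Z (elm v Z k)"
        if v: "v \<in> on_ob F L" and k: "k \<in> L \<rightarrow> Z" and vy: "ap F L Z k v = ?y" for v k
      proof -
        have rk: "(\<lambda>a. r (k a)) \<in> L \<rightarrow> L" and grk: "(\<lambda>a. g (r (k a))) \<in> L \<rightarrow> Z" using r k g by auto
        have "ap F L L (\<lambda>a. r (k a)) v = w"
          unfolding w_def vy[symmetric] using L Z L k r v by (rule ap_ap[OF E, symmetric])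
        from \<kappa>_shift[OF v rk this Z g(1)]
        have "\<kappa> w Z (elm w Z g) = \<kappa> v Z (elm v Z (\<lambda>a. g (r (k a))))" .
        also have "elm v Z (\<lambda>a. g (r (k a))) = elm v Z k"
          unfolding elt_eq_iff[OF inacc L uf_tp[OF v] Z grk k]
        proof -
          \<comment> \<open>The equation \<open>g (r (k a)) = k a\<close> holds wherever
            \<open>k a\<close> lies in the image of \<open>g\<close>, and that is almost everywhere
            along the type of \<open>v\<close>.\<close>
          have "g ` L \<in> tp F Z ?y"
            by (rule tp_image[OF P L Z g(1) x(1)]) (use g(1) in auto)
          then have "g ` L \<in> push L Z k (tp F L v)"
            unfolding vy[symmetric] tp_ap[OF P L Z k v] .
          then have "{a\<in>L. k a \<in> g ` L} \<in> tp F L v" by (simp add: push_def)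
          then show "{a\<in>L. g (r (k a)) = k a} \<in> tp F L v"
            by (rule uf_Collect_mono[OF uf_tp[OF v]]) (rule gr)
        qed
        finally show ?thesis .
      qed
      show ?thesis using step[OF x(1) g(1) refl] step[OF x(2) g(2) eq[symmetric]] by simp
    qed
    define h where "h Z y = (let p = SOME p. fst p \<in> L \<rightarrow> Z \<and> snd p \<in> on_ob F L \<and> y = ap F L Z (fst p) (snd p)
        in \<kappa> (snd p) Z (elm (snd p) Z (fst p)))" for Z y
    have h: "h Z (ap F L Z g x) = \<kappa> x Z (elm x Z g)"
      if x: "x \<in> on_ob F L" and Z: "small u Z" and g: "g \<in> L \<rightarrow> Z" for x Z g
    proof -
      let ?Q = "\<lambda>p. fst p \<in> L \<rightarrow> Z \<and> snd p \<in> on_ob F L \<and> ap F L Z g x = ap F L Z (fst p) (snd p)"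
      have "?Q (SOME p. ?Q p)" by (rule someI[of ?Q "(g, x)"]) (use x g in simp)
      then show ?thesis unfolding h_def Let_def using x Z g by (intro well) auto
    qed
    have cov: "\<exists>g x. g \<in> L \<rightarrow> Z \<and> x \<in> on_ob F L \<and> y = ap F L Z g x" if "small u Z" "y \<in> on_ob F Z" for Z y
      using gen[OF that(1)] that(2) unfolding genby_def by blast
    let ?h = "mk_nat u F h"
    have hHom: "?h \<in> Hom (FC u) F d"
    proof (rule mk_nat_in[OF inacc F d])
      fix Z y assume Z: "small u Z" and y: "y \<in> on_ob F Z"
      obtain g x where g: "g \<in> L \<rightarrow> Z" and x: "x \<in> on_ob F L" and yg: "y = ap F L Z g x"
        using cov[OF Z y] by blast
      note el = elt_in[OF inacc L uf_tp[OF x] Z g]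
      show "h Z y \<in> on_ob d Z"
        unfolding yg h[OF x Z g] using FC_Hom_in[OF inacc upw_in[OF x] d \<kappa>[OF x] Z el] .
      fix Z' :: "'u set" and f assume Z': "small u Z'" and f: "f \<in> Z \<rightarrow> Z'"
      have fg: "(\<lambda>a. f (g a)) \<in> L \<rightarrow> Z'" using f g by auto
      show "h Z' (ap F Z Z' f y) = ap d Z Z' f (h Z y)"
        unfolding yg h[OF x Z g] ap_ap[OF E L Z Z' g f x] h[OF x Z' fg]
        using FC_Hom_ap[OF inacc upw_in[OF x] d \<kappa>[OF x] Z Z' f el] ap_elt[OF inacc L uf_tp[OF x] Z Z' f g] by simp
    qed
    have fac: "Comp (FC u) (upw x) F d K (yo u L (tp F L x) F x) = \<kappa> x \<longleftrightarrow>
        (\<forall>Z g. small u Z \<longrightarrow> g \<in> L \<rightarrow> Z \<longrightarrow> K Z (ap F L Z g x) = \<kappa> x Z (elm x Z g))"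
      if K: "K \<in> Hom (FC u) F d" and x: "x \<in> on_ob F L" for K x
    proof
      assume eq: "Comp (FC u) (upw x) F d K (yo u L (tp F L x) F x) = \<kappa> x"
      show "\<forall>Z g. small u Z \<longrightarrow> g \<in> L \<rightarrow> Z \<longrightarrow> K Z (ap F L Z g x) = \<kappa> x Z (elm x Z g)"
        unfolding eq[symmetric] using FC_Comp_apply elt_in[OF inacc L uf_tp[OF x]] \<iota>_elt[OF x] by metis
    next
      assume *: "\<forall>Z g. small u Z \<longrightarrow> g \<in> L \<rightarrow> Z \<longrightarrow> K Z (ap F L Z g x) = \<kappa> x Z (elm x Z g)"
      show "Comp (FC u) (upw x) F d K (yo u L (tp F L x) F x) = \<kappa> x"
      proof (rule Hom_upow_eqI[OF inacc L uf_tp[OF x] d _ \<kappa>[OF x]])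
        show "Comp (FC u) (upw x) F d K (yo u L (tp F L x) F x) \<in> Hom (FC u) (upw x) d"
          using category_FC upw_in[OF x] F d \<iota>[OF x] K by (rule cat_Comp)
        show "Comp (FC u) (upw x) F d K (yo u L (tp F L x) F x) L (elm x L (\<lambda>a. a)) = \<kappa> x L (elm x L (\<lambda>a. a))"
          using *[rule_format, OF L iL] FC_Comp_apply[OF L elt_in[OF inacc L uf_tp[OF x] L iL]] \<iota>_elt[OF x L iL]
          by simp
      qed
    qed
    show "\<exists>!K. K \<in> Hom (FC u) F d \<and> (\<forall>x\<in>Ob (elt_cat F L).
        Comp (FC u) (on_ob (elt_diagram u F L) x) F d K (yo u L (tp F L x) F x) = \<kappa> x)"
      unfolding elt_cat_Ob Dob
    proof (rule ex1I[of _ ?h], intro conjI ballI hHom)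
      fix x assume x: "x \<in> on_ob F L"
      show "Comp (FC u) (upw x) F d ?h (yo u L (tp F L x) F x) = \<kappa> x"
        unfolding fac[OF hHom x]
      proof (intro allI impI)
        fix Z :: "'u set" and g assume Z: "small u Z" and g: "g \<in> L \<rightarrow> Z"
        show "?h Z (ap F L Z g x) = \<kappa> x Z (elm x Z g)"
          using h[OF x Z g] ap_in[OF E L Z g x] Z by simp
      qed
    next
      fix K assume K: "K \<in> Hom (FC u) F d \<and>
        (\<forall>x\<in>on_ob F L. Comp (FC u) (upw x) F d K (yo u L (tp F L x) F x) = \<kappa> x)"
      show "K = ?h"
      proof (rule FC_Hom_eqI[OF inacc F d _ hHom])
        show "K \<in> Hom (FC u) F d" using K by blast
        fix Z y assume Z: "small u Z" and y: "y \<in> on_ob F Z"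
        obtain g x where g: "g \<in> L \<rightarrow> Z" and x: "x \<in> on_ob F L" and yg: "y = ap F L Z g x"
          using cov[OF Z y] by blast
        have "K Z y = \<kappa> x Z (elm x Z g)" using fac[of K x] K x Z g unfolding yg by blast
        then show "K Z y = ?h Z y" using h[OF x Z g] Z y unfolding yg by simp
      qed
    qed
  qed
qed

end

lemma small_projective_is_upow:
  fixes u :: "'u itself"
  assumes inacc: "inaccessible u" and F: "F \<in> Ob (FC u)" and sp: "small_projective u (FC u) F"
  obtains L \<U> \<phi> where "small u L" "ultrafilter_on L \<U>" "is_iso (FC u) (upow u L \<U>) F \<phi>"
proof -
  have hf: "is_functor (FC u) (set_cat u) (hom_ftor (FC u) F)"
    and pres: "preserves_small_colimits u (FC u) (set_cat u) (hom_ftor (FC u) F)"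
    using sp by (simp_all add: small_projective_def)
  have "small u (Hom (FC u) F G)" if "G \<in> Ob (FC u)" for G
    using hf that by (simp add: is_functor_def)
  from FC_bounded[OF inacc F this] obtain L where L: "small u L"
    and gen: "\<And>Y. small u Y \<Longrightarrow> on_ob F Y \<subseteq> genby F L Y" by blast
  let ?J = "elt_cat F L" and ?D = "elt_diagram u F L" and ?\<iota> = "\<lambda>x. yo u L (tp F L x) F x"
  note cat = category_FC[of u]
  note DF = elt_diagram_functor[OF inacc F L]
  have Dob: "on_ob ?D x = upow u L (tp F L x)" for x by (simp add: elt_diagram_def)
  have col: "is_colimit ?J (set_cat u) (comp_ftor (hom_ftor (FC u) F) ?D) (Hom (FC u) F F)
      (\<lambda>x. on_hom (hom_ftor (FC u) F) (on_ob ?D x) F (?\<iota> x))"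
    using pres small_category_elt_cat[OF inacc F L] DF elt_diagram_colimit[OF inacc F L gen]
    unfolding preserves_small_colimits_def hom_ftor_simps by blast
  obtain z w :: 'u where zw: "z \<noteq> w"
    using univ_two_elements[OF inacc] by blast
  \<comment> \<open>Hom-sets have elements of the arrow type, so joint surjectivity needs two
    distinct elements of that type.\<close>
  have ne: "(\<lambda>(_ :: 'u set) (_ :: 'u). z) \<noteq> (\<lambda>_ _. w)" using zw by (simp add: fun_eq_iff)
  have idF: "Id (FC u) F \<in> Hom (FC u) F F" using cat F by (rule cat_Id)
  obtain x s where x: "x \<in> on_ob F L" and s: "s \<in> Hom (FC u) F (upow u L (tp F L x))"
    and eq: "Id (FC u) F = Comp (FC u) F (upow u L (tp F L x)) F (?\<iota> x) s"
    using set_colimit_jointly_surjective[OF inacc ne is_functor_comp[OF DF hf] col idF]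
    by (auto simp: comp_ftor_def Dob elt_cat_Ob[OF inacc F L])
  let ?U = "tp F L x" let ?y = "upow u L ?U"
  have uf: "ultrafilter_on L ?U" using inacc F L x by (rule uf_tp)
  have iL: "(\<lambda>a. a) \<in> L \<rightarrow> L" by simp
  note yin = upow_in_FC[OF inacc L uf]
  have \<iota>: "?\<iota> x \<in> Hom (FC u) ?y F" using yo_Hom[OF inacc L uf F x refl] .
  \<comment> \<open>\<open>eq\<close> is one of the two identities of an isomorphism. For the other,
    the composite on the ultrapower is given by a self-map \<open>g\<close> of \<open>L\<close>, and
    preservation of types says that \<open>g\<close> preserves the ultrafilter.\<close>
  have c: "Comp (FC u) ?y F ?y s (?\<iota> x) \<in> Hom (FC u) ?y ?y"
    using cat yin F yin \<iota> s by (rule cat_Comp)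
  let ?e = "elt L ?U L (\<lambda>a. a)"
  note ce = Hom_upow_elt[OF inacc L uf yin c]
  obtain g where g: "g \<in> L \<rightarrow> L" "Comp (FC u) ?y F ?y s (?\<iota> x) L ?e = elt L ?U L g"
    using elt_cases[OF inacc L uf L ce(1)] by blast
  have "push L L g ?U = ?U" using ce(2) tp_elt[OF inacc L uf L g(1)] g(2) by simp
  then have "{a\<in>L. g a = a} \<in> ?U" by (rule uf_endomorphism_identity[OF uf])
  then have "elt L ?U L g = ?e" using elt_eq_iff[OF inacc L uf L g(1) iL] by simp
  then have "Comp (FC u) ?y F ?y s (?\<iota> x) = Id (FC u) ?y"
    using g(2) FC_Id_apply[OF L elt_in[OF inacc L uf L iL]]
    by (intro Hom_upow_eqI[OF inacc L uf yin c cat_Id[OF cat yin]]) simp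
  then have "is_iso (FC u) ?y F (?\<iota> x)"
    unfolding is_iso_def using \<iota> s eq by auto
  with L uf show thesis by (rule that)
qed

section \<open>Fully faithful and essentially surjective functors\<close>

text \<open>The inverse chooses preimages of objects up to isomorphism and lifts the conjugate
  \<open>m\<close> of an arrow by the chosen isomorphisms. Equations in \<open>C\<close> are checked
  after applying the faithful functor \<open>F\<close>; the main tool is \<open>em\<close>, the
  naturality of \<open>e\<close>.\<close>

lemma equivalent_categoriesI:
  fixes C :: "('o, 'a) cat" and D :: "('p, 'b) cat"
  assumes C: "category C" and D: "category D" and F: "is_functor C D F"
    and ff: "\<And>x y. x \<in> Ob C \<Longrightarrow> y \<in> Ob C \<Longrightarrow> bij_betw (on_hom F x y) (Hom C x y) (Hom D (on_ob F x) (on_ob F y))"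
    and eso: "\<And>d. d \<in> Ob D \<Longrightarrow> \<exists>x\<in>Ob C. \<exists>\<phi>. is_iso D (on_ob F x) d \<phi>"
  shows "equivalent_categories C D"
proof -
  let ?F = "on_ob F"
  have Fo: "?F x \<in> Ob D" if "x \<in> Ob C" for x using F that by (simp add: is_functor_def)
  have Fh: "on_hom F x y f \<in> Hom D (?F x) (?F y)" if "x \<in> Ob C" "y \<in> Ob C" "f \<in> Hom C x y" for x y f
    using F that by (simp add: is_functor_def)
  have Fid: "on_hom F x x (Id C x) = Id D (?F x)" if "x \<in> Ob C" for x
    using F that by (simp add: is_functor_def)
  have Fcomp: "on_hom F x z (Comp C x y z g f) = Comp D (?F x) (?F y) (?F z) (on_hom F y z g) (on_hom F x y f)"
    if "x \<in> Ob C" "y \<in> Ob C" "z \<in> Ob C" "f \<in> Hom C x y" "g \<in> Hom C y z" for x y z f g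
    using F that by (simp add: is_functor_def)
  have Finj: "f = g" if "x \<in> Ob C" "y \<in> Ob C" "f \<in> Hom C x y" "g \<in> Hom C x y" "on_hom F x y f = on_hom F x y g" for x y f g
    using ff[OF that(1,2)] that(3-) by (auto simp: bij_betw_def inj_on_def)
  define pre where "pre x y = inv_into (Hom C x y) (on_hom F x y)" for x y
  have pre: "pre x y g \<in> Hom C x y" "on_hom F x y (pre x y g) = g"
    if "x \<in> Ob C" "y \<in> Ob C" "g \<in> Hom D (?F x) (?F y)" for x y g
  proof -
    have "g \<in> on_hom F x y ` Hom C x y" using ff[OF that(1,2)] that(3) by (simp add: bij_betw_def)
    then show "pre x y g \<in> Hom C x y" "on_hom F x y (pre x y g) = g"
      unfolding pre_def by (auto intro: inv_into_into f_inv_into_f)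
  qed
  have "\<forall>d\<in>Ob D. \<exists>x e i. x \<in> Ob C \<and> e \<in> Hom D (?F x) d \<and> i \<in> Hom D d (?F x) \<and>
      Comp D (?F x) d (?F x) i e = Id D (?F x) \<and> Comp D d (?F x) d e i = Id D d"
    using eso unfolding is_iso_def by blast
  then obtain r e i where rei: "\<forall>d\<in>Ob D. r d \<in> Ob C \<and> e d \<in> Hom D (?F (r d)) d \<and> i d \<in> Hom D d (?F (r d)) \<and>
      Comp D (?F (r d)) d (?F (r d)) (i d) (e d) = Id D (?F (r d)) \<and> Comp D d (?F (r d)) d (e d) (i d) = Id D d"
    by metis
  have r: "r d \<in> Ob C" and e: "e d \<in> Hom D (?F (r d)) d" and i: "i d \<in> Hom D d (?F (r d))"
    and ie: "Comp D (?F (r d)) d (?F (r d)) (i d) (e d) = Id D (?F (r d))"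
    and ei: "Comp D d (?F (r d)) d (e d) (i d) = Id D d" if "d \<in> Ob D" for d
    using rei that by blast+
  have Fr: "?F (r d) \<in> Ob D" if "d \<in> Ob D" for d using Fo r that by blast
  define m where "m d d' f = Comp D (?F (r d)) d' (?F (r d')) (i d') (Comp D (?F (r d)) d d' f (e d))" for d d' f
  have fe: "Comp D (?F (r d)) d d' f (e d) \<in> Hom D (?F (r d)) d'"
    if "d \<in> Ob D" "d' \<in> Ob D" "f \<in> Hom D d d'" for d d' f
    using D Fr[OF that(1)] that(1,2) e[OF that(1)] that(3) by (rule cat_Comp)
  have m: "m d d' f \<in> Hom D (?F (r d)) (?F (r d'))" if "d \<in> Ob D" "d' \<in> Ob D" "f \<in> Hom D d d'" for d d' f
    unfolding m_def using D Fr[OF that(1)] that(2) Fr[OF that(2)] fe[OF that] i[OF that(2)] by (rule cat_Comp)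
  have em: "Comp D (?F (r d)) (?F (r d')) d' (e d') (m d d' f) = Comp D (?F (r d)) d d' f (e d)"
    if d: "d \<in> Ob D" "d' \<in> Ob D" and f: "f \<in> Hom D d d'" for d d' f
    unfolding m_def cat_assoc[OF D Fr[OF d(1)] d(2) Fr[OF d(2)] d(2) fe[OF d f] i[OF d(2)] e[OF d(2)], symmetric]
      ei[OF d(2)] using D Fr[OF d(1)] d(2) fe[OF d f] by (rule cat_Id_left)
  define G where "G = \<lparr>on_ob = r, on_hom = (\<lambda>d d' f. pre (r d) (r d') (m d d' f))\<rparr>"
  have Gh: "on_hom G d d' f \<in> Hom C (r d) (r d')" "on_hom F (r d) (r d') (on_hom G d d' f) = m d d' f"
    if "d \<in> Ob D" "d' \<in> Ob D" "f \<in> Hom D d d'" for d d' f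
    using pre[OF r[OF that(1)] r[OF that(2)] m[OF that]] by (simp_all add: G_def)
  have Go: "on_ob G = r" by (simp add: G_def)
  have GF: "is_functor D C G"
    unfolding is_functor_def Go
  proof (intro conjI ballI)
    fix d assume d: "d \<in> Ob D"
    show "r d \<in> Ob C" using d by (rule r)
    have idd: "Id D d \<in> Hom D d d" using D d by (rule cat_Id)
    have "m d d (Id D d) = Id D (?F (r d))"
      unfolding m_def cat_Id_left[OF D Fr[OF d] d e[OF d]] using ie[OF d] .
    then have "on_hom F (r d) (r d) (on_hom G d d (Id D d)) = on_hom F (r d) (r d) (Id C (r d))"
      using Gh(2)[OF d d idd] Fid[OF r[OF d]] by simp
    then show "on_hom G d d (Id D d) = Id C (r d)"
      by (rule Finj[OF r[OF d] r[OF d] Gh(1)[OF d d idd] cat_Id[OF C r[OF d]]])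
  next
    fix d d' f assume "d \<in> Ob D" "d' \<in> Ob D" "f \<in> Hom D d d'"
    then show "on_hom G d d' f \<in> Hom C (r d) (r d')" by (rule Gh)
  next
    fix x y z f g assume x: "x \<in> Ob D" and y: "y \<in> Ob D" and z: "z \<in> Ob D"
      and f: "f \<in> Hom D x y" and g: "g \<in> Hom D y z"
    have gf: "Comp D x y z g f \<in> Hom D x z" using D x y z f g by (rule cat_Comp)
    have "Comp D (?F (r x)) (?F (r y)) (?F (r z)) (m y z g) (m x y f) =
        Comp D (?F (r x)) z (?F (r z)) (i z)
          (Comp D (?F (r x)) (?F (r y)) z (Comp D (?F (r y)) y z g (e y)) (m x y f))"
      unfolding m_def[of y z] using D Fr[OF x] Fr[OF y] z Fr[OF z] m[OF x y f] fe[OF y z g] i[OF z] by (rule cat_assoc)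
    also have "Comp D (?F (r x)) (?F (r y)) z (Comp D (?F (r y)) y z g (e y)) (m x y f) =
        Comp D (?F (r x)) y z g (Comp D (?F (r x)) (?F (r y)) y (e y) (m x y f))"
      using D Fr[OF x] Fr[OF y] y z m[OF x y f] e[OF y] g by (rule cat_assoc)
    also have "\<dots> = Comp D (?F (r x)) y z g (Comp D (?F (r x)) x y f (e x))"
      unfolding em[OF x y f] ..
    also have "\<dots> = Comp D (?F (r x)) x z (Comp D x y z g f) (e x)"
      using D Fr[OF x] x y z e[OF x] f g by (rule cat_assoc[symmetric])
    finally have mm: "m x z (Comp D x y z g f) = Comp D (?F (r x)) (?F (r y)) (?F (r z)) (m y z g) (m x y f)"
      unfolding m_def[of x z] by simp
    show "on_hom G x z (Comp D x y z g f) = Comp C (r x) (r y) (r z) (on_hom G y z g) (on_hom G x y f)"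
    proof (rule Finj[OF r[OF x] r[OF z] Gh(1)[OF x z gf]])
      show "Comp C (r x) (r y) (r z) (on_hom G y z g) (on_hom G x y f) \<in> Hom C (r x) (r z)"
        using C r[OF x] r[OF y] r[OF z] Gh(1)[OF x y f] Gh(1)[OF y z g] by (rule cat_Comp)
      show "on_hom F (r x) (r z) (on_hom G x z (Comp D x y z g f)) =
          on_hom F (r x) (r z) (Comp C (r x) (r y) (r z) (on_hom G y z g) (on_hom G x y f))"
        unfolding Fcomp[OF r[OF x] r[OF y] r[OF z] Gh(1)[OF x y f] Gh(1)[OF y z g]]
          Gh(2)[OF x y f] Gh(2)[OF y z g] Gh(2)[OF x z gf] by (rule mm)
    qed
  qed
  have ni_D: "nat_isomorphic D D (comp_ftor F G) id_ftor"
    unfolding nat_isomorphic_def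
  proof (intro bexI[of _ "\<lambda>d\<in>Ob D. e d"] ballI)
    fix d assume d: "d \<in> Ob D"
    show "is_iso D (on_ob (comp_ftor F G) d) (on_ob id_ftor d) ((\<lambda>d\<in>Ob D. e d) d)"
      using d e[OF d] i[OF d] ie[OF d] ei[OF d] unfolding is_iso_def by (auto simp: comp_ftor_def id_ftor_def Go)
  next
    show "(\<lambda>d\<in>Ob D. e d) \<in> nat_trans D D (comp_ftor F G) id_ftor"
      unfolding nat_trans_def using e Gh(2) em by (simp add: comp_ftor_def id_ftor_def Go)
  qed
  define \<eta> where "\<eta> x = pre (r (?F x)) x (e (?F x))" for x
  have \<eta>: "\<eta> x \<in> Hom C (r (?F x)) x" "on_hom F (r (?F x)) x (\<eta> x) = e (?F x)" if "x \<in> Ob C" for x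
    unfolding \<eta>_def using pre[OF r[OF Fo[OF that]] that e[OF Fo[OF that]]] by simp_all
  have ni_C: "nat_isomorphic C C (comp_ftor G F) id_ftor"
    unfolding nat_isomorphic_def
  proof (intro bexI[of _ "\<lambda>x\<in>Ob C. \<eta> x"] ballI)
    fix x assume x: "x \<in> Ob C"
    note Fx = Fo[OF x] and rx = r[OF Fo[OF x]]
    let ?j = "pre x (r (?F x)) (i (?F x))"
    note j = pre[OF x rx i[OF Fx]]
    have "Comp C (r (?F x)) x (r (?F x)) ?j (\<eta> x) = Id C (r (?F x))"
    proof (rule Finj[OF rx rx cat_Comp[OF C rx x rx \<eta>(1)[OF x] j(1)] cat_Id[OF C rx]])
      show "on_hom F (r (?F x)) (r (?F x)) (Comp C (r (?F x)) x (r (?F x)) ?j (\<eta> x)) =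
          on_hom F (r (?F x)) (r (?F x)) (Id C (r (?F x)))"
        unfolding Fcomp[OF rx x rx \<eta>(1)[OF x] j(1)] Fid[OF rx] \<eta>(2)[OF x] j(2) by (rule ie[OF Fx])
    qed
    moreover have "Comp C x (r (?F x)) x (\<eta> x) ?j = Id C x"
    proof (rule Finj[OF x x cat_Comp[OF C x rx x j(1) \<eta>(1)[OF x]] cat_Id[OF C x]])
      show "on_hom F x x (Comp C x (r (?F x)) x (\<eta> x) ?j) = on_hom F x x (Id C x)"
        unfolding Fcomp[OF x rx x j(1) \<eta>(1)[OF x]] Fid[OF x] \<eta>(2)[OF x] j(2) by (rule ei[OF Fx])
    qed
    ultimately show "is_iso C (on_ob (comp_ftor G F) x) (on_ob id_ftor x) ((\<lambda>x\<in>Ob C. \<eta> x) x)"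
      using x \<eta>(1)[OF x] j(1) unfolding is_iso_def by (auto simp: comp_ftor_def id_ftor_def Go)
  next
    have "Comp C (r (?F x)) (r (?F y)) y (\<eta> y) (on_hom G (?F x) (?F y) (on_hom F x y f)) =
        Comp C (r (?F x)) x y f (\<eta> x)"
      if x: "x \<in> Ob C" and y: "y \<in> Ob C" and f: "f \<in> Hom C x y" for x y f
    proof -
      note Fx = Fo[OF x] and rx = r[OF Fo[OF x]] and Fy = Fo[OF y] and ry = r[OF Fo[OF y]]
      note g = Gh[OF Fx Fy Fh[OF x y f]]
      show ?thesis
      proof (rule Finj[OF rx y cat_Comp[OF C rx ry y g(1) \<eta>(1)[OF y]] cat_Comp[OF C rx x y \<eta>(1)[OF x] f]])
        show "on_hom F (r (?F x)) y (Comp C (r (?F x)) (r (?F y)) y (\<eta> y) (on_hom G (?F x) (?F y) (on_hom F x y f))) =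
            on_hom F (r (?F x)) y (Comp C (r (?F x)) x y f (\<eta> x))"
          unfolding Fcomp[OF rx ry y g(1) \<eta>(1)[OF y]] Fcomp[OF rx x y \<eta>(1)[OF x] f] g(2) \<eta>(2)[OF x] \<eta>(2)[OF y]
          by (rule em[OF Fx Fy Fh[OF x y f]])
      qed
    qed
    then show "(\<lambda>x\<in>Ob C. \<eta> x) \<in> nat_trans C C (comp_ftor G F) id_ftor"
      unfolding nat_trans_def using \<eta>(1) by (simp add: comp_ftor_def id_ftor_def Go)
  qed
  show ?thesis
    unfolding equivalent_categories_def using C D F GF ni_C ni_D by blast
qed

section \<open>Morphisms of ultrafilters\<close>

text \<open>The total continuous maps. Every morphism of \<open>UF\<close> has such a
  representative, because a set that carries an ultrafilter is inhabited.\<close>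

definition cmap :: "'x set \<Rightarrow> 'x set set \<Rightarrow> 'x set \<Rightarrow> 'x set set \<Rightarrow> ('x \<Rightarrow> 'x) set" where
  "cmap X \<U> Y \<V> = {g \<in> X \<rightarrow> Y. push X Y g \<U> = \<V>}"

text \<open>The equivalence class of \<open>g\<close> in \<open>UF\<close>, described without
  continuity: a partial map that agrees almost everywhere with a continuous one is itself
  continuous.\<close>

definition pgerm :: "'x set \<Rightarrow> 'x set set \<Rightarrow> 'x set \<Rightarrow> ('x \<Rightarrow> 'x) \<Rightarrow> ('x \<rightharpoonup> 'x) set" where
  "pgerm X \<U> Y g = {f. dom f \<subseteq> X \<and> ran f \<subseteq> Y \<and> {x\<in>X. f x = Some (g x)} \<in> \<U>}"

context
  fixes X Y :: "'x set" and \<U> \<V> :: "'x set set"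
  assumes U: "ultrafilter_on X \<U>" and V: "ultrafilter_on Y \<V>"
begin

lemma pgerm_continuous:
  assumes g: "g \<in> cmap X \<U> Y \<V>" and f: "f \<in> pgerm X \<U> Y g"
  shows "f \<in> partial_continuous (X, \<U>) (Y, \<V>)"
  unfolding partial_continuous_def prod.case
proof (intro CollectI conjI ballI)
  have fX: "dom f \<subseteq> X" and eq: "{x\<in>X. f x = Some (g x)} \<in> \<U>" using f by (simp_all add: pgerm_def)
  show "ran f \<subseteq> Y" using f by (simp add: pgerm_def)
  show "dom f \<in> \<U>" by (rule uf_mono[OF U eq _ fX]) auto
  fix B assume "B \<in> Pow Y"
  then have "B \<in> \<V> \<longleftrightarrow> {x\<in>X. g x \<in> B} \<in> \<U>" using g by (auto simp: cmap_def push_def)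
  also have "\<dots> \<longleftrightarrow> {x\<in>X. \<exists>y\<in>B. f x = Some y} \<in> \<U>"
    by (intro iffI; erule uf_Collect_conj[OF U _ eq]) auto
  also have "{x\<in>X. \<exists>y\<in>B. f x = Some y} = {x. \<exists>y\<in>B. f x = Some y}" using fX by auto
  finally show "B \<in> \<V> \<longleftrightarrow> {x. \<exists>y\<in>B. f x = Some y} \<in> \<U>" .
qed

lemma uf_eq_class:
  assumes g: "g \<in> cmap X \<U> Y \<V>" and f: "f \<in> pgerm X \<U> Y g"
  shows "uf_eq (X, \<U>) (Y, \<V>) `` {f} = pgerm X \<U> Y g"
proof (intro equalityI subsetI)
  have fX: "dom f \<subseteq> X" and eq: "{x\<in>X. f x = Some (g x)} \<in> \<U>" using f by (simp_all add: pgerm_def)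
  fix k assume "k \<in> uf_eq (X, \<U>) (Y, \<V>) `` {f}"
  then have k: "k \<in> partial_continuous (X, \<U>) (Y, \<V>)" and e: "{x. \<exists>y. f x = Some y \<and> k x = Some y} \<in> \<U>"
    by (auto simp: uf_eq_def)
  have "{x. \<exists>y. f x = Some y \<and> k x = Some y} = {x\<in>X. \<exists>y. f x = Some y \<and> k x = Some y}" using fX by auto
  then have "{x\<in>X. \<exists>y. f x = Some y \<and> k x = Some y} \<in> \<U>" using e by simp
  from this eq have "{x\<in>X. k x = Some (g x)} \<in> \<U>" by (rule uf_Collect_conj[OF U]) auto
  moreover have "dom k \<subseteq> X" "ran k \<subseteq> Y"
    using k uf_subset[OF U] by (auto simp: partial_continuous_def)
  ultimately show "k \<in> pgerm X \<U> Y g" by (simp add: pgerm_def)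
next
  have fX: "dom f \<subseteq> X" and eq: "{x\<in>X. f x = Some (g x)} \<in> \<U>" using f by (simp_all add: pgerm_def)
  fix k assume k: "k \<in> pgerm X \<U> Y g"
  then have "{x\<in>X. k x = Some (g x)} \<in> \<U>" by (simp add: pgerm_def)
  from eq this have "{x\<in>X. \<exists>y. f x = Some y \<and> k x = Some y} \<in> \<U>"
    by (rule uf_Collect_conj[OF U]) auto
  moreover have "{x\<in>X. \<exists>y. f x = Some y \<and> k x = Some y} = {x. \<exists>y. f x = Some y \<and> k x = Some y}"
    using fX by auto
  ultimately show "k \<in> uf_eq (X, \<U>) (Y, \<V>) `` {f}"
    using pgerm_continuous[OF g f] pgerm_continuous[OF g k] by (simp add: uf_eq_def)
qed

lemma pgerm_total: "g \<in> X \<rightarrow> Y \<Longrightarrow> (\<lambda>x. if x \<in> X then Some (g x) else None) \<in> pgerm X \<U> Y g"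
  using uf_top[OF U] by (auto simp: pgerm_def ran_def dom_def Pi_iff split: if_splits)

lemma partial_continuous_pgerm:
  assumes f: "f \<in> partial_continuous (X, \<U>) (Y, \<V>)"
  shows "\<exists>g\<in>cmap X \<U> Y \<V>. f \<in> pgerm X \<U> Y g"
proof -
  have d: "dom f \<in> \<U>" and rY: "ran f \<subseteq> Y"
    and cont: "\<And>B. B \<subseteq> Y \<Longrightarrow> B \<in> \<V> \<longleftrightarrow> {x. \<exists>y\<in>B. f x = Some y} \<in> \<U>"
    using f by (auto simp: partial_continuous_def)
  have dX: "dom f \<subseteq> X" using d by (rule uf_subset[OF U])
  obtain y0 where y0: "y0 \<in> Y" using uf_nonempty[OF V uf_top[OF V]] by blast
  \<comment> \<open>The default \<open>y0\<close> is taken only off the domain of \<open>f\<close>,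
    and the domain belongs to \<open>\<U>\<close>.\<close>
  define g where "g x = (case f x of Some y \<Rightarrow> y | None \<Rightarrow> y0)" for x
  have "y \<in> Y" if "f x = Some y" for x y using rY ranI[of f, OF that] by blast
  then have gY: "g \<in> X \<rightarrow> Y" using y0 by (auto simp: g_def split: option.split)
  have "{x\<in>X. f x = Some (g x)} = dom f" using dX by (auto simp: g_def split: option.splits)
  then have eq: "{x\<in>X. f x = Some (g x)} \<in> \<U>" using d by simp
  have "{x\<in>X. g x \<in> B} \<in> \<U> \<longleftrightarrow> B \<in> \<V>" if "B \<subseteq> Y" for B
  proof -
    have "{x\<in>X. g x \<in> B} \<in> \<U> \<longleftrightarrow> {x\<in>X. \<exists>y\<in>B. f x = Some y} \<in> \<U>"
      by (intro iffI; erule uf_Collect_conj[OF U _ eq]) auto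
    also have "{x\<in>X. \<exists>y\<in>B. f x = Some y} = {x. \<exists>y\<in>B. f x = Some y}" using dX by auto
    finally show ?thesis using cont[OF that] by simp
  qed
  then have "push X Y g \<U> = \<V>" using uf_subset[OF V] by (auto simp: push_def)
  then have "g \<in> cmap X \<U> Y \<V>" using gY by (simp add: cmap_def)
  moreover have "f \<in> pgerm X \<U> Y g" using dX rY eq by (simp add: pgerm_def)
  ultimately show ?thesis by blast
qed

lemma pgerm_quotient: "partial_continuous (X, \<U>) (Y, \<V>) // uf_eq (X, \<U>) (Y, \<V>) = pgerm X \<U> Y ` cmap X \<U> Y \<V>"
proof (intro equalityI subsetI)
  fix c assume "c \<in> partial_continuous (X, \<U>) (Y, \<V>) // uf_eq (X, \<U>) (Y, \<V>)"
  then obtain f where f: "f \<in> partial_continuous (X, \<U>) (Y, \<V>)" "c = uf_eq (X, \<U>) (Y, \<V>) `` {f}"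
    by (rule quotientE)
  obtain g where g: "g \<in> cmap X \<U> Y \<V>" "f \<in> pgerm X \<U> Y g"
    using partial_continuous_pgerm[OF f(1)] by blast
  then show "c \<in> pgerm X \<U> Y ` cmap X \<U> Y \<V>" unfolding f(2) uf_eq_class[OF g] by blast
next
  fix c assume "c \<in> pgerm X \<U> Y ` cmap X \<U> Y \<V>"
  then obtain g where g: "g \<in> cmap X \<U> Y \<V>" "c = pgerm X \<U> Y g" by blast
  then have f: "(\<lambda>x. if x \<in> X then Some (g x) else None) \<in> pgerm X \<U> Y g"
    by (intro pgerm_total) (simp add: cmap_def)
  show "c \<in> partial_continuous (X, \<U>) (Y, \<V>) // uf_eq (X, \<U>) (Y, \<V>)"
    unfolding g(2) uf_eq_class[OF g(1) f, symmetric] using pgerm_continuous[OF g(1) f] by (rule quotientI)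
qed

lemma pgerm_eq_iff:
  assumes g: "g \<in> cmap X \<U> Y \<V>" and g': "g' \<in> cmap X \<U> Y \<V>"
  shows "pgerm X \<U> Y g = pgerm X \<U> Y g' \<longleftrightarrow> {x\<in>X. g x = g' x} \<in> \<U>"
proof
  let ?f = "\<lambda>x. if x \<in> X then Some (g x) else None"
  have f: "?f \<in> pgerm X \<U> Y g" using g by (intro pgerm_total) (simp add: cmap_def)
  assume "pgerm X \<U> Y g = pgerm X \<U> Y g'"
  then have "{x\<in>X. ?f x = Some (g' x)} \<in> \<U>" using f by (simp add: pgerm_def)
  then show "{x\<in>X. g x = g' x} \<in> \<U>" by (rule uf_Collect_mono[OF U]) simp
next
  assume *: "{x\<in>X. g x = g' x} \<in> \<U>"
  have "{x\<in>X. f x = Some (g x)} \<in> \<U> \<longleftrightarrow> {x\<in>X. f x = Some (g' x)} \<in> \<U>" for f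
    by (intro iffI; erule uf_Collect_conj[OF U _ *]) auto
  then show "pgerm X \<U> Y g = pgerm X \<U> Y g'" by (simp add: pgerm_def)
qed

lemma pgerm_comp:
  assumes g: "g \<in> cmap X \<U> Y \<V>" and f: "f \<in> pgerm X \<U> Y g" and f': "f' \<in> pgerm Y \<V> Z g'"
  shows "f' \<circ>\<^sub>m f \<in> pgerm X \<U> Z (\<lambda>x. g' (g x))"
proof -
  have "{y\<in>Y. f' y = Some (g' y)} \<in> \<V>" using f' by (simp add: pgerm_def)
  then have "{x\<in>X. g x \<in> {y\<in>Y. f' y = Some (g' y)}} \<in> \<U>"
    using g by (auto simp: cmap_def push_def)
  moreover have "{x\<in>X. f x = Some (g x)} \<in> \<U>" using f by (simp add: pgerm_def)
  ultimately have "{x\<in>X. (f' \<circ>\<^sub>m f) x = Some (g' (g x))} \<in> \<U>"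
    by (rule uf_Collect_conj[OF U]) (simp add: map_comp_def)
  moreover have "dom (f' \<circ>\<^sub>m f) \<subseteq> dom f" "ran (f' \<circ>\<^sub>m f) \<subseteq> ran f'"
    by (auto simp: map_comp_def ran_def dom_def split: option.splits)
  ultimately show ?thesis using f f' by (auto simp: pgerm_def)
qed

end

lemma cmap_comp: "g \<in> cmap X \<U> Y \<V> \<Longrightarrow> g' \<in> cmap Y \<V> Z \<W> \<Longrightarrow> (\<lambda>x. g' (g x)) \<in> cmap X \<U> Z \<W>"
  by (auto simp: cmap_def push_push)

lemma cmap_id: "ultrafilter_on X \<U> \<Longrightarrow> (\<lambda>x. x) \<in> cmap X \<U> X \<U>"
  by (simp add: cmap_def push_id)

lemma UF_Ob: "(X, \<U>) \<in> Ob (UF u) \<longleftrightarrow> small u X \<and> ultrafilter_on X \<U>"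
  by (simp add: UF_def)

lemma UF_Hom:
  "ultrafilter_on X \<U> \<Longrightarrow> ultrafilter_on Y \<V> \<Longrightarrow> Hom (UF u) (X, \<U>) (Y, \<V>) = pgerm X \<U> Y ` cmap X \<U> Y \<V>"
  by (simp add: UF_def pgerm_quotient)

lemma UF_Id:
  assumes "ultrafilter_on X \<U>" shows "Id (UF u) (X, \<U>) = pgerm X \<U> X (\<lambda>x. x)"
  using uf_eq_class[OF assms assms cmap_id[OF assms] pgerm_total[OF assms assms]] by (simp add: UF_def)

lemma UF_Comp:
  assumes U: "ultrafilter_on X \<U>" and V: "ultrafilter_on Y \<V>" and W: "ultrafilter_on Z \<W>"
    and g: "g \<in> cmap X \<U> Y \<V>" and g': "g' \<in> cmap Y \<V> Z \<W>"
  shows "Comp (UF u) (X, \<U>) (Y, \<V>) (Z, \<W>) (pgerm Y \<V> Z g') (pgerm X \<U> Y g) = pgerm X \<U> Z (\<lambda>x. g' (g x))"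
proof -
  have eq: "uf_eq (X, \<U>) (Z, \<W>) `` {f' \<circ>\<^sub>m f} = pgerm X \<U> Z (\<lambda>x. g' (g x))"
    if "f' \<in> pgerm Y \<V> Z g'" "f \<in> pgerm X \<U> Y g" for f f'
    using U W cmap_comp[OF g g'] pgerm_comp[OF U V g that(2,1)] by (rule uf_eq_class)
  have "pgerm X \<U> Y g \<noteq> {}" "pgerm Y \<V> Z g' \<noteq> {}"
    using pgerm_total[OF U V, of g] pgerm_total[OF V W, of g'] g g' by (auto simp: cmap_def)
  then have "(\<Union>f'\<in>pgerm Y \<V> Z g'. \<Union>f\<in>pgerm X \<U> Y g. uf_eq (X, \<U>) (Z, \<W>) `` {f' \<circ>\<^sub>m f}) =
      pgerm X \<U> Z (\<lambda>x. g' (g x))"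
    using eq by simp
  then show ?thesis by (simp add: UF_def)
qed

lemma category_UF: "category (UF u)"
  unfolding category_def
proof (intro conjI ballI)
  fix P assume P: "P \<in> Ob (UF u)"
  then obtain X \<U> where P_eq: "P = (X, \<U>)" and U: "ultrafilter_on X \<U>" by (cases P) (auto simp: UF_Ob)
  show "Id (UF u) P \<in> Hom (UF u) P P"
    unfolding P_eq UF_Id[OF U] UF_Hom[OF U U] using cmap_id[OF U] by (rule imageI)
next
  fix P Q R f g assume P: "P \<in> Ob (UF u)" and Q: "Q \<in> Ob (UF u)" and R: "R \<in> Ob (UF u)"
    and f: "f \<in> Hom (UF u) P Q" and g: "g \<in> Hom (UF u) Q R"
  obtain X \<U> where P_eq: "P = (X, \<U>)" and U: "ultrafilter_on X \<U>" using P by (cases P) (auto simp: UF_Ob)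
  obtain Y \<V> where Q_eq: "Q = (Y, \<V>)" and V: "ultrafilter_on Y \<V>" using Q by (cases Q) (auto simp: UF_Ob)
  obtain Z \<W> where R_eq: "R = (Z, \<W>)" and W: "ultrafilter_on Z \<W>" using R by (cases R) (auto simp: UF_Ob)
  obtain f' where f': "f' \<in> cmap X \<U> Y \<V>" "f = pgerm X \<U> Y f'" using f unfolding P_eq Q_eq UF_Hom[OF U V] by blast
  obtain g' where g': "g' \<in> cmap Y \<V> Z \<W>" "g = pgerm Y \<V> Z g'" using g unfolding Q_eq R_eq UF_Hom[OF V W] by blast
  show "Comp (UF u) P Q R g f \<in> Hom (UF u) P R"
    unfolding P_eq Q_eq R_eq f'(2) g'(2) UF_Comp[OF U V W f'(1) g'(1)] UF_Hom[OF U W]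
    using cmap_comp[OF f'(1) g'(1)] by (rule imageI)
next
  fix P Q f assume P: "P \<in> Ob (UF u)" and Q: "Q \<in> Ob (UF u)" and f: "f \<in> Hom (UF u) P Q"
  obtain X \<U> where P_eq: "P = (X, \<U>)" and U: "ultrafilter_on X \<U>" using P by (cases P) (auto simp: UF_Ob)
  obtain Y \<V> where Q_eq: "Q = (Y, \<V>)" and V: "ultrafilter_on Y \<V>" using Q by (cases Q) (auto simp: UF_Ob)
  obtain f' where f': "f' \<in> cmap X \<U> Y \<V>" "f = pgerm X \<U> Y f'" using f unfolding P_eq Q_eq UF_Hom[OF U V] by blast
  show "Comp (UF u) P P Q f (Id (UF u) P) = f"
    unfolding P_eq Q_eq f'(2) UF_Id[OF U] UF_Comp[OF U U V cmap_id[OF U] f'(1)] ..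
  show "Comp (UF u) P Q Q (Id (UF u) Q) f = f"
    unfolding P_eq Q_eq f'(2) UF_Id[OF V] UF_Comp[OF U V V f'(1) cmap_id[OF V]] ..
next
  fix O' P Q R e f g assume O': "O' \<in> Ob (UF u)" and P: "P \<in> Ob (UF u)" and Q: "Q \<in> Ob (UF u)" and R: "R \<in> Ob (UF u)"
    and e: "e \<in> Hom (UF u) O' P" and f: "f \<in> Hom (UF u) P Q" and g: "g \<in> Hom (UF u) Q R"
  obtain A \<A> where O_eq: "O' = (A, \<A>)" and A: "ultrafilter_on A \<A>" using O' by (cases O') (auto simp: UF_Ob)
  obtain X \<U> where P_eq: "P = (X, \<U>)" and U: "ultrafilter_on X \<U>" using P by (cases P) (auto simp: UF_Ob)
  obtain Y \<V> where Q_eq: "Q = (Y, \<V>)" and V: "ultrafilter_on Y \<V>" using Q by (cases Q) (auto simp: UF_Ob)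
  obtain Z \<W> where R_eq: "R = (Z, \<W>)" and W: "ultrafilter_on Z \<W>" using R by (cases R) (auto simp: UF_Ob)
  obtain e' where e': "e' \<in> cmap A \<A> X \<U>" "e = pgerm A \<A> X e'" using e unfolding O_eq P_eq UF_Hom[OF A U] by blast
  obtain f' where f': "f' \<in> cmap X \<U> Y \<V>" "f = pgerm X \<U> Y f'" using f unfolding P_eq Q_eq UF_Hom[OF U V] by blast
  obtain g' where g': "g' \<in> cmap Y \<V> Z \<W>" "g = pgerm Y \<V> Z g'" using g unfolding Q_eq R_eq UF_Hom[OF V W] by blast
  show "Comp (UF u) O' P R (Comp (UF u) P Q R g f) e = Comp (UF u) O' Q R g (Comp (UF u) O' P Q f e)"
    unfolding O_eq P_eq Q_eq R_eq e'(2) f'(2) g'(2) UF_Comp[OF U V W f'(1) g'(1)] UF_Comp[OF A U V e'(1) f'(1)]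
      UF_Comp[OF A U W e'(1) cmap_comp[OF f'(1) g'(1)]] UF_Comp[OF A V W cmap_comp[OF e'(1) f'(1)] g'(1)] ..
qed

section \<open>The equivalence\<close>

text \<open>A morphism from \<open>(Y, \<V>)\<close> to \<open>(X, \<U>)\<close> has a total
  representative, whose germ is an element of type \<open>\<U>\<close> over \<open>X\<close> in the
  ultrapower of \<open>\<V>\<close>; the Yoneda map of this element is the arrow in the opposite
  direction.\<close>

definition upow_ftor :: "'u itself \<Rightarrow> ('u uf, ('u \<rightharpoonup> 'u) set, 'u endo, 'u set \<Rightarrow> 'u \<Rightarrow> 'u) ftor" where
  "upow_ftor u =
     \<lparr>on_ob = (\<lambda>(X, \<U>). upow u X \<U>),
      on_hom = (\<lambda>(X, \<U>) (Y, \<V>) c. yo u X \<U> (upow u Y \<V>)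
        (elt Y \<V> X (inv_into (cmap Y \<V> X \<U>) (pgerm Y \<V> X) c)))\<rparr>"

context
  fixes u :: "'u itself"
  assumes inacc: "inaccessible u"
begin

lemma upow_ftor_ob: "on_ob (upow_ftor u) (X, \<U>) = upow u X \<U>"
  by (simp add: upow_ftor_def)

context
  fixes X Y :: "'u set" and \<U> \<V>
  assumes X: "small u X" and U: "ultrafilter_on X \<U>" and Y: "small u Y" and V: "ultrafilter_on Y \<V>"
begin

lemma elt_cmap: "g \<in> cmap Y \<V> X \<U> \<Longrightarrow> elt Y \<V> X g \<in> on_ob (upow u Y \<V>) X"
    "g \<in> cmap Y \<V> X \<U> \<Longrightarrow> tp (upow u Y \<V>) X (elt Y \<V> X g) = \<U>"
  using elt_in[OF inacc Y V X] tp_elt[OF inacc Y V X] by (simp_all add: cmap_def)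

lemma yo_cmap:
  assumes g: "g \<in> cmap Y \<V> X \<U>" and Z: "small u Z" and k: "k \<in> X \<rightarrow> Z"
  shows "yo u X \<U> (upow u Y \<V>) (elt Y \<V> X g) Z (elt X \<U> Z k) = elt Y \<V> Z (\<lambda>a. k (g a))"
proof -
  have gX: "g \<in> Y \<rightarrow> X" using g by (simp add: cmap_def)
  show ?thesis
    using yo_elt[OF inacc X U upow_in_FC[OF inacc Y V] elt_cmap[OF g] Z k] ap_elt[OF inacc Y V X Z k gX] by simp
qed

lemma upow_ftor_hom:
  assumes g: "g \<in> cmap Y \<V> X \<U>"
  shows "on_hom (upow_ftor u) (X, \<U>) (Y, \<V>) (pgerm Y \<V> X g) = yo u X \<U> (upow u Y \<V>) (elt Y \<V> X g)"
proof -
  let ?k = "inv_into (cmap Y \<V> X \<U>) (pgerm Y \<V> X) (pgerm Y \<V> X g)"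
  have k: "?k \<in> cmap Y \<V> X \<U>" "pgerm Y \<V> X ?k = pgerm Y \<V> X g"
    using inv_into_into[OF imageI[OF g, of "pgerm Y \<V> X"]] f_inv_into_f[OF imageI[OF g, of "pgerm Y \<V> X"]] by simp_all
  then have "{a\<in>Y. ?k a = g a} \<in> \<V>" using pgerm_eq_iff[OF V U k(1) g] by simp
  then have "elt Y \<V> X ?k = elt Y \<V> X g"
    using elt_eq_iff[OF inacc Y V X] k(1) g by (simp add: cmap_def)
  then show ?thesis by (simp add: upow_ftor_def)
qed

text \<open>Two identifications are composed: classes of continuous maps are the elements of type
  \<open>\<U>\<close> over \<open>X\<close> in the ultrapower of \<open>\<V>\<close>, and by Yoneda
  these are the natural transformations.\<close>

lemma upow_ftor_bij:
  "bij_betw (on_hom (upow_ftor u) (X, \<U>) (Y, \<V>)) (Hom (UF u) (Y, \<V>) (X, \<U>)) (Hom (FC u) (upow u X \<U>) (upow u Y \<V>))"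
  unfolding bij_betw_def
proof
  have iX: "(\<lambda>a. a) \<in> X \<rightarrow> X" by simp
  note Yin = upow_in_FC[OF inacc Y V]
  show "inj_on (on_hom (upow_ftor u) (X, \<U>) (Y, \<V>)) (Hom (UF u) (Y, \<V>) (X, \<U>))"
  proof (rule inj_onI)
    fix c c' assume "c \<in> Hom (UF u) (Y, \<V>) (X, \<U>)" "c' \<in> Hom (UF u) (Y, \<V>) (X, \<U>)"
      and eq: "on_hom (upow_ftor u) (X, \<U>) (Y, \<V>) c = on_hom (upow_ftor u) (X, \<U>) (Y, \<V>) c'"
    then obtain g g' where g: "g \<in> cmap Y \<V> X \<U>" "c = pgerm Y \<V> X g"
      and g': "g' \<in> cmap Y \<V> X \<U>" "c' = pgerm Y \<V> X g'"
      unfolding UF_Hom[OF V U] by blast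
    have "yo u X \<U> (upow u Y \<V>) (elt Y \<V> X g) = yo u X \<U> (upow u Y \<V>) (elt Y \<V> X g')"
      using eq unfolding g(2) g'(2) upow_ftor_hom[OF g(1)] upow_ftor_hom[OF g'(1)] .
    then have "yo u X \<U> (upow u Y \<V>) (elt Y \<V> X g) X (elt X \<U> X (\<lambda>a. a)) =
        yo u X \<U> (upow u Y \<V>) (elt Y \<V> X g') X (elt X \<U> X (\<lambda>a. a))" by (rule arg_cong)
    then have "elt Y \<V> X g = elt Y \<V> X g'"
      unfolding yo_cmap[OF g(1) X iX] yo_cmap[OF g'(1) X iX] .
    then have "{a\<in>Y. g a = g' a} \<in> \<V>"
      using elt_eq_iff[OF inacc Y V X] g(1) g'(1) by (simp add: cmap_def)
    then show "c = c'" unfolding g(2) g'(2) pgerm_eq_iff[OF V U g(1) g'(1)] .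
  qed
  show "on_hom (upow_ftor u) (X, \<U>) (Y, \<V>) ` Hom (UF u) (Y, \<V>) (X, \<U>) = Hom (FC u) (upow u X \<U>) (upow u Y \<V>)"
  proof (intro equalityI subsetI)
    fix \<alpha> assume "\<alpha> \<in> on_hom (upow_ftor u) (X, \<U>) (Y, \<V>) ` Hom (UF u) (Y, \<V>) (X, \<U>)"
    then obtain g where g: "g \<in> cmap Y \<V> X \<U>" "\<alpha> = on_hom (upow_ftor u) (X, \<U>) (Y, \<V>) (pgerm Y \<V> X g)"
      unfolding UF_Hom[OF V U] by blast
    show "\<alpha> \<in> Hom (FC u) (upow u X \<U>) (upow u Y \<V>)"
      unfolding g(2) upow_ftor_hom[OF g(1)] using inacc X U Yin elt_cmap[OF g(1)] by (rule yo_Hom)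
  next
    fix \<alpha> assume a: "\<alpha> \<in> Hom (FC u) (upow u X \<U>) (upow u Y \<V>)"
    note ae = Hom_upow_elt[OF inacc X U Yin a]
    obtain g where g: "g \<in> Y \<rightarrow> X" "\<alpha> X (elt X \<U> X (\<lambda>a. a)) = elt Y \<V> X g"
      using elt_cases[OF inacc Y V X ae(1)] by blast
    have "g \<in> cmap Y \<V> X \<U>" using g ae(2) tp_elt[OF inacc Y V X g(1)] by (simp add: cmap_def)
    moreover from this have "\<alpha> = on_hom (upow_ftor u) (X, \<U>) (Y, \<V>) (pgerm Y \<V> X g)"
      using ae(3) g(2) by (simp add: upow_ftor_hom)
    ultimately show "\<alpha> \<in> on_hom (upow_ftor u) (X, \<U>) (Y, \<V>) ` Hom (UF u) (Y, \<V>) (X, \<U>)"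
      unfolding UF_Hom[OF V U] by blast
  qed
qed

end

abbreviation (input) SP where "SP \<equiv> full_subcat (FC u) (small_projective u (FC u))"

lemma SP_simps: "F \<in> Ob SP \<longleftrightarrow> F \<in> Ob (FC u) \<and> small_projective u (FC u) F"
    "Hom SP = Hom (FC u)" "Id SP = Id (FC u)" "Comp SP = Comp (FC u)"
  by (simp_all add: full_subcat_def)

lemma op_simps: "Ob (op_cat C) = Ob C" "Hom (op_cat C) x y = Hom C y x" "Id (op_cat C) = Id C"
    "Comp (op_cat C) x y z g f = Comp C z y x f g"
  by (simp_all add: op_cat_def)

lemma upow_ftor_functor: "is_functor (op_cat (UF u)) SP (upow_ftor u)"
  unfolding is_functor_def op_simps SP_simps
proof (intro conjI ballI)
  fix P assume P: "P \<in> Ob (UF u)"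
  obtain X \<U> where P_eq: "P = (X, \<U>)" and X: "small u X" and U: "ultrafilter_on X \<U>"
    using P by (cases P) (auto simp: UF_Ob)
  show "on_ob (upow_ftor u) P \<in> Ob (FC u)"
    unfolding P_eq upow_ftor_ob using inacc X U by (rule upow_in_FC)
  show "small_projective u (FC u) (on_ob (upow_ftor u) P)"
    unfolding P_eq upow_ftor_ob using inacc X U by (rule upow_small_projective)
  have iX: "(\<lambda>a. a) \<in> X \<rightarrow> X" by simp
  note Xin = upow_in_FC[OF inacc X U] and i = cmap_id[OF U]
  show "on_hom (upow_ftor u) P P (Id (UF u) P) = Id (FC u) (on_ob (upow_ftor u) P)"
    unfolding P_eq upow_ftor_ob UF_Id[OF U] upow_ftor_hom[OF X U X U i]
  proof (rule Hom_upow_eqI[OF inacc X U Xin yo_Hom[OF inacc X U Xin elt_cmap[OF X U X U i]] cat_Id[OF category_FC Xin]])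
    show "yo u X \<U> (upow u X \<U>) (elt X \<U> X (\<lambda>x. x)) X (elt X \<U> X (\<lambda>a. a)) = Id (FC u) (upow u X \<U>) X (elt X \<U> X (\<lambda>a. a))"
      using yo_cmap[OF X U X U i X iX] FC_Id_apply[OF X elt_in[OF inacc X U X iX]] by simp
  qed
next
  fix P Q c assume P: "P \<in> Ob (UF u)" and Q: "Q \<in> Ob (UF u)" and c: "c \<in> Hom (UF u) Q P"
  obtain X \<U> where P_eq: "P = (X, \<U>)" and X: "small u X" and U: "ultrafilter_on X \<U>"
    using P by (cases P) (auto simp: UF_Ob)
  obtain Y \<V> where Q_eq: "Q = (Y, \<V>)" and Y: "small u Y" and V: "ultrafilter_on Y \<V>"
    using Q by (cases Q) (auto simp: UF_Ob)
  show "on_hom (upow_ftor u) P Q c \<in> Hom (FC u) (on_ob (upow_ftor u) P) (on_ob (upow_ftor u) Q)"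
    using bij_betw_apply[OF upow_ftor_bij[OF X U Y V]] c unfolding P_eq Q_eq upow_ftor_ob by blast
next
  fix P Q R c c' assume P: "P \<in> Ob (UF u)" and Q: "Q \<in> Ob (UF u)" and R: "R \<in> Ob (UF u)"
    and c: "c \<in> Hom (UF u) Q P" and c': "c' \<in> Hom (UF u) R Q"
  obtain X \<U> where P_eq: "P = (X, \<U>)" and X: "small u X" and U: "ultrafilter_on X \<U>"
    using P by (cases P) (auto simp: UF_Ob)
  obtain Y \<V> where Q_eq: "Q = (Y, \<V>)" and Y: "small u Y" and V: "ultrafilter_on Y \<V>"
    using Q by (cases Q) (auto simp: UF_Ob)
  obtain Z \<W> where R_eq: "R = (Z, \<W>)" and Z: "small u Z" and W: "ultrafilter_on Z \<W>"
    using R by (cases R) (auto simp: UF_Ob)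
  obtain g where g: "g \<in> cmap Y \<V> X \<U>" "c = pgerm Y \<V> X g" using c unfolding P_eq Q_eq UF_Hom[OF V U] by blast
  obtain h where h: "h \<in> cmap Z \<W> Y \<V>" "c' = pgerm Z \<W> Y h" using c' unfolding Q_eq R_eq UF_Hom[OF W V] by blast
  have iX: "(\<lambda>a. a) \<in> X \<rightarrow> X" by simp
  have gX: "g \<in> Y \<rightarrow> X" using g by (simp add: cmap_def)
  note gh = cmap_comp[OF h(1) g(1)]
  note Xin = upow_in_FC[OF inacc X U] and Yin = upow_in_FC[OF inacc Y V] and Zin = upow_in_FC[OF inacc Z W]
  note yg = yo_Hom[OF inacc X U Yin elt_cmap[OF X U Y V g(1)]]
  note yh = yo_Hom[OF inacc Y V Zin elt_cmap[OF Y V Z W h(1)]]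
  note ygh = yo_Hom[OF inacc X U Zin elt_cmap[OF X U Z W gh]]
  show "on_hom (upow_ftor u) P R (Comp (UF u) R Q P c c') =
      Comp (FC u) (on_ob (upow_ftor u) P) (on_ob (upow_ftor u) Q) (on_ob (upow_ftor u) R)
        (on_hom (upow_ftor u) Q R c') (on_hom (upow_ftor u) P Q c)"
    unfolding P_eq Q_eq R_eq upow_ftor_ob g(2) h(2) UF_Comp[OF W V U h(1) g(1)]
      upow_ftor_hom[OF X U Y V g(1)] upow_ftor_hom[OF Y V Z W h(1)] upow_ftor_hom[OF X U Z W gh]
  proof (rule Hom_upow_eqI[OF inacc X U Zin ygh cat_Comp[OF category_FC Xin Yin Zin yg yh]])
    show "yo u X \<U> (upow u Z \<W>) (elt Z \<W> X (\<lambda>x. g (h x))) X (elt X \<U> X (\<lambda>a. a)) =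
        Comp (FC u) (upow u X \<U>) (upow u Y \<V>) (upow u Z \<W>) (yo u Y \<V> (upow u Z \<W>) (elt Z \<W> Y h))
          (yo u X \<U> (upow u Y \<V>) (elt Y \<V> X g)) X (elt X \<U> X (\<lambda>a. a))"
      using yo_cmap[OF X U Z W gh X iX] yo_cmap[OF X U Y V g(1) X iX] yo_cmap[OF Y V Z W h(1) X gX]
        FC_Comp_apply[OF X elt_in[OF inacc X U X iX]] by simp
  qed
qed

lemma UF_op_equivalent: "equivalent_categories (op_cat (UF u)) SP"
proof (rule equivalent_categoriesI[OF category_op[OF category_UF] category_full_subcat[OF category_FC] upow_ftor_functor])
  fix P Q assume "P \<in> Ob (op_cat (UF u))" "Q \<in> Ob (op_cat (UF u))"
  then obtain X \<U> Y \<V> where P: "P = (X, \<U>)" "small u X" "ultrafilter_on X \<U>"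
    and Q: "Q = (Y, \<V>)" "small u Y" "ultrafilter_on Y \<V>"
    by (cases P; cases Q) (auto simp: UF_Ob op_simps)
  show "bij_betw (on_hom (upow_ftor u) P Q) (Hom (op_cat (UF u)) P Q)
      (Hom SP (on_ob (upow_ftor u) P) (on_ob (upow_ftor u) Q))"
    unfolding P(1) Q(1) op_simps SP_simps upow_ftor_ob using P(2,3) Q(2,3) by (rule upow_ftor_bij)
next
  fix F assume "F \<in> Ob SP"
  then have F: "F \<in> Ob (FC u)" and sp: "small_projective u (FC u) F" by (simp_all add: SP_simps)
  obtain L \<U> \<phi> where "small u L" "ultrafilter_on L \<U>" and iso: "is_iso (FC u) (upow u L \<U>) F \<phi>"
    using inacc F sp by (rule small_projective_is_upow)
  then have "(L, \<U>) \<in> Ob (op_cat (UF u))" by (simp add: op_simps UF_Ob)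
  moreover have "is_iso SP (on_ob (upow_ftor u) (L, \<U>)) F \<phi>"
    using iso by (simp add: is_iso_def SP_simps upow_ftor_ob)
  ultimately show "\<exists>P\<in>Ob (op_cat (UF u)). \<exists>\<phi>. is_iso SP (on_ob (upow_ftor u) P) F \<phi>" by blast
qed

end

theorem corollary15:
  assumes "inaccessible TYPE('u)"
  shows "equivalent_categories
           (op_cat (UF TYPE('u)))
           (full_subcat (FC TYPE('u)) (small_projective TYPE('u) (FC TYPE('u))))"
  using assms by (rule UF_op_equivalent)

end
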